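(* Let $n\ge 1$, let $\lambda=(\lambda_1,\lambda_2,\ldots)\vdash n$ be a partition of $n$, and let $r$ be an integer with $1\le r\le n-\lambda_2$. Let $\varrho$ be the defining (permutation) representation of $S_n$, and let $a_{\lambda,r}$ denote the multiplicity of the irreducible representation $S^{\lambda}$ in the decomposition of $\varrho^{\otimes r}$ into irreducible representations of $S_n$. Then $$a_{\lambda,r}=f^{\bar\lambda}\sum_{i=|\bar\lambda|}^{r}\binom{i}{|\bar\lambda|}\genfrac\{\}{0pt}{}{r}{i},$$ where $\bar\lambda=(\lambda_2,\lambda_3,\ldots)$ has weight $|\bar\lambda|=\lambda_2+\lambda_3+\cdots$, $f^{\bar\lambda}$ is the number of standard Young tableaux of shape $\bar\lambda$, and $\genfrac\{\}{0pt}{}{r}{i}$ is the Stirling number of the second kind.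
   Context: Representations are finite-dimensional complex representations. The defining representation $\varrho$ of the symmetric group $S_n$ is the $n$-dimensional representation by permutation matrices: $(\varrho(\sigma))_{i,j}=1$ if $\sigma(j)=i$ and $0$ otherwise. $\varrho^{\otimes r}$ is its $r$-th tensor power with the diagonal action of $S_n$. The irreducible representations of $S_n$ are indexed by the partitions $\lambda=(\lambda_1\ge\lambda_2\ge\cdots)$ of $n$; $S^{\lambda}$ denotes the Specht module attached to $\lambda$, in the standard convention in which $S^{(n)}$ is the trivial representation and $\varrho\cong S^{(n-1,1)}\oplus S^{(n)}$ (for $n\ge2$). Parts beyond the length of $\lambda$ are $0$; in particular $\lambda_2=0$ and $\bar\lambda=\emptyset$ when $\lambda=(n)$, and $f^{\emptyset}=1$. The Stirling number of the second kind $\genfrac\{\}{0pt}{}{r}{i}$ is the number of partitions of an $r$-element set into $i$ nonempty blocks. A sum whose lower limit exceeds its upper limit is $0$. *)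

theory Defs
  imports
    Complex_Main
    "HOL-Library.Function_Algebras"
    "HOL-Library.FuncSet"
    "HOL-Library.Indicator_Function"
    "HOL-Combinatorics.Combinatorics"
    "HOL-Algebra.Sym_Groups"
begin

section \<open>Complex representations on spaces of functions\<close>

text \<open>
  All representation spaces are finite-dimensional subspaces of a space of functions
  \<^typ>\<open>'a \<Rightarrow> complex\<close>, with the pointwise operations.
\<close>

definition cscale :: "complex \<Rightarrow> ('a \<Rightarrow> complex) \<Rightarrow> 'a \<Rightarrow> complex"
  where "cscale c v = (\<lambda>x. c * v x)"

global_interpretation cfun: vector_space cscale
  by unfold_locales (auto simp: cscale_def fun_eq_iff algebra_simps)

definition linear_map_on ::
    "('a \<Rightarrow> complex) set \<Rightarrow> ('b \<Rightarrow> complex) set \<Rightarrow> (('a \<Rightarrow> complex) \<Rightarrow> 'b \<Rightarrow> complex) \<Rightarrow> bool"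
  where "linear_map_on V W f \<longleftrightarrow>
    f \<in> V \<rightarrow> W \<and>
    (\<forall>u\<in>V. \<forall>v\<in>V. f (u + v) = f u + f v) \<and>
    (\<forall>c. \<forall>v\<in>V. f (cscale c v) = cscale c (f v))"

text \<open>Only the restriction of the action to the representation space is relevant.\<close>

record ('g, 'a) grep =
  rspace :: "('a \<Rightarrow> complex) set"
  ract :: "'g \<Rightarrow> ('a \<Rightarrow> complex) \<Rightarrow> 'a \<Rightarrow> complex"

definition is_rep :: "'g monoid \<Rightarrow> ('g, 'a) grep \<Rightarrow> bool"
  where "is_rep G R \<longleftrightarrow>
    group G \<and>
    cfun.subspace (rspace R) \<and>
    (\<exists>B. finite B \<and> rspace R = cfun.span B) \<and>
    (\<forall>g\<in>carrier G. linear_map_on (rspace R) (rspace R) (ract R g)) \<and>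
    (\<forall>v\<in>rspace R. ract R \<one>\<^bsub>G\<^esub> v = v) \<and>
    (\<forall>g\<in>carrier G. \<forall>h\<in>carrier G. \<forall>v\<in>rspace R.
      ract R (g \<otimes>\<^bsub>G\<^esub> h) v = ract R g (ract R h v))"

definition invariant_subspace :: "'g monoid \<Rightarrow> ('g, 'a) grep \<Rightarrow> ('a \<Rightarrow> complex) set \<Rightarrow> bool"
  where "invariant_subspace G R W \<longleftrightarrow>
    cfun.subspace W \<and> W \<subseteq> rspace R \<and> (\<forall>g\<in>carrier G. ract R g ` W \<subseteq> W)"

definition irreducible_rep :: "'g monoid \<Rightarrow> ('g, 'a) grep \<Rightarrow> bool"
  where "irreducible_rep G R \<longleftrightarrow>
    is_rep G R \<and> rspace R \<noteq> {0} \<and>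
    (\<forall>W. invariant_subspace G R W \<longrightarrow> W = {0} \<or> W = rspace R)"

definition subrep :: "('g, 'a) grep \<Rightarrow> ('a \<Rightarrow> complex) set \<Rightarrow> ('g, 'a) grep"
  where "subrep R W = R\<lparr>rspace := W\<rparr>"

definition rep_iso :: "'g monoid \<Rightarrow> ('g, 'a) grep \<Rightarrow> ('g, 'b) grep \<Rightarrow> bool"
  where "rep_iso G R S \<longleftrightarrow>
    (\<exists>f. linear_map_on (rspace R) (rspace S) f \<and> bij_betw f (rspace R) (rspace S) \<and>
      (\<forall>g\<in>carrier G. \<forall>v\<in>rspace R. f (ract R g v) = ract S g (f v)))"

text \<open>
  An internal direct sum decomposition into irreducible subrepresentations. Distinct summands are
  distinct subspaces, so a finite set of subspaces suffices.
\<close>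

definition irreducible_decomposition ::
    "'g monoid \<Rightarrow> ('g, 'a) grep \<Rightarrow> ('a \<Rightarrow> complex) set set \<Rightarrow> bool"
  where "irreducible_decomposition G R \<W> \<longleftrightarrow>
    finite \<W> \<and>
    (\<forall>W\<in>\<W>. invariant_subspace G R W \<and> irreducible_rep G (subrep R W)) \<and>
    (\<forall>v\<in>rspace R. \<exists>!w. w \<in> (\<Pi>\<^sub>E W\<in>\<W>. W) \<and> v = (\<Sum>W\<in>\<W>. w W))"

text \<open>
  The multiplicity of \<open>S\<close> in \<open>R\<close> is the number of summands isomorphic to \<open>S\<close> in a decomposition of
  \<open>R\<close> into irreducibles; for a finite group a decomposition exists, and this number is independent
  of its choice.
\<close>

definition rep_multiplicity :: "'g monoid \<Rightarrow> ('g, 'b) grep \<Rightarrow> ('g, 'a) grep \<Rightarrow> nat"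
  where "rep_multiplicity G S R =
    (THE m. \<exists>\<W>. irreducible_decomposition G R \<W> \<and> m = card {W\<in>\<W>. rep_iso G S (subrep R W)})"


section \<open>Matrix representations and their tensor powers\<close>

definition coord_space :: "'x set \<Rightarrow> ('x \<Rightarrow> complex) set"
  where "coord_space X = {v. \<forall>x. x \<notin> X \<longrightarrow> v x = 0}"

definition mat_vec :: "'x set \<Rightarrow> ('x \<Rightarrow> 'x \<Rightarrow> complex) \<Rightarrow> ('x \<Rightarrow> complex) \<Rightarrow> 'x \<Rightarrow> complex"
  where "mat_vec X A v = (\<lambda>i. if i \<in> X then \<Sum>j\<in>X. A i j * v j else 0)"

definition matrix_rep :: "'x set \<Rightarrow> ('g \<Rightarrow> 'x \<Rightarrow> 'x \<Rightarrow> complex) \<Rightarrow> ('g, 'x) grep"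
  where "matrix_rep X M = \<lparr>rspace = coord_space X, ract = (\<lambda>g. mat_vec X (M g))\<rparr>"

text \<open>
  The \<open>r\<close>-th tensor power of the space with basis \<open>X\<close> has the basis
  \<open>e\<^bsub>x\<^sub>1\<^esub> \<otimes> \<dots> \<otimes> e\<^bsub>x\<^sub>r\<^esub>\<close>, indexed by the lists of length \<open>r\<close> over \<open>X\<close>. In this basis the diagonal
  action is given by the Kronecker powers of the matrices; lemma \<open>tensor_power_pure\<close> below
  confirms that \<open>g\<close> maps \<open>v\<^sub>1 \<otimes> \<dots> \<otimes> v\<^sub>r\<close> to \<open>g v\<^sub>1 \<otimes> \<dots> \<otimes> g v\<^sub>r\<close>.
\<close>

definition words :: "'x set \<Rightarrow> nat \<Rightarrow> 'x list set"
  where "words X r = {xs. set xs \<subseteq> X \<and> length xs = r}"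

definition tensor_power :: "'x set \<Rightarrow> ('g \<Rightarrow> 'x \<Rightarrow> 'x \<Rightarrow> complex) \<Rightarrow> nat \<Rightarrow> ('g, 'x list) grep"
  where "tensor_power X M r = matrix_rep (words X r) (\<lambda>g I J. \<Prod>k<r. M g (I ! k) (J ! k))"

definition pure_tensor :: "('x \<Rightarrow> complex) list \<Rightarrow> 'x list \<Rightarrow> complex"
  where "pure_tensor vs =
    (\<lambda>I. if length I = length vs then \<Prod>k<length vs. (vs ! k) (I ! k) else 0)"

lemma words_Suc: "words X (Suc r) = (\<lambda>(x, xs). x # xs) ` (X \<times> words X r)"
  by (auto simp: words_def length_Suc_conv image_iff)

lemma prod_sum_words:
  fixes a :: "nat \<Rightarrow> 'x \<Rightarrow> complex"
  shows "(\<Sum>J\<in>words X r. \<Prod>k<r. a k (J ! k)) = (\<Prod>k<r. \<Sum>x\<in>X. a k x)"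
proof (induction r arbitrary: a)
  case 0
  have "words X 0 = {[]}" by (auto simp: words_def)
  then show ?case by simp
next
  case (Suc r)
  have "(\<Sum>J\<in>words X (Suc r). \<Prod>k<Suc r. a k (J ! k)) =
      (\<Sum>(x, xs)\<in>X \<times> words X r. \<Prod>k<Suc r. a k ((x # xs) ! k))"
    unfolding words_Suc by (subst sum.reindex) (auto simp: inj_on_def split_def)
  also have "\<dots> = (\<Sum>(x, xs)\<in>X \<times> words X r. a 0 x * (\<Prod>k<r. a (Suc k) (xs ! k)))"
    by (simp add: prod.lessThan_Suc_shift split_def del: prod.lessThan_Suc)
  also have "\<dots> = (\<Sum>x\<in>X. a 0 x) * (\<Sum>xs\<in>words X r. \<Prod>k<r. a (Suc k) (xs ! k))"
    by (simp add: sum_product sum.cartesian_product)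
  also have "\<dots> = (\<Prod>k<Suc r. \<Sum>x\<in>X. a k x)"
    by (simp add: Suc.IH[of "\<lambda>k. a (Suc k)"] prod.lessThan_Suc_shift del: prod.lessThan_Suc)
  finally show ?case .
qed

lemma tensor_power_pure:
  assumes "set vs \<subseteq> coord_space X"
  shows "ract (tensor_power X M (length vs)) g (pure_tensor vs) =
    pure_tensor (map (ract (matrix_rep X M) g) vs)"
proof
  fix I
  let ?r = "length vs"
  show "ract (tensor_power X M ?r) g (pure_tensor vs) I =
    pure_tensor (map (ract (matrix_rep X M) g) vs) I"
  proof (cases "I \<in> words X ?r")
    case True
    then have I: "length I = ?r" "\<And>k. k < ?r \<Longrightarrow> I ! k \<in> X"
      by (auto simp: words_def)
    have "ract (tensor_power X M ?r) g (pure_tensor vs) I =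
      (\<Sum>J\<in>words X ?r. (\<Prod>k<?r. M g (I ! k) (J ! k)) * pure_tensor vs J)"
      using True by (simp add: tensor_power_def matrix_rep_def mat_vec_def)
    also have "\<dots> = (\<Sum>J\<in>words X ?r. \<Prod>k<?r. M g (I ! k) (J ! k) * (vs ! k) (J ! k))"
      by (rule sum.cong) (auto simp: words_def pure_tensor_def prod.distrib)
    also have "\<dots> = (\<Prod>k<?r. \<Sum>x\<in>X. M g (I ! k) x * (vs ! k) x)"
      by (rule prod_sum_words)
    also have "\<dots> = pure_tensor (map (ract (matrix_rep X M) g) vs) I"
      using I by (simp add: pure_tensor_def matrix_rep_def mat_vec_def)
    finally show ?thesis .
  next
    case False
    have "pure_tensor (map (ract (matrix_rep X M) g) vs) I = 0"
    proof (cases "length I = ?r")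
      case True
      then obtain k where "k < ?r" "I ! k \<notin> X"
        using False by (auto simp: words_def set_conv_nth)
      then show ?thesis
        using True by (auto simp: pure_tensor_def matrix_rep_def mat_vec_def)
    qed (simp add: pure_tensor_def)
    then show ?thesis
      using False by (simp add: tensor_power_def matrix_rep_def mat_vec_def)
  qed
qed

definition perm_matrix :: "('x \<Rightarrow> 'x) \<Rightarrow> 'x \<Rightarrow> 'x \<Rightarrow> complex"
  where "perm_matrix \<sigma> i j = (if \<sigma> j = i then 1 else 0)"

definition defining_rep :: "nat \<Rightarrow> (nat \<Rightarrow> nat, nat) grep"
  where "defining_rep n = matrix_rep {1..n} perm_matrix"

definition defining_rep_power :: "nat \<Rightarrow> nat \<Rightarrow> (nat \<Rightarrow> nat, nat list) grep"
  where "defining_rep_power n r = tensor_power {1..n} perm_matrix r"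

lemma defining_rep_power_pure:
  assumes "set vs \<subseteq> rspace (defining_rep n)"
  shows "ract (defining_rep_power n (length vs)) \<sigma> (pure_tensor vs) =
    pure_tensor (map (ract (defining_rep n) \<sigma>) vs)"
  using tensor_power_pure[of vs "{1..n}" perm_matrix \<sigma>] assms
  by (simp add: defining_rep_def defining_rep_power_def matrix_rep_def)


section \<open>Partitions and tableaux\<close>

text \<open>
  A partition is the weakly decreasing list of its positive parts; \<open>part \<lambda> i\<close> is the
  \<open>i\<close>-th part for \<open>i \<ge> 1\<close>. Cells are indexed from \<open>(0, 0)\<close>, as (row, column).
\<close>

definition partition_of :: "nat list \<Rightarrow> nat \<Rightarrow> bool"
  where "partition_of lam n \<longleftrightarrow> sorted_wrt (\<ge>) lam \<and> 0 \<notin> set lam \<and> sum_list lam = n"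

definition part :: "nat list \<Rightarrow> nat \<Rightarrow> nat"
  where "part lam i = (if 1 \<le> i \<and> i \<le> length lam then lam ! (i - 1) else 0)"

definition cells :: "nat list \<Rightarrow> (nat \<times> nat) set"
  where "cells lam = {(i, j). i < length lam \<and> j < lam ! i}"

definition tableau :: "nat list \<Rightarrow> (nat \<times> nat \<Rightarrow> nat) \<Rightarrow> bool"
  where "tableau lam t \<longleftrightarrow> bij_betw t (cells lam) {1..sum_list lam}"

definition standard_tableaux :: "nat list \<Rightarrow> (nat \<times> nat \<Rightarrow> nat) set"
  where "standard_tableaux lam = {t \<in> extensional (cells lam).
    tableau lam t \<and>
    (\<forall>i j k. (i, j) \<in> cells lam \<and> (i, k) \<in> cells lam \<and> j < k \<longrightarrow> t (i, j) < t (i, k)) \<and>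
    (\<forall>i j k. (i, k) \<in> cells lam \<and> (j, k) \<in> cells lam \<and> i < j \<longrightarrow> t (i, k) < t (j, k))}"

definition num_standard_tableaux :: "nat list \<Rightarrow> nat"
  where "num_standard_tableaux lam = card (standard_tableaux lam)"


section \<open>Specht modules\<close>

text \<open>A tabloid is represented by the list of the sets of entries of its rows.\<close>

definition tabloid :: "nat list \<Rightarrow> (nat \<times> nat \<Rightarrow> nat) \<Rightarrow> nat set list"
  where "tabloid lam t = map (\<lambda>i. {t (i, j) | j. (i, j) \<in> cells lam}) [0..<length lam]"

definition column_stabilizer :: "nat list \<Rightarrow> (nat \<times> nat \<Rightarrow> nat) \<Rightarrow> (nat \<Rightarrow> nat) set"
  where "column_stabilizer lam t = {\<sigma>. \<sigma> permutes {1..sum_list lam} \<and>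
    (\<forall>j. \<sigma> ` {t (i, j) | i. (i, j) \<in> cells lam} = {t (i, j) | i. (i, j) \<in> cells lam})}"

text \<open>
  The formal complex combinations of tabloids are functions on tabloids, with \<^term>\<open>indicator {T}\<close>
  as the basis vector of the tabloid \<open>T\<close>.
\<close>

definition polytabloid :: "nat list \<Rightarrow> (nat \<times> nat \<Rightarrow> nat) \<Rightarrow> nat set list \<Rightarrow> complex"
  where "polytabloid lam t =
    (\<Sum>\<sigma>\<in>column_stabilizer lam t. cscale (of_int (sign \<sigma>)) (indicator {tabloid lam (\<sigma> \<circ> t)}))"

text \<open>
  \<open>\<sigma>\<close> maps the basis vector of a tabloid \<open>T\<close> to that of \<open>\<sigma>T\<close>; on coefficient functions this is
  \<open>F \<mapsto> (T \<mapsto> F (\<sigma>\<^sup>-\<^sup>1 T))\<close>.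
\<close>

definition specht :: "nat list \<Rightarrow> (nat \<Rightarrow> nat, nat set list) grep"
  where "specht lam = \<lparr>
    rspace = cfun.span {polytabloid lam t | t. tableau lam t},
    ract = (\<lambda>\<sigma> F T. F (map ((`) (inv_into UNIV \<sigma>)) T))\<rparr>"

end

theory Submission
  imports Defs "HOL-Library.Infinite_Set"
begin

text \<open>
  Schur's lemma turns the multiplicity into the dimension of the space of homomorphisms from the
  Specht module to the tensor power. Fix a tableau \<open>t\<close>. A homomorphism is determined by the image of
  the polytabloid of \<open>t\<close>, a function on words. A word is read as a filling of the shape: the entry
  \<open>x\<close> of \<open>t\<close> is labelled by the position of \<open>x\<close>, counted from the end, in the list of the distinct
  letters of the word, and by \<open>0\<close> if it does not occur. By the Garnir relations the image vanishes if it vanishes on the words with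
  semistandard filling, and the images of the orbit sums form a triangular system on these words, so
  the dimension is their number. Applied to tabloids instead of words, the same argument shows that
  the endomorphisms of the Specht module are scalars, hence that it is irreducible.

  Semistandardness depends only on the list \<open>d\<close> of the distinct letters, and a list of length \<open>i\<close>
  arises from \<open>Stirling r i\<close> words of length \<open>r\<close>. For \<open>i \<le> n - \<lambda>\<^sub>2\<close> the first \<open>n - i \<ge> \<lambda>\<^sub>2\<close> cells of
  the first row are labelled \<open>0\<close>, so the rows below it carry an arbitrary standard filling with a
  subset of \<open>{1..i}\<close>, which determines the rest of the first row.
\<close>

section \<open>Spaces of functions\<close>

text \<open>Behind the count stands Young's rule. For \<open>i \<le> n\<close> the words with
  \<open>i\<close> distinct letters form \<open>Stirling r i\<close> orbits, each affording the
  permutation module of type \<open>(n - i, 1, ..., 1)\<close>, and the semistandard fillings of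
  \<lambda> with \<open>n - i\<close> labels \<open>0\<close> and one each of
  \<open>1, ..., i\<close> are counted by the Kostka number of that content. The representation
  theory never separates these orbits; the labelling treats all words at once.
  \<open>rep_multiplicity\<close> is a definite description, so both the existence of a
  decomposition and the independence of its choice must be proved. Existence comes from an invariant
  inner product, independence from the fact that the dimension of the homomorphism space does not
  mention a decomposition. The scalars in Schur's lemma are not obtained from eigenvalues, but from
  the fact that \<lambda> has only one semistandard filling of content \<lambda>. In place of the
  dominance order on fillings there is an integer moment, the sum of column (or row) index times
  label. The same moment drives the elimination by Garnir relations, which bounds the dimension
  above, and the triangularity, which bounds it below.\<close>

lemma sum_apply: "(\<Sum>i\<in>I. f i) x = (\<Sum>i\<in>I. f i x)"
  by (induction I rule: infinite_finite_induct) auto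

lemma cscale_apply [simp]: "cscale c v x = c * v x"
  by (simp add: cscale_def)

lemma subspace_coord_space: "cfun.subspace (coord_space X)"
  by (auto simp: cfun.subspace_def coord_space_def)

lemma coord_space_expand:
  assumes "finite X" "v \<in> coord_space X"
  shows "v = (\<Sum>x\<in>X. cscale (v x) (indicator {x}))"
proof
  fix y
  show "v y = (\<Sum>x\<in>X. cscale (v x) (indicator {x})) y"
    using assms by (cases "y \<in> X") (auto simp: sum_apply coord_space_def indicator_def)
qed

lemma coord_space_span:
  assumes "finite X"
  shows "coord_space X = cfun.span ((\<lambda>x. indicator {x}) ` X)"
proof
  show "coord_space X \<subseteq> cfun.span ((\<lambda>x. indicator {x}) ` X)"
  proof
    fix v :: "'a \<Rightarrow> complex" assume v: "v \<in> coord_space X"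
    have "(\<Sum>x\<in>X. cscale (v x) (indicator {x})) \<in> cfun.span ((\<lambda>x. indicator {x}) ` X)"
      by (intro cfun.span_sum cfun.span_scale cfun.span_base) auto
    then show "v \<in> cfun.span ((\<lambda>x. indicator {x}) ` X)"
      using coord_space_expand[OF assms v] by simp
  qed
  show "cfun.span ((\<lambda>x. indicator {x}) ` X) \<subseteq> coord_space X"
    by (rule cfun.span_minimal[OF _ subspace_coord_space])
       (auto simp: coord_space_def indicator_def)
qed

lemma subspace_finite_basis:
  assumes "finite X" "V \<subseteq> coord_space X"
  obtains B where "finite B" "B \<subseteq> V" "V \<subseteq> cfun.span B" "cfun.independent B" "card B = cfun.dim V"
proof -
  obtain B where B: "B \<subseteq> V" "cfun.independent B" "V \<subseteq> cfun.span B" "card B = cfun.dim V"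
    using cfun.basis_exists by blast
  have "B \<subseteq> cfun.span ((\<lambda>x. indicator {x}) ` X)"
    using B(1) assms coord_space_span by auto
  then have "finite B"
    using cfun.independent_span_bound[OF _ B(2)] assms(1) by blast
  then show ?thesis using B that by blast
qed

lemma independent_card_le_dim:
  assumes "finite X" "V \<subseteq> coord_space X" "B \<subseteq> V" "cfun.independent B"
  shows "card B \<le> cfun.dim V" "finite B"
proof -
  obtain C where "finite C" "V \<subseteq> cfun.span C" "card C = cfun.dim V"
    using subspace_finite_basis[OF assms(1,2)] by metis
  then show "card B \<le> cfun.dim V" "finite B"
    using cfun.independent_span_bound[of C B] assms by auto
qed

lemma dim_psubset_coord_space:
  assumes "finite X" "V \<subseteq> coord_space X" "U \<subset> V" "cfun.subspace U"
  shows "cfun.dim U < cfun.dim V"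
proof -
  obtain u where u: "u \<in> V" "u \<notin> U" using assms(3) by auto
  obtain B where B: "finite B" "B \<subseteq> U" "U \<subseteq> cfun.span B" "cfun.independent B" "card B = cfun.dim U"
    using subspace_finite_basis[OF assms(1), of U] assms(2,3) by (metis order_trans psubset_imp_subset)
  have "cfun.span B \<subseteq> U" using B(2) assms(4) by (rule cfun.span_minimal)
  then have "u \<notin> cfun.span B" using u by auto
  then have "cfun.independent (insert u B)" "u \<notin> B"
    using B(4) cfun.independent_insertI cfun.span_base by blast+
  moreover have "insert u B \<subseteq> V" using B u assms(3) by auto
  ultimately show ?thesis
    using independent_card_le_dim(1)[OF assms(1,2), of "insert u B"] B by simp
qed

text \<open>Stated for an indexed family so that it also yields injectivity: the dimension counts
  need \<open>card I\<close> itself, not merely the size of the image.\<close>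

lemma independent_image:
  assumes "finite I"
    and zero: "\<And>c i. (\<Sum>i\<in>I. cscale (c i) (b i)) = 0 \<Longrightarrow> i \<in> I \<Longrightarrow> c i = 0"
  shows "inj_on b I" "cfun.independent (b ` I)"
proof -
  show inj: "inj_on b I"
  proof (rule inj_onI, rule ccontr)
    fix i j assume ij: "i \<in> I" "j \<in> I" "b i = b j" "i \<noteq> j"
    \<comment> \<open>Two indices with the same vector would give a relation with coefficients
      \<open>1\<close> and \<open>-1\<close>.\<close>
    define c :: "_ \<Rightarrow> complex" where "c k = (if k = i then 1 else if k = j then -1 else 0)" for k
    have "(\<Sum>k\<in>I. cscale (c k) (b k)) = (\<Sum>k\<in>{i, j}. cscale (c k) (b k))"
      by (rule sum.mono_neutral_right) (use ij assms(1) in \<open>auto simp: c_def fun_eq_iff\<close>)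
    also have "\<dots> = 0" using ij by (simp add: c_def fun_eq_iff)
    finally show False using zero[of c i] ij by (simp add: c_def)
  qed
  show "cfun.independent (b ` I)"
  proof (rule cfun.independent_if_scalars_zero)
    fix f v assume f: "(\<Sum>x\<in>b ` I. cscale (f x) x) = 0" and "v \<in> b ` I"
    then obtain i where i: "v = b i" "i \<in> I" by blast
    have "(\<Sum>i\<in>I. cscale (f (b i)) (b i)) = 0"
      using f sum.reindex[OF inj, of "\<lambda>x. cscale (f x) x"] by simp
    then show "f v = 0" using zero[of "f \<circ> b" i] i by simp
  qed (use assms(1) in simp)
qed

section \<open>Orthogonal projection for the standard inner product\<close>

definition inner_on :: "'a set \<Rightarrow> ('a \<Rightarrow> complex) \<Rightarrow> ('a \<Rightarrow> complex) \<Rightarrow> complex"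
  where "inner_on X u v = (\<Sum>x\<in>X. u x * cnj (v x))"

lemma inner_on_add_left: "inner_on X (u + v) w = inner_on X u w + inner_on X v w"
  and inner_on_diff_left: "inner_on X (u - v) w = inner_on X u w - inner_on X v w"
  and inner_on_scale_left: "inner_on X (cscale c u) w = c * inner_on X u w"
  and inner_on_add_right: "inner_on X w (u + v) = inner_on X w u + inner_on X w v"
  and inner_on_scale_right: "inner_on X w (cscale c u) = cnj c * inner_on X w u"
  and inner_on_zero [simp]: "inner_on X 0 w = 0" "inner_on X w 0 = 0"
  by (simp_all add: inner_on_def sum.distrib sum_subtractf algebra_simps sum_distrib_left)

lemma inner_on_commute: "inner_on X u v = cnj (inner_on X v u)"
  by (simp add: inner_on_def mult.commute)

lemma inner_on_self_eq_0:
  assumes "finite X" "v \<in> coord_space X" "inner_on X v v = 0"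
  shows "v = 0"
proof -
  have "complex_of_real (\<Sum>x\<in>X. (cmod (v x))\<^sup>2) = 0"
    using assms(3) by (simp add: inner_on_def complex_norm_square[symmetric] del: of_real_power)
  then have "(\<Sum>x\<in>X. (cmod (v x))\<^sup>2) = 0"
    by (simp only: of_real_eq_0_iff)
  then have "\<forall>x\<in>X. v x = 0"
    using assms(1) by (simp add: sum_nonneg_eq_0_iff)
  then show ?thesis using assms(2) by (auto simp: coord_space_def fun_eq_iff)
qed

text \<open>Gram-Schmidt without normalization: the new generator \<open>b\<close> is replaced by
  \<open>b - p\<close>, which is orthogonal to the span of the others, and the projection of
  \<open>v\<close> is corrected by a multiple of \<open>b - p\<close>. The induction is over all
  \<open>v\<close>, because its hypothesis serves for \<open>b\<close> as well as for
  \<open>v\<close>.\<close>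

lemma orthogonal_projection_span:
  assumes "finite X" "finite B" "B \<subseteq> coord_space X"
  shows "\<exists>w\<in>cfun.span B. \<forall>u\<in>cfun.span B. inner_on X (v - w) u = 0"
  using assms(2,3)
proof (induction B arbitrary: v)
  case empty
  show ?case by (rule bexI[of _ 0]) (simp_all only: cfun.span_empty inner_on_zero singleton_iff ball_simps simp_thms)
next
  case (insert b B)
  obtain p where p: "p \<in> cfun.span B" "\<And>u. u \<in> cfun.span B \<Longrightarrow> inner_on X (b - p) u = 0"
    using insert by (metis insert_subset)
  obtain q where q: "q \<in> cfun.span B" "\<And>u. u \<in> cfun.span B \<Longrightarrow> inner_on X (v - q) u = 0"
    using insert by (metis insert_subset)
  \<comment> \<open>The coefficient of \<open>v\<close> along \<open>b - p\<close>. If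
    \<open>b - p = 0\<close>, the quotient is \<open>0\<close> and orthogonality to
    \<open>b - p\<close> is trivial.\<close>
  define c where "c = inner_on X v (b - p) / inner_on X (b - p) (b - p)"
  have bp: "b - p \<in> coord_space X"
    using insert.prems p(1) cfun.span_minimal[OF _ subspace_coord_space, of B X]
    by (intro cfun.subspace_diff[OF subspace_coord_space]) auto
  have q': "inner_on X q (b - p) = 0"
    using p(2)[OF q(1)] inner_on_commute[of X q "b - p"] by simp
  have c: "inner_on X (v - (q + cscale c (b - p))) (b - p) = 0"
  proof (cases "b - p = 0")
    case False
    then have "inner_on X (b - p) (b - p) \<noteq> 0"
      using inner_on_self_eq_0[OF assms(1) bp] by blast
    then show ?thesis
      by (simp add: inner_on_diff_left inner_on_add_left inner_on_scale_left q' c_def)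
  qed simp
  have sub: "cfun.span B \<subseteq> cfun.span (insert b B)" by (rule cfun.span_mono) auto
  show ?case
  proof (intro bexI ballI)
    have "b - p \<in> cfun.span (insert b B)"
      using p(1) sub by (intro cfun.span_diff cfun.span_base[of b]) auto
    then show "q + cscale c (b - p) \<in> cfun.span (insert b B)"
      using q(1) sub by (intro cfun.span_add cfun.span_scale) auto
    fix u assume "u \<in> cfun.span (insert b B)"
    then obtain k where k: "u - cscale k b \<in> cfun.span B"
      by (auto simp: cfun.span_insert)
    \<comment> \<open>Splits \<open>u\<close> into a vector of \<open>cfun.span B\<close> and
      \<open>k\<close> times \<open>b - p\<close>, to which the two orthogonality statements apply
      separately.\<close>
    define u' where "u' = u - cscale k b + cscale k p"
    have u': "u' \<in> cfun.span B"
      unfolding u'_def using k p(1) by (intro cfun.span_add cfun.span_scale)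
    have "u = u' + cscale k (b - p)"
      by (simp add: u'_def fun_eq_iff algebra_simps)
    moreover have "inner_on X (v - (q + cscale c (b - p))) u' = 0"
      using p(2)[OF u'] q(2)[OF u']
      by (simp add: inner_on_diff_left inner_on_add_left inner_on_scale_left)
    ultimately show "inner_on X (v - (q + cscale c (b - p))) u = 0"
      using c by (simp add: inner_on_add_right inner_on_scale_right)
  qed
qed

lemma orthogonal_projection_exists:
  assumes "finite X" "cfun.subspace W" "W \<subseteq> coord_space X"
  obtains w where "w \<in> W" "\<And>u. u \<in> W \<Longrightarrow> inner_on X (v - w) u = 0"
proof -
  obtain B where B: "finite B" "B \<subseteq> W" "W \<subseteq> cfun.span B"
    using subspace_finite_basis[OF assms(1,3)] by metis
  have "cfun.span B = W"
    using B cfun.span_minimal[OF B(2) assms(2)] by auto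
  then show ?thesis
    using orthogonal_projection_span[OF assms(1) B(1), of v] B(2) assms(3) that by (metis order_trans)
qed


section \<open>Homomorphisms and multiplicities\<close>

definition rep_hom :: "'g monoid \<Rightarrow> ('g, 'a) grep \<Rightarrow> ('g, 'b) grep \<Rightarrow>
    (('a \<Rightarrow> complex) \<Rightarrow> 'b \<Rightarrow> complex) \<Rightarrow> bool"
  where "rep_hom G R S f \<longleftrightarrow> linear_map_on (rspace R) (rspace S) f \<and>
    (\<forall>g\<in>carrier G. \<forall>v\<in>rspace R. f (ract R g v) = ract S g (f v))"

lemma rep_iso_iff: "rep_iso G R S \<longleftrightarrow> (\<exists>f. rep_hom G R S f \<and> bij_betw f (rspace R) (rspace S))"
  by (auto simp: rep_iso_def rep_hom_def)

lemma rep_homD: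
  assumes "rep_hom G R S f"
  shows "v \<in> rspace R \<Longrightarrow> f v \<in> rspace S"
    "u \<in> rspace R \<Longrightarrow> v \<in> rspace R \<Longrightarrow> f (u + v) = f u + f v"
    "v \<in> rspace R \<Longrightarrow> f (cscale c v) = cscale c (f v)"
    "g \<in> carrier G \<Longrightarrow> v \<in> rspace R \<Longrightarrow> f (ract R g v) = ract S g (f v)"
  using assms by (auto simp: rep_hom_def linear_map_on_def)

lemma linear_map_on_zero:
  assumes "linear_map_on V W f" "cfun.subspace V"
  shows "f 0 = 0"
proof -
  have "f (cscale 0 0) = cscale 0 (f 0)"
    using assms cfun.subspace_0 unfolding linear_map_on_def by blast
  then show ?thesis by (simp add: cscale_def fun_eq_iff zero_fun_def)
qed

lemma linear_map_on_sum:
  assumes "linear_map_on V W f" "cfun.subspace V" "\<And>i. i \<in> I \<Longrightarrow> v i \<in> V"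
  shows "f (\<Sum>i\<in>I. cscale (c i) (v i)) = (\<Sum>i\<in>I. cscale (c i) (f (v i)))"
  using assms(3)
proof (induction I rule: infinite_finite_induct)
  case (insert i I)
  have "(\<Sum>i\<in>I. cscale (c i) (v i)) \<in> V" "cscale (c i) (v i) \<in> V"
    using insert.prems assms(2) by (auto intro!: cfun.subspace_sum cfun.subspace_scale)
  moreover have "f (cscale (c i) (v i)) = cscale (c i) (f (v i))"
    using insert.prems assms(1) by (simp add: linear_map_on_def)
  moreover have "f (a + b) = f a + f b" if "a \<in> V" "b \<in> V" for a b
    using that assms(1) by (simp add: linear_map_on_def)
  ultimately show ?case
    by (simp only: sum.insert[OF insert.hyps] insert.IH[OF insert.prems] insertI2)
qed (auto simp: linear_map_on_zero[OF assms(1,2)])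

lemma linear_map_on_diff:
  assumes "linear_map_on V W f" "cfun.subspace V" "u \<in> V" "v \<in> V"
  shows "f (u - v) = f u - f v"
proof -
  have "u - v = u + cscale (-1) v" by (simp add: fun_eq_iff)
  moreover have "f (u + cscale (-1) v) = f u + cscale (-1) (f v)"
    using assms cfun.subspace_scale unfolding linear_map_on_def by metis
  ultimately show ?thesis by (simp add: fun_eq_iff)
qed

lemma linear_map_on_inj:
  assumes "linear_map_on V W f" "cfun.subspace V" "\<And>v. v \<in> V \<Longrightarrow> f v = 0 \<Longrightarrow> v = 0"
  shows "inj_on f V"
proof (rule inj_onI)
  fix u v assume uv: "u \<in> V" "v \<in> V" "f u = f v"
  then have "f (u - v) = 0" using linear_map_on_diff[OF assms(1,2)] by simp
  then show "u = v" using assms(3)[of "u - v"] cfun.subspace_diff[OF assms(2)] uv by auto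
qed

lemma is_repD:
  assumes "is_rep G R"
  shows "group G" "cfun.subspace (rspace R)" "g \<in> carrier G \<Longrightarrow> linear_map_on (rspace R) (rspace R) (ract R g)"
    "v \<in> rspace R \<Longrightarrow> ract R \<one>\<^bsub>G\<^esub> v = v"
    "g \<in> carrier G \<Longrightarrow> h \<in> carrier G \<Longrightarrow> v \<in> rspace R \<Longrightarrow>
      ract R (g \<otimes>\<^bsub>G\<^esub> h) v = ract R g (ract R h v)"
  using assms unfolding is_rep_def by auto

lemma is_rep_act:
  assumes "is_rep G R" "g \<in> carrier G"
  shows "v \<in> rspace R \<Longrightarrow> ract R g v \<in> rspace R"
    "u \<in> rspace R \<Longrightarrow> v \<in> rspace R \<Longrightarrow> ract R g (u + v) = ract R g u + ract R g v"
    "v \<in> rspace R \<Longrightarrow> ract R g (cscale c v) = cscale c (ract R g v)"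
  using is_repD(3)[OF assms] by (auto simp: linear_map_on_def)

lemma subrep_simps [simp]: "rspace (subrep R W) = W" "ract (subrep R W) = ract R"
    "subrep (subrep R V) W = subrep R W" "subrep R (rspace R) = R"
  by (simp_all add: subrep_def)

text \<open>Schur's lemma: kernel and image are invariant, so a nonzero homomorphism of irreducibles
  has kernel \<open>{0}\<close> and full image.\<close>

lemma rep_hom_zero_or_bij:
  assumes S: "irreducible_rep G S" and W: "irreducible_rep G W" and f: "rep_hom G S W f"
  shows "(\<forall>v\<in>rspace S. f v = 0) \<or> bij_betw f (rspace S) (rspace W)"
proof (cases "\<forall>v\<in>rspace S. f v = 0")
  case False
  have rS: "is_rep G S" and rW: "is_rep G W"
    using S W by (auto simp: irreducible_rep_def)
  note sub = is_repD(2)[OF rS] is_repD(2)[OF rW]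
  have lin: "linear_map_on (rspace S) (rspace W) f" using f by (simp add: rep_hom_def)
  have f0: "f 0 = 0" using linear_map_on_zero[OF lin sub(1)] .
  let ?K = "{v \<in> rspace S. f v = 0}"
  have "invariant_subspace G S ?K"
    unfolding invariant_subspace_def cfun.subspace_def
  proof (intro conjI)
    have "ract W g 0 = 0" if "g \<in> carrier G" for g
      using linear_map_on_zero[OF is_repD(3)[OF rW that] sub(2)] .
    then show "\<forall>g\<in>carrier G. ract S g ` ?K \<subseteq> ?K"
      using rep_homD(4)[OF f] is_rep_act(1)[OF rS] by auto
  qed (use rep_homD[OF f] f0 sub cfun.subspace_0 cfun.subspace_add cfun.subspace_scale in auto)
  then have "?K = {0}" using S False unfolding irreducible_rep_def by blast
  then have "inj_on f (rspace S)"
    using linear_map_on_inj[OF lin sub(1)] by blast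
  moreover have "invariant_subspace G W (f ` rspace S)"
    unfolding invariant_subspace_def cfun.subspace_def
  proof (intro conjI ballI allI)
    show "0 \<in> f ` rspace S" using f0 cfun.subspace_0[OF sub(1)] by (metis imageI)
    fix x y c assume "x \<in> f ` rspace S"
    then obtain u where u: "x = f u" "u \<in> rspace S" by auto
    show "cscale c x \<in> f ` rspace S"
      using u rep_homD(3)[OF f, of u c] cfun.subspace_scale[OF sub(1)] by (metis imageI)
    assume "y \<in> f ` rspace S"
    then obtain v where v: "y = f v" "v \<in> rspace S" by auto
    show "x + y \<in> f ` rspace S"
      using u v rep_homD(2)[OF f, of u v] cfun.subspace_add[OF sub(1)] by (metis imageI)
  next
    fix g assume g: "g \<in> carrier G"
    show "ract W g ` f ` rspace S \<subseteq> f ` rspace S"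
      using rep_homD(4)[OF f g] is_rep_act(1)[OF rS g] by (auto simp: image_iff) metis
  qed (use rep_homD(1)[OF f] in auto)
  moreover have "f ` rspace S \<noteq> {0}" using False by auto
  ultimately have "f ` rspace S = rspace W" using W unfolding irreducible_rep_def by blast
  then show ?thesis using \<open>inj_on f (rspace S)\<close> by (simp add: bij_betw_def)
qed auto


lemma invariant_subspaceD:
  assumes "invariant_subspace G R W"
  shows "cfun.subspace W" "W \<subseteq> rspace R" "g \<in> carrier G \<Longrightarrow> v \<in> W \<Longrightarrow> ract R g v \<in> W"
  using assms by (auto simp: invariant_subspace_def)

section \<open>Components in a direct sum of irreducibles\<close>

locale irreducible_sum =
  fixes G :: "'g monoid" and R :: "('g, 'a) grep" and \<W> :: "('a \<Rightarrow> complex) set set"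
  assumes rep: "is_rep G R" and decomp: "irreducible_decomposition G R \<W>"
begin

lemma finite_summands: "finite \<W>"
  and summand: "W \<in> \<W> \<Longrightarrow> invariant_subspace G R W" "W \<in> \<W> \<Longrightarrow> irreducible_rep G (subrep R W)"
  and unique: "v \<in> rspace R \<Longrightarrow> \<exists>!w. w \<in> (\<Pi>\<^sub>E W\<in>\<W>. W) \<and> v = (\<Sum>W\<in>\<W>. w W)"
  using decomp unfolding irreducible_decomposition_def by blast+

text \<open>The family chosen by \<open>THE\<close> is meaningful only for \<open>v\<close> in
  \<open>rspace R\<close>, whence the membership hypotheses below.\<close>

definition component :: "('a \<Rightarrow> complex) set \<Rightarrow> ('a \<Rightarrow> complex) \<Rightarrow> 'a \<Rightarrow> complex"
  where "component W v = (THE w. w \<in> (\<Pi>\<^sub>E W\<in>\<W>. W) \<and> v = (\<Sum>W\<in>\<W>. w W)) W"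

lemma component_in: "v \<in> rspace R \<Longrightarrow> W \<in> \<W> \<Longrightarrow> component W v \<in> W"
  and sum_component: "v \<in> rspace R \<Longrightarrow> (\<Sum>W\<in>\<W>. component W v) = v"
  using theI'[OF unique, of v] by (auto simp: component_def PiE_def)

text \<open>The tool for linearity and equivariance of the components: apply the operation to each
  component separately and recognize the resulting family as the decomposition of its sum.\<close>

lemma component_unique:
  assumes "\<And>W. W \<in> \<W> \<Longrightarrow> w W \<in> W" "W \<in> \<W>"
  shows "component W (\<Sum>W\<in>\<W>. w W) = w W"
proof -
  let ?v = "\<Sum>W\<in>\<W>. w W"
  have v: "?v \<in> rspace R"
    using assms(1) summand(1) is_repD(2)[OF rep]
    by (intro cfun.subspace_sum) (auto dest: invariant_subspaceD)
  have "restrict w \<W> \<in> (\<Pi>\<^sub>E W\<in>\<W>. W) \<and> ?v = (\<Sum>W\<in>\<W>. restrict w \<W> W)"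
    using assms(1) by auto
  then have "(THE w. w \<in> (\<Pi>\<^sub>E W\<in>\<W>. W) \<and> ?v = (\<Sum>W\<in>\<W>. w W)) = restrict w \<W>"
    using the1_equality[OF unique[OF v]] by blast
  then show ?thesis using assms(2) by (simp add: component_def)
qed

lemma component_add:
  assumes "u \<in> rspace R" "v \<in> rspace R" "W \<in> \<W>"
  shows "component W (u + v) = component W u + component W v"
proof -
  have "(\<Sum>W\<in>\<W>. component W u + component W v) = u + v"
    using assms sum_component by (simp only: sum.distrib)
  moreover have "component W u + component W v \<in> W" if "W \<in> \<W>" for W
    using that assms component_in cfun.subspace_add[OF invariant_subspaceD(1)[OF summand(1)]] by metis
  ultimately show ?thesis
    using component_unique[of "\<lambda>W. component W u + component W v" W] assms(3) by metis
qed

lemma component_scale: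
  assumes "v \<in> rspace R" "W \<in> \<W>"
  shows "component W (cscale c v) = cscale c (component W v)"
proof -
  have "(\<Sum>W\<in>\<W>. cscale c (component W v)) = cscale c v"
    using assms sum_component by (simp only: cfun.scale_sum_right[symmetric])
  moreover have "cscale c (component W v) \<in> W" if "W \<in> \<W>" for W
    using that assms component_in cfun.subspace_scale[OF invariant_subspaceD(1)[OF summand(1)]] by metis
  ultimately show ?thesis
    using component_unique[of "\<lambda>W. cscale c (component W v)" W] assms(2) by metis
qed

lemma component_act:
  assumes "v \<in> rspace R" "W \<in> \<W>" "g \<in> carrier G"
  shows "component W (ract R g v) = ract R g (component W v)"
proof -
  have inW: "component W v \<in> rspace R" if "W \<in> \<W>" for W
    using that assms component_in summand(1) invariant_subspaceD(2) by blast
  have "ract R g (\<Sum>W\<in>\<W>. cscale 1 (component W v)) = (\<Sum>W\<in>\<W>. cscale 1 (ract R g (component W v)))"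
    by (rule linear_map_on_sum[OF is_repD(3,2)[OF rep]]) (use assms inW in auto)
  then have "(\<Sum>W\<in>\<W>. ract R g (component W v)) = ract R g v"
    using sum_component[OF assms(1)] by (simp only: cfun.scale_one)
  moreover have "ract R g (component W v) \<in> W" if "W \<in> \<W>" for W
    using that assms component_in invariant_subspaceD(3)[OF summand(1)] by metis
  ultimately show ?thesis
    using component_unique[of "\<lambda>W. ract R g (component W v)" W] assms(2) by metis
qed

lemma rep_hom_component:
  assumes "rep_hom G S R f" "W \<in> \<W>"
  shows "rep_hom G S (subrep R W) (component W \<circ> f)"
  using rep_homD[OF assms(1)] assms(2) component_in component_add component_scale component_act
  by (simp add: rep_hom_def linear_map_on_def Pi_iff)

text \<open>
  The evaluations at a nonzero vector \<open>e\<close> of an isomorphism onto each summand of type \<open>S\<close> form a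
  basis of the space of values at \<open>e\<close> of all homomorphisms.
\<close>

lemma card_isomorphic_summands:
  assumes S: "irreducible_rep G S" and e: "e \<in> rspace S" "e \<noteq> 0"
    and scalar: "\<And>f. rep_hom G S S f \<Longrightarrow> \<exists>c. \<forall>v\<in>rspace S. f v = cscale c v"
  shows "card {W\<in>\<W>. rep_iso G S (subrep R W)} = cfun.dim {f e | f. rep_hom G S R f}"
proof -
  define I where "I = {W\<in>\<W>. rep_iso G S (subrep R W)}"
  have I: "finite I" "I \<subseteq> \<W>" using finite_summands by (auto simp: I_def)
  have rS: "is_rep G S" using S by (simp add: irreducible_rep_def)
  have "\<forall>W\<in>I. \<exists>f. rep_hom G S (subrep R W) f \<and> bij_betw f (rspace S) W"
    by (auto simp: I_def rep_iso_iff)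
  then obtain F where F: "\<And>W. W \<in> I \<Longrightarrow> rep_hom G S (subrep R W) (F W)"
      "\<And>W. W \<in> I \<Longrightarrow> bij_betw (F W) (rspace S) W"
    by metis
  define b where "b W = F W e" for W
  have sub: "cfun.subspace W" "W \<subseteq> rspace R" if "W \<in> \<W>" for W
    using invariant_subspaceD(1,2)[OF summand(1)[OF that]] .
  have bW: "b W \<in> W" if "W \<in> I" for W
    using rep_homD(1)[OF F(1)[OF that] e(1)] by (simp add: b_def)
  have b0: "b W \<noteq> 0" if "W \<in> I" for W
  proof
    assume "b W = 0"
    moreover have "F W 0 = 0"
      using linear_map_on_zero F(1)[OF that] is_repD(2)[OF rS] unfolding rep_hom_def by blast
    ultimately show False
      using F(2)[OF that] e cfun.subspace_0[OF is_repD(2)[OF rS]]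
      unfolding b_def bij_betw_def inj_on_def by metis
  qed
  have zero: "c W = 0" if sum: "(\<Sum>W\<in>I. cscale (c W) (b W)) = 0" and W: "W \<in> I" for c W
  proof -
    \<comment> \<open>The relation extended by \<open>0\<close> to all summands. Comparison with the
      zero family, by uniqueness of the decomposition of \<open>0\<close>, kills every term.\<close>
    define w where "w W = (if W \<in> I then cscale (c W) (b W) else 0)" for W
    have w: "w W \<in> W" if "W \<in> \<W>" for W
      using bW cfun.subspace_scale[OF sub(1)[OF that]] cfun.subspace_0[OF sub(1)[OF that]]
      by (simp add: w_def)
    have "(\<Sum>W\<in>\<W>. w W) = (\<Sum>W\<in>I. cscale (c W) (b W))"
      unfolding w_def using I finite_summands by (simp add: sum.If_cases Int_absorb1)
    then have "(\<Sum>W\<in>\<W>. w W) = (\<Sum>W\<in>\<W>. 0)" using sum by simp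
    moreover have "component W (\<Sum>W\<in>\<W>. 0) = 0"
      using component_unique[of "\<lambda>_. 0" W] W I cfun.subspace_0[OF sub(1)] by blast
    ultimately have "w W = 0" using component_unique[of w W] w W I by (metis subsetD)
    then show "c W = 0" using W b0 cfun.scale_eq_0_iff by (simp add: w_def)
  qed
  have inj: "inj_on b I" and indep: "cfun.independent (b ` I)"
    using independent_image[OF I(1), of b] zero by auto
  let ?E = "{f e | f. rep_hom G S R f}"
  have bE: "b ` I \<subseteq> ?E"
  proof
    fix v assume "v \<in> b ` I"
    then obtain W where W: "v = F W e" "W \<in> I" by (auto simp: b_def)
    have "rep_hom G S R (F W)"
      using F(1)[OF W(2)] sub(2)[of W] I(2) W(2)
      by (auto simp: rep_hom_def linear_map_on_def Pi_iff subset_iff)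
    then show "v \<in> ?E" using W by blast
  qed
  have Eb: "?E \<subseteq> cfun.span (b ` I)"
  proof
    fix v assume "v \<in> ?E"
    then obtain f where f: "rep_hom G S R f" "v = f e" by blast
    have v: "v \<in> rspace R" using rep_homD(1)[OF f(1)] e f by simp
    have "component W v \<in> cfun.span (b ` I)" if W: "W \<in> \<W>" for W
    proof -
      let ?p = "component W \<circ> f"
      have p: "rep_hom G S (subrep R W) ?p" using rep_hom_component[OF f(1) W] .
      consider "\<forall>v\<in>rspace S. ?p v = 0" | "bij_betw ?p (rspace S) W"
        using rep_hom_zero_or_bij[OF S summand(2)[OF W] p] by auto
      then show ?thesis
      proof cases
        case 1
        then show ?thesis using e f by (simp add: cfun.span_zero)
      next
        case 2
        then have "W \<in> I" using W p by (auto simp: I_def rep_iso_iff)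
        note FW = F[OF this]
        have WS: "W \<subseteq> F W ` rspace S" using FW(2) by (simp add: bij_betw_def)
        \<comment> \<open>The component of \<open>f\<close> pulled back along the isomorphism
          \<open>F W\<close> is an endomorphism of \<open>S\<close>, hence a scalar; this makes the
          component of \<open>v = f e\<close> a multiple of \<open>b W\<close>.\<close>
        define g where "g v = inv_into (rspace S) (F W) (?p v)" for v
        have g: "g v \<in> rspace S" "F W (g v) = ?p v" if "v \<in> rspace S" for v
        proof -
          have "?p v \<in> F W ` rspace S" using rep_homD(1)[OF p that] WS by auto
          then show "g v \<in> rspace S" "F W (g v) = ?p v"
            unfolding g_def by (rule inv_into_into, rule f_inv_into_f)
        qed
        \<comment> \<open>Linearity and equivariance of \<open>g\<close> are checked after applying
          the injective map \<open>F W\<close>.\<close>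
        have Fcancel: "x = y" if "F W x = F W y" "x \<in> rspace S" "y \<in> rspace S" for x y
          using FW(2) that by (auto simp: bij_betw_def inj_on_def)
        note sS = is_repD(2)[OF rS]
        have "rep_hom G S S g"
          unfolding rep_hom_def linear_map_on_def
        proof (intro conjI ballI allI funcsetI)
          fix u v c assume uv: "u \<in> rspace S" "v \<in> rspace S"
          show "g (u + v) = g u + g v"
          proof (rule Fcancel)
            show "F W (g (u + v)) = F W (g u + g v)"
              using uv rep_homD(2)[OF p] rep_homD(2)[OF FW(1)] g cfun.subspace_add[OF sS] by metis
          qed (use uv g cfun.subspace_add[OF sS] in metis)+
        next
          fix v c assume v: "v \<in> rspace S"
          show "g (cscale c v) = cscale c (g v)"
          proof (rule Fcancel)
            show "F W (g (cscale c v)) = F W (cscale c (g v))"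
              using v rep_homD(3)[OF p] rep_homD(3)[OF FW(1)] g cfun.subspace_scale[OF sS] by metis
          qed (use v g cfun.subspace_scale[OF sS] in metis)+
        next
          fix h v assume hv: "h \<in> carrier G" "v \<in> rspace S"
          show "g (ract S h v) = ract S h (g v)"
          proof (rule Fcancel)
            show "F W (g (ract S h v)) = F W (ract S h (g v))"
              using hv rep_homD(4)[OF p] rep_homD(4)[OF FW(1)] g is_rep_act(1)[OF rS] by metis
          qed (use hv g is_rep_act(1)[OF rS] in metis)+
        qed (use g in auto)
        then obtain c where "g e = cscale c e" using scalar e by blast
        then have "component W v = cscale c (b W)"
          using g(2)[OF e(1)] rep_homD(3)[OF FW(1) e(1)] f by (simp add: b_def)
        moreover have "b W \<in> cfun.span (b ` I)"
          using \<open>W \<in> I\<close> by (simp add: cfun.span_base)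
        ultimately show ?thesis using cfun.span_scale by metis
      qed
    qed
    then have "(\<Sum>W\<in>\<W>. component W v) \<in> cfun.span (b ` I)" by (rule cfun.span_sum)
    then show "v \<in> cfun.span (b ` I)" using sum_component[OF v] by simp
  qed
  have "cfun.dim ?E = card (b ` I)"
    using cfun.dim_unique[OF bE Eb indep refl] .
  then show ?thesis using card_image[OF inj] by (simp add: I_def)
qed

end

section \<open>Complete reducibility from an invariant inner product\<close>

definition unitary_rep :: "'g monoid \<Rightarrow> ('g, 'a) grep \<Rightarrow> 'a set \<Rightarrow> bool"
  where "unitary_rep G R X \<longleftrightarrow> is_rep G R \<and> finite X \<and> rspace R \<subseteq> coord_space X \<and>
    (\<forall>g\<in>carrier G. \<forall>u\<in>rspace R. \<forall>v\<in>rspace R. inner_on X (ract R g u) (ract R g v) = inner_on X u v)"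

lemma is_rep_subrep:
  assumes "unitary_rep G R X" "invariant_subspace G R V"
  shows "is_rep G (subrep R V)"
proof -
  have R: "is_rep G R" "finite X" "rspace R \<subseteq> coord_space X" using assms(1) by (auto simp: unitary_rep_def)
  note V = invariant_subspaceD[OF assms(2)]
  obtain B where B: "finite B" "B \<subseteq> V" "V \<subseteq> cfun.span B"
    using subspace_finite_basis[of X V] V R by (metis order_trans)
  then have "V = cfun.span B" using cfun.span_minimal[OF B(2) V(1)] by auto
  then show ?thesis
    using B(1) R(1) V unfolding is_rep_def linear_map_on_def
    by (auto simp: subset_iff)
qed

text \<open>The action of \<open>g\<close> on \<open>v\<close> is moved to the action of its inverse
  on \<open>u\<close>, which stays in \<open>W\<close>. Invariance of the given inner product takes
  the place of averaging over the group.\<close>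

lemma orthogonal_complement_invariant:
  assumes R: "unitary_rep G R X" and W: "invariant_subspace G R W"
  shows "invariant_subspace G R {v \<in> rspace R. \<forall>u\<in>W. inner_on X v u = 0}"
proof -
  have rep: "is_rep G R" using R by (simp add: unitary_rep_def)
  interpret G: group G using is_repD(1)[OF rep] .
  note sub = is_repD(2)[OF rep] and Wd = invariant_subspaceD[OF W]
  have "inner_on X (ract R g v) u = 0"
    if v: "v \<in> rspace R" "\<forall>u\<in>W. inner_on X v u = 0" and g: "g \<in> carrier G" and u: "u \<in> W" for g v u
  proof -
    let ?u = "ract R (inv\<^bsub>G\<^esub> g) u"
    have u': "u \<in> rspace R" "?u \<in> W" "?u \<in> rspace R" using u Wd g by auto
    have "ract R g ?u = u"
      using is_repD(5)[OF rep g G.inv_closed[OF g] u'(1)] is_repD(4)[OF rep u'(1)] g by simp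
    then have "inner_on X (ract R g v) u = inner_on X (ract R g v) (ract R g ?u)" by simp
    also have "\<dots> = inner_on X v ?u" using R g v u' by (simp add: unitary_rep_def)
    finally show ?thesis using v u' by simp
  qed
  then show ?thesis
    using is_rep_act(1)[OF rep] cfun.subspace_0[OF sub] cfun.subspace_add[OF sub] cfun.subspace_scale[OF sub]
    by (auto simp: invariant_subspace_def cfun.subspace_def inner_on_add_left inner_on_scale_left
      simp del: cscale_apply)
qed

text \<open>A nonzero invariant subspace of \<open>V\<close> of least dimension has no proper
  nonzero invariant subspace.\<close>

lemma irreducible_invariant_subspace_exists:
  assumes R: "unitary_rep G R X" and V: "invariant_subspace G R V" "V \<noteq> {0}"
  obtains W where "invariant_subspace G R W" "W \<subseteq> V" "irreducible_rep G (subrep R W)"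
proof -
  define P where "P W \<longleftrightarrow> invariant_subspace G R W \<and> W \<subseteq> V \<and> W \<noteq> {0}" for W
  have "P V" using V by (simp add: P_def)
  then obtain W where W: "P W" "\<And>U. P U \<Longrightarrow> cfun.dim W \<le> cfun.dim U"
    using ex_has_least_nat[of P V cfun.dim] by blast
  have fin: "finite X" "W \<subseteq> coord_space X"
    using R W(1) by (auto simp: unitary_rep_def P_def invariant_subspace_def)
  have "U = {0} \<or> U = W" if U: "invariant_subspace G (subrep R W) U" for U
  proof (rule ccontr)
    assume "\<not> (U = {0} \<or> U = W)"
    then have "P U" "U \<subset> W" using U W(1) by (auto simp: P_def invariant_subspace_def)
    then show False
      using dim_psubset_coord_space[OF fin, of U] W(2)[of U] invariant_subspaceD(1)[OF U] by simp
  qed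
  then have "irreducible_rep G (subrep R W)"
    using is_rep_subrep[OF R] W(1) by (simp add: irreducible_rep_def P_def)
  then show ?thesis using W(1) that unfolding P_def by blast
qed

text \<open>Projection to \<open>W\<close> splits \<open>V\<close> into \<open>W\<close> and
  \<open>V'\<close>, which meet only in \<open>0\<close> since a common vector is orthogonal to
  itself. The components of \<open>v\<close> are its projection \<open>p\<close>, at index
  \<open>W\<close>, and the components of \<open>v - p\<close>.\<close>

lemma irreducible_decomposition_insert:
  assumes R: "unitary_rep G R X" and V: "invariant_subspace G R V"
    and W: "invariant_subspace G R W" "W \<subseteq> V" "irreducible_rep G (subrep R W)"
    and V': "V' = {v \<in> V. \<forall>u\<in>W. inner_on X v u = 0}"
    and \<W>: "irreducible_decomposition G (subrep R V') \<W>"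
  shows "irreducible_decomposition G (subrep R V) (insert W \<W>)"
proof -
  have fin: "finite X" "V \<subseteq> coord_space X"
    using R V by (auto simp: unitary_rep_def invariant_subspace_def)
  note sV = invariant_subspaceD(1)[OF V] and sW = invariant_subspaceD(1)[OF W(1)]
  have sV': "cfun.subspace V'"
    using sV unfolding V' cfun.subspace_def by (auto simp: inner_on_add_left inner_on_scale_left simp del: cscale_apply)
  have disj: "x = 0" if "x \<in> W" "x \<in> V'" for x
    using that inner_on_self_eq_0[OF fin(1), of x] fin(2) by (auto simp: V')
  have \<W>': "finite \<W>" "\<And>U. U \<in> \<W> \<Longrightarrow> U \<subseteq> V'" "\<And>U. U \<in> \<W> \<Longrightarrow> cfun.subspace U"
    "\<And>U. U \<in> \<W> \<Longrightarrow> invariant_subspace G R U \<and> irreducible_rep G (subrep R U)"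
    and uniq: "\<And>v. v \<in> V' \<Longrightarrow> \<exists>!w. w \<in> (\<Pi>\<^sub>E W\<in>\<W>. W) \<and> v = (\<Sum>W\<in>\<W>. w W)"
    using \<W> invariant_subspaceD(2)[OF V]
    by (auto simp: irreducible_decomposition_def invariant_subspace_def V' dest!: bspec)
  have W0: "W \<noteq> {0}" using W(3) by (simp add: irreducible_rep_def)
  \<comment> \<open>The summands form a set, so a repeated \<open>W\<close> would be absorbed rather
    than added.\<close>
  have "W \<notin> \<W>"
  proof
    assume "W \<in> \<W>"
    then have "W \<subseteq> {0}" using \<W>'(2) disj by blast
    then show False using W0 cfun.subspace_0[OF sW] by blast
  qed
  have "\<exists>!w. w \<in> (\<Pi>\<^sub>E W\<in>insert W \<W>. W) \<and> v = (\<Sum>W\<in>insert W \<W>. w W)" if v: "v \<in> V" for v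
  proof -
    obtain p where p: "p \<in> W" "\<And>u. u \<in> W \<Longrightarrow> inner_on X (v - p) u = 0"
      using orthogonal_projection_exists[OF fin(1) sW, of v] W(2) fin(2) by (metis order_trans)
    have "v - p \<in> V'" using p W(2) v cfun.subspace_diff[OF sV] by (auto simp: V')
    then obtain w where w: "w \<in> (\<Pi>\<^sub>E W\<in>\<W>. W)" "v - p = (\<Sum>W\<in>\<W>. w W)" using uniq by blast
    show ?thesis
    proof (rule ex1I[of _ "w(W := p)"])
      have "(\<Sum>U\<in>\<W>. (w(W := p)) U) = v - p" 
        using \<open>W \<notin> \<W>\<close> w(2) by (auto intro!: sum.cong)
      moreover have "w(W := p) \<in> (\<Pi>\<^sub>E W\<in>insert W \<W>. W)" 
        using w(1) p(1) by (auto simp: PiE_iff extensional_def)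
      ultimately show "w(W := p) \<in> (\<Pi>\<^sub>E W\<in>insert W \<W>. W) \<and> v = (\<Sum>U\<in>insert W \<W>. (w(W := p)) U)"
        using \<W>'(1) \<open>W \<notin> \<W>\<close> by (simp only: sum.insert fun_upd_same) (simp add: fun_eq_iff)
    next
      fix u assume u: "u \<in> (\<Pi>\<^sub>E W\<in>insert W \<W>. W) \<and> v = (\<Sum>U\<in>insert W \<W>. u U)"
      then have "v = u W + (\<Sum>U\<in>\<W>. u U)"
        using sum.insert[OF \<W>'(1) \<open>W \<notin> \<W>\<close>, of u] by simp
      then have s: "(\<Sum>U\<in>\<W>. u U) = v - u W" by (simp add: algebra_simps)
      have "(\<Sum>U\<in>\<W>. u U) \<in> V'" using u \<W>'(2) by (intro cfun.subspace_sum[OF sV']) auto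
      then have 1: "v - u W \<in> V'" using s by simp
      have uW: "u W \<in> W" using u by auto
      \<comment> \<open>Two candidates for the component in \<open>W\<close> differ by a vector that
        lies in both \<open>W\<close> and \<open>V'\<close>.\<close>
      have "(v - p) - (v - u W) \<in> V'" using \<open>v - p \<in> V'\<close> 1 cfun.subspace_diff[OF sV'] by blast
      then have "u W - p \<in> V'" by (simp add: algebra_simps)
      moreover have "u W - p \<in> W" using uW p cfun.subspace_diff[OF sW] by blast
      ultimately have up: "u W = p" using disj[of "u W - p"] by simp
      have "restrict u \<W> \<in> (\<Pi>\<^sub>E W\<in>\<W>. W) \<and> v - p = (\<Sum>U\<in>\<W>. restrict u \<W> U)"
        using u s up by auto
      then have eq: "restrict u \<W> = w" using uniq[OF \<open>v - p \<in> V'\<close>] w by blast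
      show "u = w(W := p)"
      proof
        fix U
        consider "U = W" | "U \<in> \<W>" "U \<noteq> W" | "U \<notin> insert W \<W>" by blast
        then show "u U = (w(W := p)) U"
        proof cases
          case 2 then show ?thesis using eq by (metis fun_upd_other restrict_apply')
        next
          case 3 then show ?thesis using u w(1) by (auto simp: PiE_def extensional_def)
        qed (use up in simp)
      qed
    qed
  qed
  moreover have "invariant_subspace G (subrep R V) U" if "U \<in> insert W \<W>" for U
  proof -
    have "invariant_subspace G R U" "U \<subseteq> V" using that \<W>'(2,4)[of U] W(1,2) by (auto simp: V')
    then show ?thesis by (simp add: invariant_subspace_def)
  qed
  ultimately show ?thesis
    using \<W>' W by (simp add: irreducible_decomposition_def)
qed

lemma irreducible_decomposition_exists:
  assumes R: "unitary_rep G R X" and V: "invariant_subspace G R V"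
  shows "\<exists>\<W>. irreducible_decomposition G (subrep R V) \<W>"
  using V
proof (induction "cfun.dim V" arbitrary: V rule: less_induct)
  case less
  note V = invariant_subspaceD[OF less.prems]
  show ?case
  proof (cases "V = {0}")
    case True
    then have "irreducible_decomposition G (subrep R V) {}"
      by (auto simp: irreducible_decomposition_def)
    then show ?thesis by blast
  next
    case False
    obtain W where W: "invariant_subspace G R W" "W \<subseteq> V" "irreducible_rep G (subrep R W)"
      using irreducible_invariant_subspace_exists[OF R less.prems False] .
    define V' where "V' = {v \<in> V. \<forall>u\<in>W. inner_on X v u = 0}"
    have "V' = V \<inter> {v \<in> rspace R. \<forall>u\<in>W. inner_on X v u = 0}" using V(2) by (auto simp: V'_def)
    then have inv: "invariant_subspace G R V'"
      using orthogonal_complement_invariant[OF R W(1)] less.prems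
      unfolding invariant_subspace_def by (auto simp: cfun.subspace_inter image_subset_iff)
    have fin: "finite X" "V \<subseteq> coord_space X"
      using R V by (auto simp: unitary_rep_def)
    have "W \<noteq> {0}" using W(3) by (simp add: irreducible_rep_def)
    then obtain x where x: "x \<in> W" "x \<noteq> 0"
      using cfun.subspace_0[OF invariant_subspaceD(1)[OF W(1)]] by blast
    then have "x \<notin> V'" using inner_on_self_eq_0[OF fin(1), of x] W(2) fin(2) by (auto simp: V'_def)
    then have "V' \<subset> V" using x W(2) by (auto simp: V'_def)
    then have "cfun.dim V' < cfun.dim V"
      using dim_psubset_coord_space[OF fin] inv by (simp add: invariant_subspace_def)
    then obtain \<W> where "irreducible_decomposition G (subrep R V') \<W>"
      using less.hyps inv by blast
    then show ?thesis
      using irreducible_decomposition_insert[OF R less.prems W V'_def] by blast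
  qed
qed

text \<open>Every decomposition yields the same dimension, so the number described by
  \<open>rep_multiplicity\<close> is unique; complete reducibility supplies a decomposition.\<close>

lemma rep_multiplicity_eq_dim:
  assumes R: "unitary_rep G R X" and S: "irreducible_rep G S" and e: "e \<in> rspace S" "e \<noteq> 0"
    and scalar: "\<And>f. rep_hom G S S f \<Longrightarrow> \<exists>c. \<forall>v\<in>rspace S. f v = cscale c v"
  shows "rep_multiplicity G S R = cfun.dim {f e | f. rep_hom G S R f}"
proof -
  have rep: "is_rep G R" using R by (simp add: unitary_rep_def)
  then have "invariant_subspace G R (rspace R)"
    using is_rep_act(1)[OF rep] by (auto simp: invariant_subspace_def is_repD(2))
  then obtain \<W> where "irreducible_decomposition G R \<W>"
    using irreducible_decomposition_exists[OF R] by force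
  moreover have "card {W\<in>\<W>. rep_iso G S (subrep R W)} = cfun.dim {f e | f. rep_hom G S R f}"
    if "irreducible_decomposition G R \<W>" for \<W>
  proof -
    interpret irreducible_sum G R \<W> using rep that by unfold_locales
    show ?thesis using card_isomorphic_summands[OF S e scalar] .
  qed
  ultimately show ?thesis
    unfolding rep_multiplicity_def by (intro the_equality) auto
qed


section \<open>A rearrangement inequality\<close>

text \<open>The classes of \<open>r\<close> are rearranged independently; on each class
  \<open>c\<close> is injective and \<open>l\<close> weakly increasing in \<open>c\<close>. The
  induction removes an element \<open>a\<close> with largest \<open>c\<close>, after a transposition
  has made the permutation fix it. In the equality case only ties in \<open>l\<close> can have been
  permuted. It is applied with rows as classes and columns as weights, and the other way
  round.\<close>

lemma rearrangement_inequality: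
  fixes c l :: "'a \<Rightarrow> int" and r :: "'a \<Rightarrow> 'b"
  assumes "finite S" "\<pi> permutes S" "\<And>x. x \<in> S \<Longrightarrow> r (\<pi> x) = r x"
    and "\<And>x y. x \<in> S \<Longrightarrow> y \<in> S \<Longrightarrow> r x = r y \<Longrightarrow> c x = c y \<Longrightarrow> x = y"
    and "\<And>x y. x \<in> S \<Longrightarrow> y \<in> S \<Longrightarrow> r x = r y \<Longrightarrow> c x < c y \<Longrightarrow> l x \<le> l y"
  shows "(\<Sum>x\<in>S. c (\<pi> x) * l x) \<le> (\<Sum>x\<in>S. c x * l x) \<and>
    ((\<Sum>x\<in>S. c (\<pi> x) * l x) = (\<Sum>x\<in>S. c x * l x) \<longrightarrow> (\<forall>x\<in>S. l (\<pi> x) = l x))"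
  using assms
proof (induction "card S" arbitrary: S \<pi>)
  case 0
  then show ?case by simp
next
  case (Suc m)
  have "S \<noteq> {}" using Suc.hyps(2) by auto
  then have "Max (c ` S) \<in> c ` S" using Suc.prems(1) by simp
  then obtain a where "a \<in> S" "Max (c ` S) = c a" by (rule imageE) simp
  then have a: "a \<in> S" "\<And>x. x \<in> S \<Longrightarrow> c x \<le> c a"
    using Max_ge[of "c ` S"] Suc.prems(1) by auto
  define y where "y = inv' \<pi> a"
  define z where "z = \<pi> a"
  define \<tau> where "\<tau> = transpose a y"
  define \<pi>' where "\<pi>' = \<pi> \<circ> \<tau>"
  have y: "y \<in> S" "\<pi> y = a"
    using a Suc.prems(2) by (auto simp: y_def permutes_inv permutes_in_image permutes_inverses)
  have z: "z \<in> S" using a Suc.prems(2) by (simp add: z_def permutes_in_image)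
  have ry: "r y = r a" "r z = r a" using Suc.prems(3)[OF y(1)] Suc.prems(3)[OF a(1)] y z_def by auto
  have \<tau>: "\<tau> permutes S" unfolding \<tau>_def using a y by (intro permutes_swap_id)
  then have \<pi>'S: "\<pi>' permutes S" unfolding \<pi>'_def using Suc.prems(2) by (rule permutes_compose)
  have fx: "\<pi>' a = a" "\<pi>' y = z" by (simp_all add: \<pi>'_def \<tau>_def y z_def)
  have \<pi>': "\<pi>' permutes (S - {a})"
    by (rule permutes_superset[OF \<pi>'S]) (use fx in auto)
  have r': "r (\<pi>' x) = r x" if "x \<in> S" for x
    using that Suc.prems(3) ry y z_def by (auto simp: \<pi>'_def \<tau>_def transpose_def)
  let ?S = "S - {a}"
  have IH: "(\<Sum>x\<in>?S. c (\<pi>' x) * l x) \<le> (\<Sum>x\<in>?S. c x * l x) \<and>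
    ((\<Sum>x\<in>?S. c (\<pi>' x) * l x) = (\<Sum>x\<in>?S. c x * l x) \<longrightarrow> (\<forall>x\<in>?S. l (\<pi>' x) = l x))"
    using Suc.hyps(2) Suc.prems a(1) r' by (intro Suc.hyps(1) \<pi>') auto
  \<comment> \<open>The gain from the exchange. Its first factor is nonnegative by maximality of
    \<open>c a\<close>, the second because \<open>y\<close> lies in the class of
    \<open>a\<close>.\<close>
  define D where "D = (c a - c z) * (l a - l y)"
  have split: "(\<Sum>x\<in>S. f x) = f a + (\<Sum>x\<in>?S. f x)" for f :: "'a \<Rightarrow> int"
    using a(1) Suc.prems(1) by (simp add: sum.remove)
  have "(\<Sum>x\<in>S. c (\<pi> x) * l x) = (\<Sum>x\<in>S. c (\<pi>' x) * l (\<tau> x))"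
    using sum.permute[OF \<tau>, of "\<lambda>x. c (\<pi> x) * l x"] by (simp add: \<pi>'_def)
  moreover have "(\<Sum>x\<in>S. c (\<pi>' x) * l x) - (\<Sum>x\<in>S. c (\<pi>' x) * l (\<tau> x)) = D"
  proof -
    have "(\<Sum>x\<in>S. c (\<pi>' x) * l x) - (\<Sum>x\<in>S. c (\<pi>' x) * l (\<tau> x)) =
        (\<Sum>x\<in>S. c (\<pi>' x) * (l x - l (\<tau> x)))"
      by (simp add: sum_subtractf algebra_simps)
    also have "\<dots> = (\<Sum>x\<in>{a, y}. c (\<pi>' x) * (l x - l (\<tau> x)))"
      by (rule sum.mono_neutral_right) (use Suc.prems(1) a y in \<open>auto simp: \<tau>_def transpose_def\<close>)
    also have "\<dots> = D"
    proof (cases "y = a")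
      case False
      then show ?thesis by (simp add: fx D_def) (simp add: \<tau>_def algebra_simps)
    qed (simp add: D_def \<tau>_def)
    finally show ?thesis .
  qed
  ultimately have sums: "(\<Sum>x\<in>S. c x * l x) - (\<Sum>x\<in>S. c (\<pi> x) * l x) =
      (\<Sum>x\<in>?S. c x * l x) - (\<Sum>x\<in>?S. c (\<pi>' x) * l x) + D"
    using split[of "\<lambda>x. c x * l x"] split[of "\<lambda>x. c (\<pi>' x) * l x"] fx by simp
  have le: "l x \<le> l a" if "x \<in> S" "r x = r a" for x
    using that a Suc.prems(4)[of x a] Suc.prems(5)[of x a] by (metis order_le_less order_refl)
  have D: "D \<ge> 0" unfolding D_def using a(2)[OF z] le[OF y(1) ry(1)] by simp
  have "\<forall>x\<in>S. l (\<pi> x) = l x" if eq: "(\<Sum>x\<in>S. c (\<pi> x) * l x) = (\<Sum>x\<in>S. c x * l x)"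
  proof
    have "D = 0" "(\<Sum>x\<in>?S. c (\<pi>' x) * l x) = (\<Sum>x\<in>?S. c x * l x)" using eq sums D IH by linarith+
    then have l': "l (\<pi>' x) = l x" if "x \<in> S" for x using that IH fx by (cases "x = a") auto
    \<comment> \<open>\<open>D = 0\<close> leaves only the alternative \<open>c a = c z\<close>;
      injectivity of \<open>c\<close> on the class then gives \<open>z = a\<close> and hence
      \<open>y = a\<close>.\<close>
    have "l a = l y"
    proof (rule ccontr)
      assume "l a \<noteq> l y"
      then have "c a = c z" using \<open>D = 0\<close> by (simp add: D_def)
      then have "z = a" using Suc.prems(4)[OF z a(1)] ry by simp
      then have "y = a" using y(2) z_def injD[OF permutes_inj[OF Suc.prems(2)], of y a] by simp
      then show False using \<open>l a \<noteq> l y\<close> by simp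
    qed
    fix x assume x: "x \<in> S"
    have "\<pi> x = \<pi>' (\<tau> x)" by (simp add: \<pi>'_def \<tau>_def)
    then have "l (\<pi> x) = l (\<tau> x)" using l' x \<tau> by (simp add: permutes_in_image)
    then show "l (\<pi> x) = l x" using \<open>l a = l y\<close> by (auto simp: \<tau>_def transpose_def split: if_splits)
  qed
  then show ?case using sums D IH by auto
qed


section \<open>Positions of the entries of a tableau\<close>

lemma finite_cells: "finite (cells lam)"
  and card_cells: "card (cells lam) = sum_list lam"
proof -
  have cells: "cells lam = Sigma {..<length lam} (\<lambda>i. {..<lam ! i})" by (auto simp: cells_def)
  show "finite (cells lam)" unfolding cells by auto
  show "card (cells lam) = sum_list lam"
    unfolding cells by (simp add: sum_list_sum_nth atLeast0LessThan)
qed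

lemma tableau_exists: obtains t where "tableau lam t"
  using ex_bij_betw_finite_nat finite_same_card_bij[OF finite_cells[of lam], of "{1..sum_list lam}"]
  by (auto simp: tableau_def card_cells)

lemma cells_down_closed:
  assumes "partition_of lam n" "(i, j) \<in> cells lam" "i' \<le> i" "j' \<le> j"
  shows "(i', j') \<in> cells lam"
proof -
  have "lam ! i \<le> lam ! i'"
    using assms sorted_wrt_nth_less[of "(\<ge>)" lam i' i]
    by (cases "i' = i") (auto simp: partition_of_def cells_def)
  then show ?thesis using assms by (auto simp: cells_def)
qed

abbreviation tabloid_act :: "(nat \<Rightarrow> nat) \<Rightarrow> nat set list \<Rightarrow> nat set list"
  where "tabloid_act \<sigma> \<equiv> map ((`) \<sigma>)"

locale young_tableau =
  fixes lam :: "nat list" and n :: nat and t :: "nat \<times> nat \<Rightarrow> nat"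
  assumes partition: "partition_of lam n" and tableau: "tableau lam t"
begin

lemma sum_lam: "sum_list lam = n"
  using partition by (simp add: partition_of_def)

lemma bij_t: "bij_betw t (cells lam) {1..n}"
  using tableau by (simp add: tableau_def sum_lam)

definition row :: "nat \<Rightarrow> nat" where "row x = fst (inv_into (cells lam) t x)"
definition col :: "nat \<Rightarrow> nat" where "col x = snd (inv_into (cells lam) t x)"

lemma row_t [simp]: "(i, j) \<in> cells lam \<Longrightarrow> row (t (i, j)) = i"
  and col_t [simp]: "(i, j) \<in> cells lam \<Longrightarrow> col (t (i, j)) = j"
  using bij_t by (simp_all add: row_def col_def bij_betw_def)

lemma t_in: "(i, j) \<in> cells lam \<Longrightarrow> t (i, j) \<in> {1..n}"
  using bij_t by (auto simp: bij_betw_def)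

lemma entry_cases:
  assumes "x \<in> {1..n}"
  obtains i j where "(i, j) \<in> cells lam" "x = t (i, j)" "row x = i" "col x = j"
proof -
  obtain i j where "(i, j) \<in> cells lam" "x = t (i, j)"
    using assms bij_betw_imp_surj_on[OF bij_t] by (metis imageE old.prod.exhaust)
  then show ?thesis using that row_t col_t by blast
qed

lemma row_col_in: "x \<in> {1..n} \<Longrightarrow> (row x, col x) \<in> cells lam"
  and t_row_col [simp]: "x \<in> {1..n} \<Longrightarrow> t (row x, col x) = x"
  by (metis entry_cases)+

lemma row_col_eq: "x \<in> {1..n} \<Longrightarrow> y \<in> {1..n} \<Longrightarrow> row x = row y \<Longrightarrow> col x = col y \<Longrightarrow> x = y"
  by (metis t_row_col)

lemma column_entries: "{t (i, j) | i. (i, j) \<in> cells lam} = {x \<in> {1..n}. col x = j}"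
proof (intro equalityI subsetI)
  fix x assume "x \<in> {t (i, j) | i. (i, j) \<in> cells lam}"
  then show "x \<in> {x \<in> {1..n}. col x = j}" using t_in by auto
next
  fix x assume "x \<in> {x \<in> {1..n}. col x = j}"
  then show "x \<in> {t (i, j) | i. (i, j) \<in> cells lam}"
    using row_col_in[of x] t_row_col[of x] by force
qed

lemma row_entries: "{t (i, j) | j. (i, j) \<in> cells lam} = {x \<in> {1..n}. row x = i}"
proof (intro equalityI subsetI)
  fix x assume "x \<in> {t (i, j) | j. (i, j) \<in> cells lam}"
  then show "x \<in> {x \<in> {1..n}. row x = i}" using t_in by auto
next
  fix x assume "x \<in> {x \<in> {1..n}. row x = i}"
  then show "x \<in> {t (i, j) | j. (i, j) \<in> cells lam}"
    using row_col_in[of x] t_row_col[of x] by force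
qed

text \<open>An injection that maps a finite column into itself maps it onto itself, so the setwise
  condition can be tested entry by entry.\<close>

lemma column_stabilizer_iff:
  "\<sigma> \<in> column_stabilizer lam t \<longleftrightarrow> \<sigma> permutes {1..n} \<and> (\<forall>x\<in>{1..n}. col (\<sigma> x) = col x)"
proof (cases "\<sigma> permutes {1..n}")
  case True
  have "(\<forall>j. \<sigma> ` {x \<in> {1..n}. col x = j} = {x \<in> {1..n}. col x = j}) \<longleftrightarrow>
      (\<forall>x\<in>{1..n}. col (\<sigma> x) = col x)" (is "?l \<longleftrightarrow> ?r")
  proof
    assume ?l
    then show ?r by blast
  next
    assume r: ?r
    show ?l
    proof
      fix j
      have "\<sigma> ` {x \<in> {1..n}. col x = j} \<subseteq> {x \<in> {1..n}. col x = j}"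
        using r permutes_in_image[OF True] by auto
      moreover have "inj_on \<sigma> {x \<in> {1..n}. col x = j}"
        using permutes_inj[OF True] by (rule inj_on_subset) auto
      ultimately show "\<sigma> ` {x \<in> {1..n}. col x = j} = {x \<in> {1..n}. col x = j}"
        by (intro endo_inj_surj) auto
    qed
  qed
  then show ?thesis using True by (simp add: column_stabilizer_def column_entries sum_lam)
qed (simp add: column_stabilizer_def sum_lam)

lemma finite_column_stabilizer: "finite (column_stabilizer lam t)"
  by (rule finite_subset[OF _ finite_permutations[of "{1..n}"]]) (auto simp: column_stabilizer_iff)

lemma column_stabilizer_comp:
  assumes "\<sigma> \<in> column_stabilizer lam t" "\<tau> \<in> column_stabilizer lam t"
  shows "\<sigma> \<circ> \<tau> \<in> column_stabilizer lam t"
  using assms permutes_in_image permutes_compose unfolding column_stabilizer_iff comp_apply by metis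

lemma column_stabilizer_inv:
  assumes "\<sigma> \<in> column_stabilizer lam t"
  shows "inv' \<sigma> \<in> column_stabilizer lam t"
proof -
  have p: "\<sigma> permutes {1..n}" using assms by (simp add: column_stabilizer_iff)
  have "col (inv' \<sigma> x) = col x" if "x \<in> {1..n}" for x
  proof -
    have "inv' \<sigma> x \<in> {1..n}" using that permutes_in_image[OF permutes_inv[OF p]] by blast
    then show ?thesis using assms permutes_inverses(1)[OF p, of x] unfolding column_stabilizer_iff by metis
  qed
  then show ?thesis using permutes_inv[OF p] by (simp add: column_stabilizer_iff)
qed

lemma length_tabloid [simp]: "length (tabloid lam t) = length lam"
  by (simp add: tabloid_def)

lemma nth_tabloid: "i < length lam \<Longrightarrow> tabloid lam t ! i = {x \<in> {1..n}. row x = i}"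
  by (simp add: tabloid_def row_entries)

lemma tabloid_comp: "tabloid lam (\<sigma> \<circ> t) = tabloid_act \<sigma> (tabloid lam t)"
  by (auto simp: tabloid_def)

text \<open>The stabilizer of the tabloid is the row stabilizer, for the same reason as with
  columns: an injection of a finite row into itself is onto.\<close>

lemma tabloid_act_fix_iff:
  assumes "\<rho> permutes {1..n}"
  shows "tabloid_act \<rho> (tabloid lam t) = tabloid lam t \<longleftrightarrow> (\<forall>x\<in>{1..n}. row (\<rho> x) = row x)"
proof -
  have "tabloid_act \<rho> (tabloid lam t) = tabloid lam t \<longleftrightarrow>
      (\<forall>i<length lam. \<rho> ` {x \<in> {1..n}. row x = i} = {x \<in> {1..n}. row x = i})"
    by (auto simp: list_eq_iff_nth_eq nth_tabloid)
  also have "\<dots> \<longleftrightarrow> (\<forall>x\<in>{1..n}. row (\<rho> x) = row x)" (is "?l \<longleftrightarrow> ?r")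
  proof
    assume l: ?l
    show ?r
    proof
      fix x assume x: "x \<in> {1..n}"
      then have "row x < length lam" using row_col_in by (auto simp: cells_def)
      then show "row (\<rho> x) = row x" using l x by blast
    qed
  next
    assume r: ?r
    show ?l
    proof (intro allI impI)
      fix i
      have "\<rho> ` {x \<in> {1..n}. row x = i} \<subseteq> {x \<in> {1..n}. row x = i}"
        using r permutes_in_image[OF assms] by auto
      moreover have "inj_on \<rho> {x \<in> {1..n}. row x = i}"
        using permutes_inj[OF assms] by (rule inj_on_subset) auto
      ultimately show "\<rho> ` {x \<in> {1..n}. row x = i} = {x \<in> {1..n}. row x = i}"
        by (intro endo_inj_surj) auto
    qed
  qed
  finally show ?thesis .
qed

text \<open>Both column pieces include row \<open>q\<close>; this overlap makes the set larger by
  one than column \<open>j\<close>, enough for a pigeonhole argument. The columns are arbitrary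
  rather than adjacent because \<open>semistandard\<close> compares arbitrary entries of a
  row.\<close>

definition garnir_set :: "nat \<Rightarrow> nat \<Rightarrow> nat \<Rightarrow> nat set"
  where "garnir_set q j k = {x \<in> {1..n}. col x = j \<and> q \<le> row x} \<union> {x \<in> {1..n}. col x = k \<and> row x \<le> q}"

lemma garnir_set_subset: "garnir_set q j k \<subseteq> {1..n}"
  by (auto simp: garnir_set_def)

text \<open>Column \<open>j\<close> loses its \<open>q\<close> entries above row \<open>q\<close>,
  and column \<open>k\<close> contributes \<open>q + 1\<close> entries.\<close>

lemma card_garnir_set:
  assumes "(q, k) \<in> cells lam" "j < k"
  shows "card (garnir_set q j k) = Suc (card {i. (i, j) \<in> cells lam})"
proof -
  let ?A = "{x \<in> {1..n}. col x = j \<and> q \<le> row x}" and ?B = "{x \<in> {1..n}. col x = k \<and> row x \<le> q}"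
  let ?C = "{i. (i, j) \<in> cells lam}"
  have fin: "finite ?C" by (rule finite_subset[of _ "{..<length lam}"]) (auto simp: cells_def)
  have "inj_on row {x \<in> {1..n}. col x = j'}" for j'
    unfolding inj_on_def using row_col_eq by blast
  then have inj: "inj_on row ?A" "inj_on row ?B" by (auto simp: inj_on_def)
  have "row ` ?A = {i \<in> ?C. q \<le> i}"
  proof
    show "row ` ?A \<subseteq> {i \<in> ?C. q \<le> i}" using row_col_in by blast
    show "{i \<in> ?C. q \<le> i} \<subseteq> row ` ?A"
    proof
      fix i assume "i \<in> {i \<in> ?C. q \<le> i}"
      then show "i \<in> row ` ?A" using t_in[of i j] by (intro image_eqI[of _ _ "t (i, j)"]) auto
    qed
  qed
  then have A: "card ?A = card {i \<in> ?C. q \<le> i}" using card_image[OF inj(1)] by simp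
  have k: "(i, k) \<in> cells lam" if "i \<le> q" for i using cells_down_closed[OF partition assms(1) that] by simp
  have "row ` ?B = {..q}"
  proof
    show "{..q} \<subseteq> row ` ?B"
    proof
      fix i assume "i \<in> {..q}"
      then show "i \<in> row ` ?B" using t_in[OF k[of i]] k[of i] by (intro image_eqI[of _ _ "t (i, k)"]) auto
    qed
  qed auto
  then have B: "card ?B = Suc q" using card_image[OF inj(2)] by simp
  have "card ?C = card ({i \<in> ?C. q \<le> i} \<union> {..<q})"
    using cells_down_closed[OF partition assms(1)] assms(2) by (intro arg_cong[of _ _ card]) auto
  also have "card ({i \<in> ?C. q \<le> i} \<union> {..<q}) = card {i \<in> ?C. q \<le> i} + card {..<q}"
    using fin by (intro card_Un_disjoint) auto
  finally have "card ?C = card {i \<in> ?C. q \<le> i} + q" by simp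
  moreover have "card (garnir_set q j k) = card ?A + card ?B"
    unfolding garnir_set_def using assms(2) by (intro card_Un_disjoint) auto
  ultimately show ?thesis using A B by simp
qed

end


section \<open>Semistandard points of a labelled action\<close>

definition (in young_tableau) semistandard :: "(nat \<Rightarrow> nat) \<Rightarrow> bool"
  where "semistandard L \<longleftrightarrow>
    (\<forall>x\<in>{1..n}. \<forall>y\<in>{1..n}. row x = row y \<and> col x < col y \<longrightarrow> L x \<le> L y) \<and>
    (\<forall>x\<in>{1..n}. \<forall>y\<in>{1..n}. col x = col y \<and> row x < row y \<longrightarrow> L x < L y)"

text \<open>
  A point \<open>w\<close> of a permutation representation assigns labels to the entries of the tableau; it is
  thought of as a filling of the shape, on which the permutations act by moving the labels.
\<close>

locale labelled_action =
  fixes n :: nat and act :: "(nat \<Rightarrow> nat) \<Rightarrow> 'b \<Rightarrow> 'b" and \<Omega> :: "'b set" and lab :: "'b \<Rightarrow> nat \<Rightarrow> nat"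
  assumes finite_points: "finite \<Omega>"
    and act_comp: "act (\<sigma> \<circ> \<tau>) w = act \<sigma> (act \<tau> w)"
    and act_id: "act id w = w"
    and act_in: "\<sigma> permutes {1..n} \<Longrightarrow> w \<in> \<Omega> \<Longrightarrow> act \<sigma> w \<in> \<Omega>"
    and lab_act: "\<sigma> permutes {1..n} \<Longrightarrow> w \<in> \<Omega> \<Longrightarrow> x \<in> {1..n} \<Longrightarrow> lab (act \<sigma> w) (\<sigma> x) = lab w x"
    and act_fix: "\<sigma> permutes {1..n} \<Longrightarrow> w \<in> \<Omega> \<Longrightarrow> (\<And>x. x \<in> {1..n} \<Longrightarrow> lab w (\<sigma> x) = lab w x) \<Longrightarrow> act \<sigma> w = w"
begin

lemma act_inverse:
  assumes "\<sigma> permutes {1..n}"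
  shows "act (inv' \<sigma>) (act \<sigma> w) = w" "act \<sigma> (act (inv' \<sigma>) w) = w"
  using permutes_inv_o[OF assms] by (simp_all flip: act_comp add: act_id)

end

locale labelled_tableau = young_tableau lam n t + labelled_action n act \<Omega> lab
  for lam :: "nat list" and n :: nat and t :: "nat \<times> nat \<Rightarrow> nat"
    and act :: "(nat \<Rightarrow> nat) \<Rightarrow> 'b \<Rightarrow> 'b" and \<Omega> :: "'b set" and lab :: "'b \<Rightarrow> nat \<Rightarrow> nat"
begin

text \<open>A numerical substitute for the dominance order: \<open>moment col\<close> grows when
  larger labels move to the right, \<open>moment row\<close> when they move down. It is
  integer-valued because differences are taken.\<close>

definition moment :: "(nat \<Rightarrow> nat) \<Rightarrow> 'b \<Rightarrow> int"
  where "moment f w = (\<Sum>x\<in>{1..n}. int (f x) * int (lab w x))"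

lemma moment_act:
  assumes "\<sigma> permutes {1..n}" "w \<in> \<Omega>"
  shows "moment f (act \<sigma> w) = (\<Sum>x\<in>{1..n}. int (f (\<sigma> x)) * int (lab w x))"
proof -
  have "moment f (act \<sigma> w) = (\<Sum>x\<in>{1..n}. int (f (\<sigma> x)) * int (lab (act \<sigma> w) (\<sigma> x)))"
    unfolding moment_def using sum.permute[OF assms(1)] by simp
  also have "\<dots> = (\<Sum>x\<in>{1..n}. int (f (\<sigma> x)) * int (lab w x))"
    using lab_act[OF assms] by (intro sum.cong) auto
  finally show ?thesis .
qed

lemma moment_col_act:
  assumes "\<sigma> \<in> column_stabilizer lam t" "w \<in> \<Omega>"
  shows "moment col (act \<sigma> w) = moment col w"
  using assms by (simp add: moment_act column_stabilizer_iff) (simp add: moment_def)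

text \<open>The labels of a semistandard filling already increase along the rows, so by the
  rearrangement inequality no row permutation raises the column moment.\<close>

lemma moment_row_permutation:
  assumes "semistandard (lab w)" "w \<in> \<Omega>" "\<rho> permutes {1..n}" "\<And>x. x \<in> {1..n} \<Longrightarrow> row (\<rho> x) = row x"
  shows "moment col (act \<rho> w) \<le> moment col w"
    and "moment col (act \<rho> w) = moment col w \<Longrightarrow> act \<rho> w = w"
proof -
  have "(\<Sum>x\<in>{1..n}. int (col (\<rho> x)) * int (lab w x)) \<le> (\<Sum>x\<in>{1..n}. int (col x) * int (lab w x)) \<and>
    ((\<Sum>x\<in>{1..n}. int (col (\<rho> x)) * int (lab w x)) = (\<Sum>x\<in>{1..n}. int (col x) * int (lab w x)) \<longrightarrow>
      (\<forall>x\<in>{1..n}. int (lab w (\<rho> x)) = int (lab w x)))"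
  proof (rule rearrangement_inequality[where r = row])
    fix x y assume xy: "x \<in> {1..n}" "y \<in> {1..n}" "row x = row y"
    show "x = y" if "int (col x) = int (col y)" using row_col_eq[OF xy] that by simp
    show "int (lab w x) \<le> int (lab w y)" if "int (col x) < int (col y)"
      using xy that assms(1) unfolding semistandard_def by simp
  qed (use assms in auto)
  then show "moment col (act \<rho> w) \<le> moment col w"
    and "moment col (act \<rho> w) = moment col w \<Longrightarrow> act \<rho> w = w"
    using act_fix[OF assms(3,2)] unfolding moment_act[OF assms(3,2)] unfolding moment_def by auto
qed

lemma moment_column_permutation:
  assumes "semistandard (lab w)" "w \<in> \<Omega>" "\<sigma> \<in> column_stabilizer lam t"
  shows "moment row (act \<sigma> w) \<le> moment row w"
    and "moment row (act \<sigma> w) = moment row w \<Longrightarrow> act \<sigma> w = w"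
proof -
  have \<sigma>: "\<sigma> permutes {1..n}" "\<And>x. x \<in> {1..n} \<Longrightarrow> col (\<sigma> x) = col x"
    using assms(3) by (simp_all add: column_stabilizer_iff)
  have "(\<Sum>x\<in>{1..n}. int (row (\<sigma> x)) * int (lab w x)) \<le> (\<Sum>x\<in>{1..n}. int (row x) * int (lab w x)) \<and>
    ((\<Sum>x\<in>{1..n}. int (row (\<sigma> x)) * int (lab w x)) = (\<Sum>x\<in>{1..n}. int (row x) * int (lab w x)) \<longrightarrow>
      (\<forall>x\<in>{1..n}. int (lab w (\<sigma> x)) = int (lab w x)))"
  proof (rule rearrangement_inequality[where r = col])
    fix x y assume xy: "x \<in> {1..n}" "y \<in> {1..n}" "col x = col y"
    show "x = y" if "int (row x) = int (row y)" using row_col_eq[OF xy(1,2) _ xy(3)] that by simp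
    show "int (lab w x) \<le> int (lab w y)" if "int (row x) < int (row y)"
      using xy that assms(1) unfolding semistandard_def by (simp add: less_imp_le)
  qed (use \<sigma> in auto)
  then show "moment row (act \<sigma> w) \<le> moment row w"
    and "moment row (act \<sigma> w) = moment row w \<Longrightarrow> act \<sigma> w = w"
    using act_fix[OF \<sigma>(1) assms(2)] unfolding moment_act[OF \<sigma>(1) assms(2)] unfolding moment_def by auto
qed

text \<open>Each of the two fillings has the largest row moment among the column rearrangements of
  the other, so the moments agree and the equality case applies.\<close>

lemma semistandard_column_unique:
  assumes "semistandard (lab w)" "w \<in> \<Omega>" "\<sigma> \<in> column_stabilizer lam t" "semistandard (lab (act \<sigma> w))"
  shows "act \<sigma> w = w"
proof -
  have \<sigma>: "\<sigma> permutes {1..n}" using assms(3) by (simp add: column_stabilizer_iff)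
  have "moment row w \<le> moment row (act \<sigma> w)"
    using moment_column_permutation(1)[OF assms(4) act_in[OF \<sigma> assms(2)] column_stabilizer_inv[OF assms(3)]]
      act_inverse[OF \<sigma>] by simp
  then show ?thesis using moment_column_permutation[OF assms(1-3)] by simp
qed

text \<open>Labels are strictly increasing, hence distinct, within a column; a column permutation
  that preserves them moves nothing.\<close>

lemma semistandard_column_fix:
  assumes "semistandard (lab w)" "w \<in> \<Omega>" "\<sigma> \<in> column_stabilizer lam t" "act \<sigma> w = w"
  shows "\<sigma> = id"
proof
  have \<sigma>: "\<sigma> permutes {1..n}" "\<And>x. x \<in> {1..n} \<Longrightarrow> col (\<sigma> x) = col x"
    using assms(3) by (simp_all add: column_stabilizer_iff)
  fix x
  show "\<sigma> x = id x"
  proof (cases "x \<in> {1..n}")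
    case True
    have x': "\<sigma> x \<in> {1..n}" using True permutes_in_image[OF \<sigma>(1)] by blast
    have "lab w (\<sigma> x) = lab w x" using lab_act[OF \<sigma>(1) assms(2) True] assms(4) by simp
    then have "\<not> row (\<sigma> x) < row x" "\<not> row x < row (\<sigma> x)"
      using assms(1) \<sigma>(2)[OF True] True x' unfolding semistandard_def by (metis less_irrefl)+
    then show ?thesis using row_col_eq[OF x' True] \<sigma>(2)[OF True] by simp
  qed (use permutes_not_in[OF \<sigma>(1)] in simp)
qed

text \<open>
  A nonzero \<open>v\<close> has a point in its support which maximizes the moment of the columns and then that
  of the rows; such a point is semistandard, since otherwise a column transposition or a Garnir
  relation would produce a larger point.
\<close>

lemma zero_if_zero_on_semistandard:
  fixes v :: "'b \<Rightarrow> complex"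
  assumes supp: "\<And>w. w \<notin> \<Omega> \<Longrightarrow> v w = 0"
    and alt: "\<And>\<sigma> w. \<sigma> \<in> column_stabilizer lam t \<Longrightarrow> w \<in> \<Omega> \<Longrightarrow> v (act \<sigma> w) = of_int (sign \<sigma>) * v w"
    and garnir: "\<And>q j k w. (q, k) \<in> cells lam \<Longrightarrow> j < k \<Longrightarrow> w \<in> \<Omega> \<Longrightarrow>
      (\<Sum>\<pi> | \<pi> permutes garnir_set q j k. of_int (sign \<pi>) * v (act \<pi> w)) = 0"
    and zero: "\<And>w. w \<in> \<Omega> \<Longrightarrow> semistandard (lab w) \<Longrightarrow> v w = 0"
  shows "v = 0"
proof (rule ccontr)
  note [simp del] = One_nat_def atLeastAtMost_iff
  define S where "S = {w\<in>\<Omega>. v w \<noteq> 0}"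
  assume "v \<noteq> 0"
  then have "S \<noteq> {}" using supp by (auto simp: S_def fun_eq_iff)
  have "finite S" using finite_points by (simp add: S_def)
  define S' where "S' = {w\<in>S. moment col w = Max (moment col ` S)}"
  have "Max (moment col ` S) \<in> moment col ` S" using \<open>finite S\<close> \<open>S \<noteq> {}\<close> by simp
  then have S': "finite S'" "S' \<noteq> {}" using \<open>finite S\<close> by (auto simp: S'_def)
  then have "Max (moment row ` S') \<in> moment row ` S'" by simp
  then obtain w where w: "w \<in> S'" "moment row w = Max (moment row ` S')" by auto
  have w\<Omega>: "w \<in> \<Omega>" "v w \<noteq> 0" using w(1) by (auto simp: S'_def S_def)
  have max_col: "moment col w' \<le> moment col w" if "w' \<in> \<Omega>" "v w' \<noteq> 0" for w'
    using that w(1) \<open>finite S\<close> by (auto simp: S'_def S_def)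
  have max_row: "moment row w' \<le> moment row w"
    if "w' \<in> \<Omega>" "v w' \<noteq> 0" "moment col w' = moment col w" for w'
    using that w S'(1) by (auto simp: S'_def S_def)
  have column: "lab w x < lab w y"
    if xy: "x \<in> {1..n}" "y \<in> {1..n}" "col x = col y" "row x < row y" for x y
  proof (rule ccontr)
    assume less: "\<not> lab w x < lab w y"
    let ?\<sigma> = "transpose x y"
    have \<sigma>: "?\<sigma> permutes {1..n}" using xy by (intro permutes_swap_id)
    have C: "?\<sigma> \<in> column_stabilizer lam t"
      using \<sigma> xy by (auto simp: column_stabilizer_iff transpose_def)
    have "x \<noteq> y" using xy by auto
    then have v: "v (act ?\<sigma> w) = - v w" using alt[OF C w\<Omega>(1)] by (simp add: sign_swap_id)
    have "lab w x \<noteq> lab w y"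
    proof
      assume "lab w x = lab w y"
      then have "act ?\<sigma> w = w" by (intro act_fix \<sigma> w\<Omega>) (auto simp: transpose_def)
      then show False using v w\<Omega> by simp
    qed
    then have lt: "lab w y < lab w x" using less by simp
    \<comment> \<open>Exchanging labels that decrease down the column raises the row moment, keeps
      the column moment and only flips the sign of \<open>v\<close>, against the choice of
      \<open>w\<close>.\<close>
    have "moment row (act ?\<sigma> w) - moment row w =
        (\<Sum>z\<in>{1..n}. (int (row (?\<sigma> z)) - int (row z)) * int (lab w z))"
      unfolding moment_act[OF \<sigma> w\<Omega>(1)] by (simp add: moment_def sum_subtractf algebra_simps)
    also have "\<dots> = (\<Sum>z\<in>{x, y}. (int (row (?\<sigma> z)) - int (row z)) * int (lab w z))"
      by (rule sum.mono_neutral_right) (use xy in \<open>auto simp: transpose_def\<close>)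
    also have "\<dots> = (int (row y) - int (row x)) * (int (lab w x) - int (lab w y))"
      using \<open>x \<noteq> y\<close> by (simp add: algebra_simps)
    also have "\<dots> > 0" using lt xy by simp
    finally have "moment row (act ?\<sigma> w) > moment row w" by simp
    moreover have "moment col (act ?\<sigma> w) = moment col w" using moment_col_act[OF C w\<Omega>(1)] .
    ultimately show False using max_row[OF act_in[OF \<sigma> w\<Omega>(1)]] v w\<Omega> by simp
  qed
  have "lab w x \<le> lab w y"
    if xy: "x \<in> {1..n}" "y \<in> {1..n}" "row x = row y" "col x < col y" for x y
  proof (rule ccontr)
    assume "\<not> lab w x \<le> lab w y"
    then have lt: "lab w y < lab w x" by simp
    let ?q = "row x" and ?j = "col x" and ?k = "col y"
    let ?A = "{z \<in> {1..n}. col z = ?j \<and> ?q \<le> row z}" and ?B = "{z \<in> {1..n}. col z = ?k \<and> row z \<le> ?q}"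
    let ?G = "garnir_set ?q ?j ?k"
    have G: "?G = ?A \<union> ?B" by (simp add: garnir_set_def)
    \<comment> \<open>Since the columns are already known to be strict, the descent from
      \<open>x\<close> to \<open>y\<close> spreads to the Garnir set: labels on \<open>?A\<close>
      are at least \<open>lab w x\<close>, labels on \<open>?B\<close> are below it.\<close>
    have A: "lab w x \<le> lab w z" if "z \<in> ?A" for z
    proof (cases "row z = row x")
      case True
      then have "z = x" using that xy row_col_eq by blast
      then show ?thesis by simp
    next
      case False
      then show ?thesis using that xy column[of x z] by (simp add: less_imp_le)
    qed
    have B: "lab w z < lab w x" if "z \<in> ?B" for z
    proof (cases "row z = row y")
      case True
      then have "z = y" using that xy row_col_eq by blast
      then show ?thesis using lt by simp
    next
      case False
      then show ?thesis using that xy column[of z y] lt by simp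
    qed
    have "(\<Sum>\<pi> | \<pi> permutes ?G. of_int (sign \<pi>) * v (act \<pi> w)) = 0"
      using garnir[of ?q ?k ?j w] xy row_col_in[OF xy(2)] w\<Omega> by simp
    \<comment> \<open>A permutation that preserves \<open>?B\<close> is a column permutation and
      contributes \<open>v w\<close>; any other raises the column moment above its maximum, so its
      term vanishes. As \<open>id\<close> is of the first kind, the relation becomes a positive
      multiple of \<open>v w\<close>.\<close>
    moreover have "of_int (sign \<pi>) * v (act \<pi> w) = (if \<pi> ` ?B \<subseteq> ?B then v w else 0)" if \<pi>: "\<pi> permutes ?G" for \<pi>
    proof -
      have \<pi>n: "\<pi> permutes {1..n}" using permutes_subset[OF \<pi> garnir_set_subset] .
      have out: "\<pi> z = z" if "z \<notin> ?G" for z using permutes_not_in[OF \<pi> that] .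
      have inG: "\<pi> z \<in> ?G" if "z \<in> ?G" for z using that permutes_in_image[OF \<pi>] by blast
      show ?thesis
      proof (cases "\<pi> ` ?B \<subseteq> ?B")
        case True
        have "inj_on \<pi> ?B" using permutes_inj[OF \<pi>] by (rule inj_on_subset) auto
        then have eqB: "\<pi> ` ?B = ?B" using True by (intro endo_inj_surj) auto
        have "\<pi> z \<in> ?A" if z: "z \<in> ?A" for z
        proof (rule ccontr)
          assume "\<pi> z \<notin> ?A"
          then have "\<pi> z \<in> \<pi> ` ?B" using inG[of z] z G eqB by auto
          then have "z \<in> ?B" using permutes_inj[OF \<pi>] by (auto dest: injD)
          then show False using z xy by auto
        qed
        then have "col (\<pi> z) = col z" for z
          using True out[of z] G by (cases "z \<in> ?A"; cases "z \<in> ?B") auto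
        then have "\<pi> \<in> column_stabilizer lam t" using \<pi>n by (simp add: column_stabilizer_iff)
        then have "v (act \<pi> w) = of_int (sign \<pi>) * v w" using alt w\<Omega> by blast
        then have "of_int (sign \<pi>) * v (act \<pi> w) = of_int (sign \<pi> * sign \<pi>) * v w"
          by (simp only: of_int_mult mult.assoc)
        then show ?thesis using True by simp
      next
        case False
        then obtain b where b: "b \<in> ?B" "\<pi> b \<notin> ?B" by auto
        then have b': "\<pi> b \<in> ?A" using inG[of b] G by auto
        \<comment> \<open>The contribution of \<open>z\<close> to the change of the column moment,
          with labels measured from \<open>lab w x\<close>. The shift is harmless because \<pi>
          preserves the sum of all column indices, and it makes every term nonnegative.\<close>
        define d where "d z = (int (col (\<pi> z)) - int (col z)) * (int (lab w z) - int (lab w x))" for z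
        have d: "d z \<ge> 0" for z
        proof -
          consider "z \<in> ?A" | "z \<in> ?B" | "z \<notin> ?G" using G by blast
          then show ?thesis
          proof cases
            case 1
            then have "col (\<pi> z) = ?j \<or> col (\<pi> z) = ?k" using inG[of z] G by auto
            then have "int (col (\<pi> z)) - int (col z) \<ge> 0" using 1 xy by auto
            then show ?thesis unfolding d_def using A[OF 1] by simp
          next
            case 2
            then have "col (\<pi> z) = ?j \<or> col (\<pi> z) = ?k" using inG[of z] G by auto
            then have "int (col (\<pi> z)) - int (col z) \<le> 0" using 2 xy by auto
            moreover have "int (lab w z) - int (lab w x) \<le> 0" using B[OF 2] by simp
            ultimately show ?thesis unfolding d_def by (rule mult_nonpos_nonpos)
          next
            case 3
            then show ?thesis by (simp add: d_def out)
          qed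
        qed
        \<comment> \<open>\<open>b\<close> moves left, from column \<open>?k\<close> to column
          \<open>?j\<close>, and its label is below \<open>lab w x\<close>: both factors are
          negative.\<close>
        have "d b > 0"
          unfolding d_def using b b' B[OF b(1)] xy by (intro mult_neg_neg) auto
        then have "0 < (\<Sum>z\<in>{1..n}. d z)"
          using d b by (intro sum_pos2[of _ b]) auto
        also have "(\<Sum>z\<in>{1..n}. d z) = (\<Sum>z\<in>{1..n}. int (col (\<pi> z)) * int (lab w z)) -
            (\<Sum>z\<in>{1..n}. int (col z) * int (lab w z)) -
            int (lab w x) * ((\<Sum>z\<in>{1..n}. int (col (\<pi> z))) - (\<Sum>z\<in>{1..n}. int (col z)))"
          by (simp add: d_def algebra_simps sum.distrib sum_subtractf sum_distrib_left)
        also have "\<dots> = moment col (act \<pi> w) - moment col w"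
          using sum.permute[OF \<pi>n, of "\<lambda>z. int (col z)"]
          unfolding moment_act[OF \<pi>n w\<Omega>(1)] by (simp add: moment_def)
        finally have "v (act \<pi> w) = 0" using max_col[OF act_in[OF \<pi>n w\<Omega>(1)]] by fastforce
        then show ?thesis using False by simp
      qed
    qed
    ultimately have "(\<Sum>\<pi> | \<pi> permutes ?G. if \<pi> ` ?B \<subseteq> ?B then v w else 0) = 0" by simp
    moreover have fin: "finite {\<pi>. \<pi> permutes ?G}"
      using finite_subset[OF garnir_set_subset] by (intro finite_permutations) auto
    ultimately have "card {\<pi>. \<pi> permutes ?G \<and> \<pi> ` ?B \<subseteq> ?B} = 0"
      using w\<Omega>(2) by (simp add: sum.If_cases Collect_conj_eq[symmetric] Int_def)
    then have "{\<pi>. \<pi> permutes ?G \<and> \<pi> ` ?B \<subseteq> ?B} = {}"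
      using fin by simp
    moreover have "id \<in> {\<pi>. \<pi> permutes ?G \<and> \<pi> ` ?B \<subseteq> ?B}" by simp
    ultimately show False by (simp only: empty_iff)
  qed
  then have "semistandard (lab w)" using column unfolding semistandard_def by blast
  then show False using zero w\<Omega> by blast
qed

end


section \<open>Polytabloids\<close>

context young_tableau
begin

text \<open>As an orbit it provides for each tabloid a permutation \<open>g\<close>, through which
  labels and stabilizers are traced back to the base tabloid.\<close>

definition tabloids :: "nat set list set"
  where "tabloids = {tabloid_act g (tabloid lam t) | g. g permutes {1..n}}"

abbreviation "base_tabloid \<equiv> tabloid lam t"
abbreviation "base_polytabloid \<equiv> polytabloid lam t"

lemma tabloid_act_comp: "tabloid_act (\<sigma> \<circ> \<tau>) T = tabloid_act \<sigma> (tabloid_act \<tau> T)"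
  by (simp add: image_comp)

lemma tabloid_act_id: "tabloid_act id T = T"
  by simp

lemma tabloid_act_inverse:
  assumes "\<sigma> permutes S"
  shows "tabloid_act (inv' \<sigma>) (tabloid_act \<sigma> T) = T" "tabloid_act \<sigma> (tabloid_act (inv' \<sigma>) T) = T"
  using permutes_inv_o[OF assms] by (simp_all only: tabloid_act_comp[symmetric] tabloid_act_id)

lemma finite_tabloids: "finite tabloids"
proof -
  have "tabloids = (\<lambda>g. tabloid_act g (tabloid lam t)) ` {g. g permutes {1..n}}"
    by (auto simp: tabloids_def)
  then show ?thesis by (simp add: finite_permutations)
qed

lemma base_tabloid_in: "base_tabloid \<in> tabloids"
  unfolding tabloids_def using permutes_id tabloid_act_id by (metis (mono_tags, lifting) mem_Collect_eq)

lemma tabloid_act_in: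
  assumes "g permutes {1..n}" "T \<in> tabloids"
  shows "tabloid_act g T \<in> tabloids"
proof -
  obtain h where "h permutes {1..n}" "T = tabloid_act h (tabloid lam t)"
    using assms(2) by (auto simp: tabloids_def)
  then have "g \<circ> h permutes {1..n} \<and> tabloid_act g T = tabloid_act (g \<circ> h) (tabloid lam t)"
    using assms(1) permutes_compose tabloid_act_comp by metis
  then show ?thesis unfolding tabloids_def by blast
qed

lemma base_polytabloid_eq: "base_polytabloid =
    (\<Sum>\<sigma>\<in>column_stabilizer lam t. cscale (of_int (sign \<sigma>)) (indicator {tabloid_act \<sigma> base_tabloid}))"
  by (simp add: polytabloid_def tabloid_comp)

lemma ract_specht: "ract (specht lam) \<sigma> F T = F (tabloid_act (inv' \<sigma>) T)"
  by (simp add: specht_def)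

lemma ract_specht_indicator:
  assumes "\<sigma> permutes S"
  shows "ract (specht lam) \<sigma> (indicator {T}) = indicator {tabloid_act \<sigma> T}"
  using tabloid_act_inverse[OF assms] by (auto simp: ract_specht indicator_def fun_eq_iff simp del: map_map)

lemma permutation_if_permutes: "\<sigma> permutes {1..n} \<Longrightarrow> permutation \<sigma>"
  by (rule permutes_imp_permutation) auto

text \<open>Conjugation by \<open>g\<close> carries the column stabilizer of \<open>t\<close> to
  that of \<open>g \<circ> t\<close> and preserves signs.\<close>

lemma polytabloid_comp:
  assumes g: "g permutes {1..n}"
  shows "ract (specht lam) g base_polytabloid = polytabloid lam (g \<circ> t)"
proof -
  let ?C = "column_stabilizer lam t"
  have perm: "permutation \<sigma>" if "\<sigma> \<in> ?C" for \<sigma>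
    using that permutation_if_permutes by (simp add: column_stabilizer_iff)
  have pg: "permutation g" "permutation (inv' g)"
    using permutation_if_permutes g permutes_inv[OF g] by auto
  have gi: "inv' g \<circ> g = id" "g \<circ> inv' g = id" using permutes_inv_o[OF g] by auto
  have bij: "bij_betw (\<lambda>\<sigma>. g \<circ> \<sigma> \<circ> inv' g) ?C (column_stabilizer lam (g \<circ> t))"
  proof (rule bij_betwI[where g = "\<lambda>\<sigma>. inv' g \<circ> \<sigma> \<circ> g"])
    have col: "{(g \<circ> t) (i, j) |i. (i, j) \<in> cells lam} = g ` {t (i, j) |i. (i, j) \<in> cells lam}" for j
      by auto
    have stab: "\<sigma> \<in> column_stabilizer lam (g \<circ> t) \<longleftrightarrow>
        \<sigma> permutes {1..n} \<and> (\<forall>j. \<sigma> ` g ` {t (i, j) |i. (i, j) \<in> cells lam} = g ` {t (i, j) |i. (i, j) \<in> cells lam})" for \<sigma>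
      unfolding column_stabilizer_def col sum_lam by simp
    have stab': "\<sigma> \<in> ?C \<longleftrightarrow>
        \<sigma> permutes {1..n} \<and> (\<forall>j. \<sigma> ` {t (i, j) |i. (i, j) \<in> cells lam} = {t (i, j) |i. (i, j) \<in> cells lam})" for \<sigma>
      unfolding column_stabilizer_def sum_lam by simp
    have im: "inv' g ` g ` A = A" for A
      using gi(1) by (metis image_comp image_id id_apply)
    show "(\<lambda>\<sigma>. g \<circ> \<sigma> \<circ> inv' g) \<in> ?C \<rightarrow> column_stabilizer lam (g \<circ> t)"
    proof
      fix \<sigma> assume \<sigma>: "\<sigma> \<in> ?C"
      then have "g \<circ> \<sigma> \<circ> inv' g permutes {1..n}"
        using g permutes_inv[OF g] by (auto simp: stab' intro: permutes_compose)
      then show "g \<circ> \<sigma> \<circ> inv' g \<in> column_stabilizer lam (g \<circ> t)"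
        using \<sigma> unfolding stab stab' image_comp[symmetric] im by simp
    qed
    show "(\<lambda>\<sigma>. inv' g \<circ> \<sigma> \<circ> g) \<in> column_stabilizer lam (g \<circ> t) \<rightarrow> ?C"
    proof
      fix \<sigma> assume \<sigma>: "\<sigma> \<in> column_stabilizer lam (g \<circ> t)"
      then have "inv' g \<circ> \<sigma> \<circ> g permutes {1..n}"
        using g permutes_inv[OF g] by (auto simp: stab intro: permutes_compose)
      then show "inv' g \<circ> \<sigma> \<circ> g \<in> ?C"
        using \<sigma> unfolding stab stab' image_comp[symmetric] by (simp add: im)
    qed
    show "inv' g \<circ> (g \<circ> \<sigma> \<circ> inv' g) \<circ> g = \<sigma>" for \<sigma>
      using gi by (metis comp_assoc comp_id id_comp)
    show "g \<circ> (inv' g \<circ> \<sigma> \<circ> g) \<circ> inv' g = \<sigma>" for \<sigma>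
      using gi by (metis comp_assoc comp_id id_comp)
  qed
  have term_eq: "cscale (of_int (sign (g \<circ> \<sigma> \<circ> inv' g))) (indicator {tabloid lam (g \<circ> \<sigma> \<circ> inv' g \<circ> (g \<circ> t))}) =
      cscale (of_int (sign \<sigma>)) (indicator {tabloid_act g (tabloid_act \<sigma> base_tabloid)})" if "\<sigma> \<in> ?C" for \<sigma>
  proof -
    have "sign (g \<circ> \<sigma> \<circ> inv' g) = sign \<sigma>"
      using perm[OF that] pg by (simp add: sign_compose sign_inverse permutation_compose mult.commute mult.left_commute)
    moreover have "g \<circ> \<sigma> \<circ> inv' g \<circ> (g \<circ> t) = (g \<circ> \<sigma>) \<circ> t"
      using gi by (metis comp_assoc comp_id)
    ultimately show ?thesis by (simp add: tabloid_comp tabloid_act_comp del: map_map)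
  qed
  have "polytabloid lam (g \<circ> t) =
      (\<Sum>\<sigma>\<in>?C. cscale (of_int (sign \<sigma>)) (indicator {tabloid_act g (tabloid_act \<sigma> base_tabloid)}))"
    unfolding polytabloid_def sum.reindex_bij_betw[OF bij, symmetric] using term_eq by (intro sum.cong) auto
  also have "\<dots> = ract (specht lam) g base_polytabloid"
  proof
    fix T
    have "(indicator {tabloid_act g U} T :: complex) = indicator {U} (tabloid_act (inv' g) T)" for U
      using ract_specht_indicator[OF g, of U] ract_specht by metis
    then show "(\<Sum>\<sigma>\<in>?C. cscale (of_int (sign \<sigma>)) (indicator {tabloid_act g (tabloid_act \<sigma> base_tabloid)})) T =
        ract (specht lam) g base_polytabloid T"
      by (simp add: base_polytabloid_eq ract_specht sum_apply del: map_map)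
  qed
  finally show ?thesis by simp
qed

text \<open>A tableau is a function on all pairs with arbitrary values off the cells, so two
  tableaux can be compared only on the cells.\<close>

lemma polytabloid_cong:
  assumes "\<And>c. c \<in> cells lam \<Longrightarrow> s c = s' c"
  shows "polytabloid lam s = polytabloid lam s'"
proof -
  have "{s (i, j) | i. (i, j) \<in> cells lam} = {s' (i, j) | i. (i, j) \<in> cells lam}" for j
    using assms by metis
  then have "column_stabilizer lam s = column_stabilizer lam s'"
    by (simp add: column_stabilizer_def)
  moreover have "{(\<sigma> \<circ> s) (i, j) | j. (i, j) \<in> cells lam} = {(\<sigma> \<circ> s') (i, j) | j. (i, j) \<in> cells lam}" for i \<sigma>
    using assms unfolding comp_def by metis
  then have "tabloid lam (\<sigma> \<circ> s) = tabloid lam (\<sigma> \<circ> s')" for \<sigma>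
    unfolding tabloid_def by metis
  ultimately show ?thesis by (simp add: polytabloid_def)
qed

lemma tableau_eq_comp:
  assumes "tableau lam s"
  obtains g where "g permutes {1..n}" "\<And>c. c \<in> cells lam \<Longrightarrow> s c = g (t c)"
proof -
  have s: "bij_betw s (cells lam) {1..n}" using assms by (simp add: tableau_def sum_lam)
  define g where "g x = (if x \<in> {1..n} then s (inv_into (cells lam) t x) else x)" for x
  have "bij_betw (\<lambda>x. s (inv_into (cells lam) t x)) {1..n} {1..n}"
    using bij_betw_trans[OF bij_betw_inv_into[OF bij_t] s] by (simp add: comp_def)
  then have "bij_betw g {1..n} {1..n}" by (rule bij_betw_cong[THEN iffD1, rotated]) (simp add: g_def)
  then have "g permutes {1..n}" by (rule bij_imp_permutes) (simp only: g_def if_False)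
  moreover have "s c = g (t c)" if "c \<in> cells lam" for c
    using that bij_t by (auto simp: g_def bij_betw_def)
  ultimately show ?thesis using that by blast
qed

lemma tableau_comp:
  assumes "g permutes {1..n}"
  shows "tableau lam (g \<circ> t)"
  using bij_betw_trans[OF bij_t permutes_imp_bij[OF assms]] by (simp add: tableau_def sum_lam)

text \<open>The module is cyclic: a homomorphism is determined by its value at
  \<open>base_polytabloid\<close>.\<close>

lemma rspace_specht:
  "rspace (specht lam) = cfun.span {ract (specht lam) g base_polytabloid | g. g permutes {1..n}}"
proof -
  have "{polytabloid lam s | s. tableau lam s} = {ract (specht lam) g base_polytabloid | g. g permutes {1..n}}"
  proof (intro equalityI subsetI)
    fix v assume "v \<in> {polytabloid lam s | s. tableau lam s}"
    then obtain s where s: "v = polytabloid lam s" "tableau lam s" by blast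
    obtain g where g: "g permutes {1..n}" "\<And>c. c \<in> cells lam \<Longrightarrow> s c = g (t c)"
      using tableau_eq_comp[OF s(2)] by blast
    have "v = polytabloid lam (g \<circ> t)" unfolding s(1) by (rule polytabloid_cong) (simp add: g)
    then show "v \<in> {ract (specht lam) g base_polytabloid | g. g permutes {1..n}}"
      using polytabloid_comp[OF g(1)] g(1) by (intro CollectI exI[of _ g]) simp
  next
    fix v assume "v \<in> {ract (specht lam) g base_polytabloid | g. g permutes {1..n}}"
    then show "v \<in> {polytabloid lam s | s. tableau lam s}"
      using polytabloid_comp tableau_comp by auto
  qed
  then show ?thesis by (simp add: specht_def)
qed

lemma subspace_specht: "cfun.subspace (rspace (specht lam))"
  unfolding rspace_specht by (rule cfun.subspace_span)

lemma ract_specht_comp: "ract (specht lam) g (ract (specht lam) h v) = ract (specht lam) (g \<circ> h) v"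
  if "g permutes {1..n}" "h permutes {1..n}"
proof -
  have "inv' (g \<circ> h) = inv' h \<circ> inv' g"
    using that by (intro o_inv_distrib permutes_bij)
  then show ?thesis by (intro ext) (simp only: ract_specht tabloid_act_comp)
qed

lemma ract_specht_linear:
  "ract (specht lam) g (u + v) = ract (specht lam) g u + ract (specht lam) g v"
  "ract (specht lam) g (cscale c u) = cscale c (ract (specht lam) g u)"
  by (simp_all add: fun_eq_iff ract_specht del: map_map)

lemma base_polytabloid_in: "base_polytabloid \<in> rspace (specht lam)"
proof -
  have "tableau lam t" using tableau .
  then show ?thesis unfolding specht_def by (auto intro: cfun.span_base)
qed

lemma ract_specht_closed:
  assumes g: "g permutes {1..n}" and v: "v \<in> rspace (specht lam)"
  shows "ract (specht lam) g v \<in> rspace (specht lam)"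
proof -
  let ?X = "{v. ract (specht lam) g v \<in> rspace (specht lam)}"
  have zero: "ract (specht lam) g 0 = 0" by (simp add: fun_eq_iff ract_specht)
  have "rspace (specht lam) \<subseteq> ?X"
    unfolding rspace_specht
  proof (rule cfun.span_minimal)
    show "cfun.subspace {v. ract (specht lam) g v \<in> cfun.span {ract (specht lam) g base_polytabloid | g. g permutes {1..n}}}"
      unfolding cfun.subspace_def
      by (auto simp only: mem_Collect_eq ract_specht_linear zero intro: cfun.span_add cfun.span_scale cfun.span_zero)
  qed (use g ract_specht_comp permutes_compose in \<open>fastforce intro!: cfun.span_base\<close>)
  then show ?thesis using v by blast
qed

lemma specht_supported: "rspace (specht lam) \<subseteq> coord_space tabloids"
proof -
  have "ract (specht lam) g base_polytabloid \<in> coord_space tabloids" if g: "g permutes {1..n}" for g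
  proof -
    have "base_polytabloid (tabloid_act (inv' g) T) = 0" if "T \<notin> tabloids" for T
    proof -
      have "tabloid_act (inv' g) T \<noteq> tabloid_act \<sigma> base_tabloid" if "\<sigma> \<in> column_stabilizer lam t" for \<sigma>
      proof
        assume eq: "tabloid_act (inv' g) T = tabloid_act \<sigma> base_tabloid"
        have "T = tabloid_act g (tabloid_act (inv' g) T)" using tabloid_act_inverse[OF g] by simp
        also have "\<dots> \<in> tabloids"
          unfolding eq using that g tabloid_act_in base_tabloid_in by (simp add: column_stabilizer_iff del: map_map)
        finally show False using \<open>T \<notin> tabloids\<close> by simp
      qed
      then show ?thesis
        by (simp add: base_polytabloid_eq sum_apply indicator_def del: map_map)
    qed
    then show ?thesis by (simp add: coord_space_def ract_specht del: map_map)
  qed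
  then show ?thesis
    unfolding rspace_specht by (intro cfun.span_minimal[OF _ subspace_coord_space]) auto
qed

text \<open>A permutation that preserves rows and columns is the identity, so the base tabloid
  occurs exactly once, with sign \<open>1\<close>.\<close>

lemma base_polytabloid_base_tabloid: "base_polytabloid base_tabloid = 1"
proof -
  have "(indicator {tabloid_act \<sigma> base_tabloid} base_tabloid :: complex) = (if \<sigma> = id then 1 else 0)"
    if \<sigma>: "\<sigma> \<in> column_stabilizer lam t" for \<sigma>
  proof -
    have p: "\<sigma> permutes {1..n}" using \<sigma> by (simp add: column_stabilizer_iff)
    have "\<sigma> = id" if "tabloid_act \<sigma> base_tabloid = base_tabloid"
    proof
      fix x
      show "\<sigma> x = id x"
      proof (cases "x \<in> {1..n}")
        case True
        then have "\<sigma> x \<in> {1..n}" using permutes_in_image[OF p] by blast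
        moreover have "row (\<sigma> x) = row x" using that tabloid_act_fix_iff[OF p] True by blast
        moreover have "col (\<sigma> x) = col x" using \<sigma> True column_stabilizer_iff by blast
        ultimately show ?thesis using row_col_eq[OF _ True] by simp
      qed (use permutes_not_in[OF p] in simp)
    qed
    then show ?thesis by (auto simp: indicator_def)
  qed
  then have "base_polytabloid base_tabloid =
      (\<Sum>\<sigma>\<in>column_stabilizer lam t. if \<sigma> = id then of_int (sign \<sigma>) else 0)"
    unfolding base_polytabloid_eq sum_apply by (intro sum.cong) auto
  also have "\<dots> = 1"
    using finite_column_stabilizer by (simp add: column_stabilizer_iff)
  finally show ?thesis .
qed

lemma base_polytabloid_nonzero: "base_polytabloid \<noteq> 0"
  using base_polytabloid_base_tabloid by auto

text \<open>Composition with \<tau> permutes the column stabilizer and multiplies every sign by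
  \<open>sign \<tau>\<close>, whose square is \<open>1\<close>.\<close>

lemma ract_column_stabilizer:
  assumes \<tau>: "\<tau> \<in> column_stabilizer lam t"
  shows "ract (specht lam) \<tau> base_polytabloid = cscale (of_int (sign \<tau>)) base_polytabloid"
proof -
  let ?C = "column_stabilizer lam t"
  have p: "\<tau> permutes {1..n}" using \<tau> by (simp add: column_stabilizer_iff)
  have bij: "bij_betw (\<lambda>\<sigma>. \<tau> \<circ> \<sigma>) ?C ?C"
  proof (rule bij_betwI[where g = "\<lambda>\<sigma>. inv' \<tau> \<circ> \<sigma>"])
    show "inv' \<tau> \<circ> (\<tau> \<circ> \<sigma>) = \<sigma>" "\<tau> \<circ> (inv' \<tau> \<circ> \<sigma>) = \<sigma>" for \<sigma>
      using permutes_inv_o[OF p] by (simp_all flip: comp_assoc)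
  qed (use \<tau> column_stabilizer_comp column_stabilizer_inv in auto)
  have "base_polytabloid = (\<Sum>\<sigma>\<in>?C. cscale (of_int (sign (\<tau> \<circ> \<sigma>))) (indicator {tabloid_act (\<tau> \<circ> \<sigma>) base_tabloid}))"
    unfolding base_polytabloid_eq by (rule sum.reindex_bij_betw[OF bij, symmetric])
  also have "\<dots> = (\<Sum>\<sigma>\<in>?C. cscale (of_int (sign \<tau>)) (cscale (of_int (sign \<sigma>))
      (ract (specht lam) \<tau> (indicator {tabloid_act \<sigma> base_tabloid}))))"
  proof (rule sum.cong)
    fix \<sigma> assume "\<sigma> \<in> ?C"
    then have "sign (\<tau> \<circ> \<sigma>) = sign \<tau> * sign \<sigma>"
      using p permutation_if_permutes by (intro sign_compose) (auto simp: column_stabilizer_iff)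
    then show "cscale (of_int (sign (\<tau> \<circ> \<sigma>))) (indicator {tabloid_act (\<tau> \<circ> \<sigma>) base_tabloid}) =
        cscale (of_int (sign \<tau>)) (cscale (of_int (sign \<sigma>)) (ract (specht lam) \<tau> (indicator {tabloid_act \<sigma> base_tabloid})))"
      unfolding ract_specht_indicator[OF p] tabloid_act_comp by (simp add: fun_eq_iff)
  qed simp
  also have "\<dots> = cscale (of_int (sign \<tau>)) (ract (specht lam) \<tau> base_polytabloid)"
    by (simp add: base_polytabloid_eq fun_eq_iff sum_apply ract_specht sum_distrib_left mult.assoc del: map_map)
  finally have "cscale (of_int (sign \<tau>)) base_polytabloid =
      cscale (of_int (sign \<tau> * sign \<tau>)) (ract (specht lam) \<tau> base_polytabloid)"
    by (metis of_int_mult cfun.scale_scale)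
  then show ?thesis by simp
qed

text \<open>
  Two entries of the Garnir set lie in the same row of any column rearrangement of the tableau;
  their transposition cancels the sum.
\<close>

lemma garnir_relation:
  assumes cells: "(q, k) \<in> cells lam" "j < k"
  shows "(\<Sum>\<pi> | \<pi> permutes garnir_set q j k.
    cscale (of_int (sign \<pi>)) (ract (specht lam) \<pi> base_polytabloid)) = 0"
proof
  let ?G = "garnir_set q j k" and ?C = "column_stabilizer lam t"
  let ?P = "{\<pi>. \<pi> permutes ?G}"
  have finG: "finite ?G" using finite_subset[OF garnir_set_subset] by auto
  have cancel: "(\<Sum>\<pi>\<in>?P. of_int (sign \<pi>) * indicator {tabloid_act \<pi> (tabloid_act \<sigma> base_tabloid)} T) = (0::complex)"
    if \<sigma>: "\<sigma> \<in> ?C" for \<sigma> T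
  proof -
    have p: "\<sigma> permutes {1..n}" using \<sigma> by (simp add: column_stabilizer_iff)
    have fin: "finite {i. (i, j) \<in> cells lam}"
      by (rule finite_subset[of _ "{..<length lam}"]) (auto simp: cells_def)
    \<comment> \<open>\<sigma> preserves columns, so the entry \<open>inv' \<sigma> x\<close> lies
      in column \<open>j\<close> or \<open>k\<close>; its row meets column \<open>j\<close> because
      \<open>j < k\<close>. The Garnir set has more elements than column \<open>j\<close> has
      rows.\<close>
    have img: "row (inv' \<sigma> x) \<in> {i. (i, j) \<in> cells lam}" if x: "x \<in> ?G" for x
    proof -
      have x': "x \<in> {1..n}" using x garnir_set_subset by blast
      have i: "inv' \<sigma> x \<in> {1..n}" using x' permutes_in_image[OF permutes_inv[OF p]] by blast
      have "col (inv' \<sigma> x) = col x"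
        using column_stabilizer_inv[OF \<sigma>] x' column_stabilizer_iff by blast
      then have "j \<le> col (inv' \<sigma> x)" using x cells(2) by (auto simp: garnir_set_def)
      then show ?thesis using cells_down_closed[OF partition row_col_in[OF i]] by simp
    qed
    have "\<not> inj_on (\<lambda>x. row (inv' \<sigma> x)) ?G"
    proof
      assume "inj_on (\<lambda>x. row (inv' \<sigma> x)) ?G"
      then have "card ?G \<le> card {i. (i, j) \<in> cells lam}"
        using img fin by (intro card_inj_on_le[of "\<lambda>x. row (inv' \<sigma> x)"]) auto
      then show False using card_garnir_set[OF cells] by simp
    qed
    then obtain x y where xy: "x \<in> ?G" "y \<in> ?G" "x \<noteq> y" "row (inv' \<sigma> x) = row (inv' \<sigma> y)"
      by (auto simp: inj_on_def)
    let ?\<tau> = "transpose x y" and ?\<tau>' = "transpose (inv' \<sigma> x) (inv' \<sigma> y)"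
    have in_n: "inv' \<sigma> x \<in> {1..n}" "inv' \<sigma> y \<in> {1..n}"
      using xy garnir_set_subset permutes_in_image[OF permutes_inv[OF p]] by blast+
    then have \<tau>': "?\<tau>' permutes {1..n}" by (rule permutes_swap_id)
    have "tabloid_act ?\<tau>' base_tabloid = base_tabloid"
      unfolding tabloid_act_fix_iff[OF \<tau>'] using xy(4) by (auto simp: transpose_def)
    \<comment> \<open>Conjugation by \<sigma> turns the row-preserving \<open>?\<tau>'\<close> into
      \<open>?\<tau>\<close>, which therefore fixes the rearranged tabloid. Hence \<pi> and
      \<open>\<pi> \<circ> ?\<tau>\<close> give the same tabloid with opposite signs.\<close>
    moreover have "?\<tau> \<circ> \<sigma> = \<sigma> \<circ> ?\<tau>'"
      using permutes_inverses[OF p] by (auto simp: fun_eq_iff transpose_def)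
    ultimately have fixed: "tabloid_act ?\<tau> (tabloid_act \<sigma> base_tabloid) = tabloid_act \<sigma> base_tabloid"
      by (metis tabloid_act_comp)
    have \<tau>: "?\<tau> permutes ?G" using xy by (intro permutes_swap_id)
    let ?f = "\<lambda>\<pi>. of_int (sign \<pi>) * indicator {tabloid_act \<pi> (tabloid_act \<sigma> base_tabloid)} T :: complex"
    have "sum ?f ?P = (\<Sum>\<pi>\<in>?P. ?f (\<pi> \<circ> ?\<tau>))"
      by (rule sum_permutations_compose_right[OF \<tau>])
    also have "\<dots> = (\<Sum>\<pi>\<in>?P. - ?f \<pi>)"
    proof (rule sum.cong)
      fix \<pi> assume "\<pi> \<in> ?P"
      then have "sign (\<pi> \<circ> ?\<tau>) = - sign \<pi>"
        using sign_compose[of \<pi> ?\<tau>] permutes_imp_permutation[OF finG] \<tau> xy(3) by (simp add: sign_swap_id)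
      then show "?f (\<pi> \<circ> ?\<tau>) = - ?f \<pi>" unfolding tabloid_act_comp fixed by simp
    qed simp
    also have "\<dots> = - sum ?f ?P" by (simp add: sum_negf)
    finally show ?thesis by simp
  qed
  fix T
  have "(\<Sum>\<pi>\<in>?P. cscale (of_int (sign \<pi>)) (ract (specht lam) \<pi> base_polytabloid)) T =
      (\<Sum>\<pi>\<in>?P. \<Sum>\<sigma>\<in>?C. of_int (sign \<sigma>) * (of_int (sign \<pi>) *
        indicator {tabloid_act \<pi> (tabloid_act \<sigma> base_tabloid)} T))"
    unfolding sum_apply
  proof (rule sum.cong)
    fix \<pi> assume "\<pi> \<in> ?P"
    then have \<pi>: "\<pi> permutes ?G" by simp
    have "ract (specht lam) \<pi> base_polytabloid T =
        (\<Sum>\<sigma>\<in>?C. of_int (sign \<sigma>) * ract (specht lam) \<pi> (indicator {tabloid_act \<sigma> base_tabloid}) T)"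
      by (simp add: base_polytabloid_eq ract_specht sum_apply del: map_map)
    then show "cscale (of_int (sign \<pi>)) (ract (specht lam) \<pi> base_polytabloid) T = (\<Sum>\<sigma>\<in>?C. of_int (sign \<sigma>) *
        (of_int (sign \<pi>) * indicator {tabloid_act \<pi> (tabloid_act \<sigma> base_tabloid)} T))"
      unfolding ract_specht_indicator[OF \<pi>] by (simp add: sum_distrib_left algebra_simps del: map_map)
  qed simp
  also have "\<dots> = (\<Sum>\<sigma>\<in>?C. of_int (sign \<sigma>) * (\<Sum>\<pi>\<in>?P. of_int (sign \<pi>) *
        indicator {tabloid_act \<pi> (tabloid_act \<sigma> base_tabloid)} T))"
    by (subst sum.swap) (simp add: sum_distrib_left)
  also have "\<dots> = 0" using cancel by simp
  finally show "(\<Sum>\<pi>\<in>?P. cscale (of_int (sign \<pi>)) (ract (specht lam) \<pi> base_polytabloid)) T = 0 T" by simp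
qed

end


section \<open>Homomorphisms from a Specht module to a permutation representation\<close>

text \<open>\<open>R\<close> may be a proper subspace of the functions on \<open>\<Omega>\<close>:
  this admits the Specht module, inside the functions on tabloids, besides the tensor power. The
  upper bound holds in this generality; the exact dimension takes \<open>R\<close> to be the full
  coordinate space.\<close>

locale labelled_rep = labelled_tableau lam n t act \<Omega> lab
  for lam :: "nat list" and n :: nat and t :: "nat \<times> nat \<Rightarrow> nat"
    and act :: "(nat \<Rightarrow> nat) \<Rightarrow> 'b \<Rightarrow> 'b" and \<Omega> :: "'b set" and lab :: "'b \<Rightarrow> nat \<Rightarrow> nat" +
  fixes R :: "(nat \<Rightarrow> nat, 'b) grep"
  assumes rspace_subspace: "cfun.subspace (rspace R)"
    and rspace_supported: "rspace R \<subseteq> coord_space \<Omega>"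
    and ract_closed: "g permutes {1..n} \<Longrightarrow> v \<in> rspace R \<Longrightarrow> ract R g v \<in> rspace R"
    and ract_eq: "g permutes {1..n} \<Longrightarrow> v \<in> rspace R \<Longrightarrow> ract R g v w = v (act (inv' g) w)"
begin

lemma act_bij: "g permutes {1..n} \<Longrightarrow> bij_betw (act g) \<Omega> \<Omega>"
  using act_inverse[of g] act_in[of g] act_in[OF permutes_inv, of g]
  by (intro bij_betwI[where g = "act (inv' g)"]) auto

lemma unitary: "unitary_rep (sym_group n) R \<Omega>"
proof -
  note [simp] = sym_group_carrier sym_group_mult sym_group_one
  have lin: "linear_map_on (rspace R) (rspace R) (ract R g)" if g: "g permutes {1..n}" for g
    using ract_closed[OF g] ract_eq[OF g] cfun.subspace_add[OF rspace_subspace] cfun.subspace_scale[OF rspace_subspace]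
    by (auto simp: linear_map_on_def fun_eq_iff)
  have one: "ract R id v = v" if "v \<in> rspace R" for v
    using ract_eq[OF permutes_id that] by (simp add: fun_eq_iff act_id)
  have comp: "ract R (g \<circ> h) v = ract R g (ract R h v)"
    if g: "g permutes {1..n}" and h: "h permutes {1..n}" and v: "v \<in> rspace R" for g h v
  proof
    fix w
    have "inv' (g \<circ> h) = inv' h \<circ> inv' g"
      using g h by (intro o_inv_distrib permutes_bij)
    then show "ract R (g \<circ> h) v w = ract R g (ract R h v) w"
      using ract_eq[OF permutes_compose[OF h g] v] ract_eq[OF g ract_closed[OF h v]] ract_eq[OF h v]
      by (simp only: act_comp)
  qed
  have "inner_on \<Omega> (ract R g u) (ract R g v) = inner_on \<Omega> u v"
    if g: "g permutes {1..n}" and uv: "u \<in> rspace R" "v \<in> rspace R" for g u v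
  proof -
    have "inner_on \<Omega> (ract R g u) (ract R g v) = (\<Sum>w\<in>\<Omega>. ract R g u (act g w) * cnj (ract R g v (act g w)))"
      unfolding inner_on_def by (rule sum.reindex_bij_betw[OF act_bij[OF g], symmetric])
    also have "\<dots> = inner_on \<Omega> u v"
      using ract_eq[OF g] uv act_inverse[OF g] by (simp add: inner_on_def)
    finally show ?thesis .
  qed
  moreover obtain B where B: "finite B" "B \<subseteq> rspace R" "rspace R \<subseteq> cfun.span B"
    using subspace_finite_basis[OF finite_points rspace_supported] by metis
  then have "rspace R = cfun.span B"
    using cfun.span_minimal[OF B(2) rspace_subspace] by auto
  ultimately show ?thesis
    using B(1) lin one comp rspace_subspace rspace_supported finite_points
    by (auto simp: unitary_rep_def is_rep_def sym_group_is_group)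
qed

text \<open>The image of \<open>base_polytabloid\<close> inherits its sign rule under column
  permutations and its Garnir relations.\<close>

lemma hom_zero_if_zero_on_semistandard:
  assumes f: "rep_hom (sym_group n) (specht lam) R f"
    and zero: "\<And>w. w \<in> \<Omega> \<Longrightarrow> semistandard (lab w) \<Longrightarrow> f base_polytabloid w = 0"
  shows "f base_polytabloid = 0"
proof (rule zero_if_zero_on_semistandard[OF _ _ _ zero])
  let ?e = base_polytabloid and ?v = "f base_polytabloid"
  note eS = base_polytabloid_in
  have v: "?v \<in> rspace R" using rep_homD(1)[OF f eS] .
  have lin: "linear_map_on (rspace (specht lam)) (rspace R) f" using f by (simp add: rep_hom_def)
  show "?v w = 0" if "w \<notin> \<Omega>" for w
    using v rspace_supported that by (auto simp: coord_space_def)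
  have act: "?v (act g w) = f (ract (specht lam) (inv' g) ?e) w" if g: "g permutes {1..n}" for g w
  proof -
    have "f (ract (specht lam) (inv' g) ?e) = ract R (inv' g) ?v"
      using rep_homD(4)[OF f _ eS] permutes_inv[OF g] by (simp add: sym_group_carrier)
    then show ?thesis
      using ract_eq[OF permutes_inv[OF g] v] permutes_inv_inv[OF g] by simp
  qed
  show "?v (act \<sigma> w) = of_int (sign \<sigma>) * ?v w" if \<sigma>: "\<sigma> \<in> column_stabilizer lam t" for \<sigma> w
  proof -
    have p: "\<sigma> permutes {1..n}" using \<sigma> by (simp add: column_stabilizer_iff)
    have "sign (inv' \<sigma>) = sign \<sigma>" using sign_inverse permutation_if_permutes[OF p] by blast
    then have "ract (specht lam) (inv' \<sigma>) ?e = cscale (of_int (sign \<sigma>)) ?e"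
      using ract_column_stabilizer[OF column_stabilizer_inv[OF \<sigma>]] by simp
    then show ?thesis using act[OF p] rep_homD(3)[OF f eS] by simp
  qed
  fix q j k w assume jk: "(q, k) \<in> cells lam" "j < (k::nat)"
  let ?P = "{\<pi>. \<pi> permutes garnir_set q j k}"
  have P: "\<pi> permutes {1..n}" if "\<pi> \<in> ?P" for \<pi>
    using that permutes_subset garnir_set_subset by blast
  \<comment> \<open>Moving the point by \<pi> corresponds to acting on the function by the inverse,
    so the sum is reindexed by inverses, which have the same signs.\<close>
  have "(\<Sum>\<pi>\<in>?P. of_int (sign \<pi>) * ?v (act \<pi> w)) =
      (\<Sum>\<pi>\<in>?P. of_int (sign (inv' \<pi>)) * ?v (act (inv' \<pi>) w))"
    by (rule sum_permutations_inverse)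
  also have "\<dots> = (\<Sum>\<pi>\<in>?P. cscale (of_int (sign \<pi>)) (f (ract (specht lam) \<pi> ?e)) w)"
  proof (rule sum.cong)
    fix \<pi> assume "\<pi> \<in> ?P"
    note p = P[OF this]
    show "of_int (sign (inv' \<pi>)) * ?v (act (inv' \<pi>) w) = cscale (of_int (sign \<pi>)) (f (ract (specht lam) \<pi> ?e)) w"
      using act[OF permutes_inv[OF p]] permutes_inv_inv[OF p] sign_inverse[OF permutation_if_permutes[OF p]] by simp
  qed simp
  also have "\<dots> = (\<Sum>\<pi>\<in>?P. cscale (of_int (sign \<pi>)) (f (ract (specht lam) \<pi> ?e))) w"
    by (simp only: sum_apply)
  also have "(\<Sum>\<pi>\<in>?P. cscale (of_int (sign \<pi>)) (f (ract (specht lam) \<pi> ?e))) =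
      f (\<Sum>\<pi>\<in>?P. cscale (of_int (sign \<pi>)) (ract (specht lam) \<pi> ?e))"
    using P ract_specht_closed[OF _ eS]
    by (intro linear_map_on_sum[OF lin subspace_specht, symmetric]) auto
  also have "\<dots> = f 0" using garnir_relation[OF jk] by simp
  also have "\<dots> = 0" using linear_map_on_zero[OF lin subspace_specht] .
  finally show "(\<Sum>\<pi>\<in>?P. of_int (sign \<pi>) * ?v (act \<pi> w)) = 0" by simp
qed

section \<open>Dimension of the space of homomorphisms\<close>

definition hom_values :: "('b \<Rightarrow> complex) set"
  where "hom_values = {f base_polytabloid | f. rep_hom (sym_group n) (specht lam) R f}"

lemma hom_values_supported: "hom_values \<subseteq> coord_space \<Omega>"
  using rep_homD(1)[OF _ base_polytabloid_in] rspace_supported by (auto simp: hom_values_def)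

lemma subspace_hom_values: "cfun.subspace hom_values"
  unfolding cfun.subspace_def
proof (intro conjI ballI allI)
  have R0: "ract R g 0 = 0" if "g permutes {1..n}" for g
    using ract_eq[OF that cfun.subspace_0[OF rspace_subspace]] by (simp add: fun_eq_iff)
  have "rep_hom (sym_group n) (specht lam) R (\<lambda>_. 0)"
    using cfun.subspace_0[OF rspace_subspace] R0
    by (simp add: rep_hom_def linear_map_on_def sym_group_carrier fun_eq_iff)
  then show "0 \<in> hom_values"
    unfolding hom_values_def by (intro CollectI exI[of _ "\<lambda>_. 0"]) simp
  note Radd = is_rep_act(2,3)[OF unitary[unfolded unitary_rep_def, THEN conjunct1]]
  fix x assume "x \<in> hom_values"
  then obtain f where f: "x = f base_polytabloid" "rep_hom (sym_group n) (specht lam) R f" by (auto simp: hom_values_def)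
  fix c
  have "rep_hom (sym_group n) (specht lam) R (\<lambda>v. cscale c (f v))"
    using rep_homD[OF f(2)] Radd cfun.subspace_scale[OF rspace_subspace]
    by (auto simp: rep_hom_def linear_map_on_def cfun.scale_right_distrib mult.commute simp del: cscale_apply)
  then show "cscale c x \<in> hom_values" using f(1) by (auto simp: hom_values_def simp del: cscale_apply)
  fix y assume "y \<in> hom_values"
  then obtain h where h: "y = h base_polytabloid" "rep_hom (sym_group n) (specht lam) R h" by (auto simp: hom_values_def)
  have "rep_hom (sym_group n) (specht lam) R (\<lambda>v. f v + h v)"
    using rep_homD[OF f(2)] rep_homD[OF h(2)] Radd cfun.subspace_add[OF rspace_subspace]
    by (auto simp: rep_hom_def linear_map_on_def cfun.scale_right_distrib algebra_simps simp del: cscale_apply)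
  then show "x + y \<in> hom_values"
    unfolding hom_values_def f(1) h(1) by (intro CollectI exI[of _ "\<lambda>v. f v + h v"]) simp
qed

text \<open>Restriction to the semistandard points is injective on \<open>hom_values\<close>, since
  a value that vanishes on them is \<open>0\<close>.\<close>

lemma dim_hom_values_le: "cfun.dim hom_values \<le> card {w\<in>\<Omega>. semistandard (lab w)}"
proof -
  let ?SS = "{w\<in>\<Omega>. semistandard (lab w)}"
  obtain B where B: "finite B" "B \<subseteq> hom_values" "cfun.independent B" "card B = cfun.dim hom_values"
    using subspace_finite_basis[OF finite_points hom_values_supported] by metis
  define \<rho> :: "('b \<Rightarrow> complex) \<Rightarrow> 'b \<Rightarrow> complex" where "\<rho> v w = (if w \<in> ?SS then v w else 0)" for v w
  have "c b = 0" if sum: "(\<Sum>b\<in>B. cscale (c b) (\<rho> b)) = 0" and b: "b \<in> B" for c b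
  proof -
    let ?v = "\<Sum>b\<in>B. cscale (c b) b"
    have "?v \<in> hom_values"
      using B(2) by (intro cfun.subspace_sum[OF subspace_hom_values] cfun.subspace_scale[OF subspace_hom_values]) auto
    then obtain f where f: "?v = f base_polytabloid" "rep_hom (sym_group n) (specht lam) R f" by (auto simp: hom_values_def)
    have "?v w = 0" if "w \<in> ?SS" for w
    proof -
      have "(\<Sum>b\<in>B. cscale (c b) (\<rho> b)) w = 0" using sum by simp
      then show ?thesis using that by (simp add: sum_apply \<rho>_def)
    qed
    then have "?v = 0" using hom_zero_if_zero_on_semistandard[OF f(2)] f(1) by simp
    then show ?thesis using cfun.independentD[OF B(3,1) subset_refl _ b] by blast
  qed
  then have "inj_on \<rho> B" "cfun.independent (\<rho> ` B)"
    using independent_image[OF B(1), of \<rho>] by blast+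
  moreover have "\<rho> ` B \<subseteq> cfun.span ((\<lambda>x. indicator {x}) ` ?SS)"
    using coord_space_span[of ?SS] finite_points by (auto simp: coord_space_def \<rho>_def)
  ultimately have "card (\<rho> ` B) \<le> card ((\<lambda>x. indicator {x} :: 'b \<Rightarrow> complex) ` ?SS)"
    using cfun.independent_span_bound[of "(\<lambda>x. indicator {x}) ` ?SS" "\<rho> ` B"] finite_points by simp
  also have "\<dots> \<le> card ?SS" using finite_points by (intro card_image_le) auto
  finally show ?thesis using card_image[OF \<open>inj_on \<rho> B\<close>] B(4) by simp
qed

text \<open>The kernel is the indicator of the orbit of the pair \<open>(base_tabloid, w)\<close>.
  On the functions on tabloids this is the map that sends the base tabloid to the sum of the
  distinct points in the orbit of \<open>w\<close> under the row stabilizer.\<close>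

definition orbit_hom :: "'b \<Rightarrow> (nat set list \<Rightarrow> complex) \<Rightarrow> 'b \<Rightarrow> complex"
  where "orbit_hom w F w' = (\<Sum>T\<in>tabloids. F T *
    of_bool (\<exists>g. g permutes {1..n} \<and> T = tabloid_act g base_tabloid \<and> w' = act g w))"

text \<open>The kernel is unchanged when a permutation acts on tabloid and point simultaneously. The
  values are arbitrary functions on \<open>\<Omega>\<close>, so \<open>R\<close> is taken to be all
  of them.\<close>

lemma rep_hom_orbit_hom:
  assumes w: "w \<in> \<Omega>" and R: "rspace R = coord_space \<Omega>"
  shows "rep_hom (sym_group n) (specht lam) R (orbit_hom w)"
proof -
  let ?K = "\<lambda>T w'. \<exists>g. g permutes {1..n} \<and> T = tabloid_act g base_tabloid \<and> w' = act g w"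
  have in_R: "orbit_hom w F \<in> rspace R" for F
    unfolding R coord_space_def using act_in w by (auto simp: orbit_hom_def of_bool_def intro!: sum.neutral simp del: map_map)
  have K: "?K (tabloid_act h T) (act h w')" if h: "h permutes {1..n}" and T: "?K T w'" for h T w'
  proof -
    obtain g where "g permutes {1..n}" "T = tabloid_act g base_tabloid" "w' = act g w" using T by blast
    then show ?thesis
      using permutes_compose[of g "{1..n}" h] h by (intro exI[of _ "h \<circ> g"]) (simp add: act_comp tabloid_act_comp)
  qed
  have "orbit_hom w (ract (specht lam) h F) w' = ract R h (orbit_hom w F) w'" if h: "h permutes {1..n}" for h F w'
  proof -
    have bij: "bij_betw (tabloid_act h) tabloids tabloids"
      using tabloid_act_inverse[OF h] tabloid_act_in h permutes_inv[OF h]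
      by (intro bij_betwI[where g = "tabloid_act (inv' h)"]) (auto simp del: map_map)
    have iff: "?K (tabloid_act h T) w' \<longleftrightarrow> ?K T (act (inv' h) w')" for T
      using K[OF h, of T "act (inv' h) w'"] K[OF permutes_inv[OF h], of "tabloid_act h T" w']
        act_inverse[OF h] tabloid_act_inverse[OF h] by metis
    have "orbit_hom w (ract (specht lam) h F) w' =
        (\<Sum>T\<in>tabloids. ract (specht lam) h F (tabloid_act h T) * of_bool (?K (tabloid_act h T) w'))"
      unfolding orbit_hom_def by (rule sum.reindex_bij_betw[OF bij, symmetric])
    also have "\<dots> = orbit_hom w F (act (inv' h) w')"
      unfolding orbit_hom_def iff ract_specht tabloid_act_inverse[OF h] ..
    finally show ?thesis using ract_eq[OF h in_R] by simp
  qed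
  then have "orbit_hom w (ract (specht lam) h F) = ract R h (orbit_hom w F)" if "h permutes {1..n}" for h F
    using that by (simp add: fun_eq_iff)
  moreover have "orbit_hom w (u + v) = orbit_hom w u + orbit_hom w v" for u v
    by (simp add: fun_eq_iff orbit_hom_def distrib_right sum.distrib)
  moreover have "orbit_hom w (cscale c u) = cscale c (orbit_hom w u)" for c u
    by (simp add: fun_eq_iff orbit_hom_def sum_distrib_left mult.assoc)
  ultimately show ?thesis
    using in_R by (simp add: rep_hom_def linear_map_on_def sym_group_carrier Pi_iff)
qed

lemma orbit_hom_base_polytabloid:
  "orbit_hom w base_polytabloid w' = (\<Sum>\<sigma>\<in>column_stabilizer lam t. of_int (sign \<sigma>) *
    of_bool (\<exists>\<rho>. \<rho> permutes {1..n} \<and> (\<forall>x\<in>{1..n}. row (\<rho> x) = row x) \<and> w' = act \<sigma> (act \<rho> w)))"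
proof -
  let ?K = "\<lambda>T. \<exists>g. g permutes {1..n} \<and> T = tabloid_act g base_tabloid \<and> w' = act g w"
  let ?C = "column_stabilizer lam t"
  have in_T: "tabloid_act \<sigma> base_tabloid \<in> tabloids" if "\<sigma> \<in> ?C" for \<sigma>
    using that column_stabilizer_iff tabloids_def by auto
  have "orbit_hom w base_polytabloid w' =
      (\<Sum>T\<in>tabloids. \<Sum>\<sigma>\<in>?C. of_int (sign \<sigma>) * indicator {tabloid_act \<sigma> base_tabloid} T * of_bool (?K T))"
    by (simp add: orbit_hom_def base_polytabloid_eq sum_apply sum_distrib_right)
  also have "\<dots> = (\<Sum>\<sigma>\<in>?C. \<Sum>T\<in>tabloids. of_int (sign \<sigma>) * indicator {tabloid_act \<sigma> base_tabloid} T * of_bool (?K T))"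
    by (rule sum.swap)
  also have "\<dots> = (\<Sum>\<sigma>\<in>?C. of_int (sign \<sigma>) * of_bool (?K (tabloid_act \<sigma> base_tabloid)))"
  proof (rule sum.cong)
    fix \<sigma> assume \<sigma>: "\<sigma> \<in> ?C"
    have "(\<Sum>T\<in>tabloids. of_int (sign \<sigma>) * indicator {tabloid_act \<sigma> base_tabloid} T * of_bool (?K T)) =
        (\<Sum>T\<in>{tabloid_act \<sigma> base_tabloid}. of_int (sign \<sigma>) * indicator {tabloid_act \<sigma> base_tabloid} T * of_bool (?K T) :: complex)"
      by (rule sum.mono_neutral_right) (use in_T[OF \<sigma>] finite_tabloids in auto)
    then show "(\<Sum>T\<in>tabloids. of_int (sign \<sigma>) * indicator {tabloid_act \<sigma> base_tabloid} T * of_bool (?K T)) =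
        (of_int (sign \<sigma>) * of_bool (?K (tabloid_act \<sigma> base_tabloid)) :: complex)"
      by simp
  qed simp
  also have "\<dots> = (\<Sum>\<sigma>\<in>?C. of_int (sign \<sigma>) *
    of_bool (\<exists>\<rho>. \<rho> permutes {1..n} \<and> (\<forall>x\<in>{1..n}. row (\<rho> x) = row x) \<and> w' = act \<sigma> (act \<rho> w)))"
  proof (rule sum.cong)
    fix \<sigma> assume "\<sigma> \<in> ?C"
    then have \<sigma>: "\<sigma> permutes {1..n}" by (simp add: column_stabilizer_iff)
    have "?K (tabloid_act \<sigma> base_tabloid) \<longleftrightarrow>
        (\<exists>\<rho>. \<rho> permutes {1..n} \<and> (\<forall>x\<in>{1..n}. row (\<rho> x) = row x) \<and> w' = act \<sigma> (act \<rho> w))"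
    proof
      assume "?K (tabloid_act \<sigma> base_tabloid)"
      then obtain g where g: "g permutes {1..n}" "tabloid_act \<sigma> base_tabloid = tabloid_act g base_tabloid" "w' = act g w"
        by blast
      \<comment> \<open>\<open>g\<close> and \<sigma> send the base tabloid to the same tabloid, so
        they differ by a row permutation.\<close>
      define \<rho> where "\<rho> = inv' \<sigma> \<circ> g"
      have \<rho>: "\<rho> permutes {1..n}" unfolding \<rho>_def by (rule permutes_compose[OF g(1) permutes_inv[OF \<sigma>]])
      have "tabloid_act \<rho> base_tabloid = base_tabloid"
        unfolding \<rho>_def tabloid_act_comp g(2)[symmetric] tabloid_act_inverse[OF \<sigma>] ..
      moreover have "w' = act \<sigma> (act \<rho> w)" unfolding \<rho>_def act_comp act_inverse[OF \<sigma>] g(3) ..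
      ultimately show "\<exists>\<rho>. \<rho> permutes {1..n} \<and> (\<forall>x\<in>{1..n}. row (\<rho> x) = row x) \<and> w' = act \<sigma> (act \<rho> w)"
        using \<rho> tabloid_act_fix_iff by blast
    next
      assume "\<exists>\<rho>. \<rho> permutes {1..n} \<and> (\<forall>x\<in>{1..n}. row (\<rho> x) = row x) \<and> w' = act \<sigma> (act \<rho> w)"
      then obtain \<rho> where \<rho>: "\<rho> permutes {1..n}" "\<forall>x\<in>{1..n}. row (\<rho> x) = row x" "w' = act \<sigma> (act \<rho> w)" by blast
      then have "tabloid_act \<rho> base_tabloid = base_tabloid" using tabloid_act_fix_iff by blast
      then have "tabloid_act \<sigma> base_tabloid = tabloid_act (\<sigma> \<circ> \<rho>) base_tabloid" unfolding tabloid_act_comp by simp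
      moreover have "\<sigma> \<circ> \<rho> permutes {1..n}" "w' = act (\<sigma> \<circ> \<rho>) w"
        using permutes_compose[OF \<rho>(1) \<sigma>] \<rho>(3) by (simp_all add: act_comp)
      ultimately show "?K (tabloid_act \<sigma> base_tabloid)" by blast
    qed
    then show "of_int (sign \<sigma>) * of_bool (?K (tabloid_act \<sigma> base_tabloid)) = (of_int (sign \<sigma>) * of_bool
      (\<exists>\<rho>. \<rho> permutes {1..n} \<and> (\<forall>x\<in>{1..n}. row (\<rho> x) = row x) \<and> w' = act \<sigma> (act \<rho> w)) :: complex)"
      by (simp only:)
  qed simp
  finally show ?thesis .
qed

text \<open>A point in the support arises from \<open>w\<close> by a row permutation followed by a
  column permutation. The first lowers the column moment unless it fixes \<open>w\<close>, the
  second preserves it; and the only semistandard column rearrangement of \<open>w\<close> is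
  \<open>w\<close>.\<close>

lemma orbit_hom_triangular:
  assumes w: "w \<in> \<Omega>" "semistandard (lab w)" and w': "semistandard (lab w')"
    and nz: "orbit_hom w base_polytabloid w' \<noteq> 0"
  shows "w' = w \<or> moment col w' < moment col w"
proof -
  obtain \<sigma> \<rho> where \<sigma>: "\<sigma> \<in> column_stabilizer lam t" and \<rho>: "\<rho> permutes {1..n}" "\<And>x. x \<in> {1..n} \<Longrightarrow> row (\<rho> x) = row x"
    and eq: "w' = act \<sigma> (act \<rho> w)"
  proof -
    have "\<exists>\<sigma>\<in>column_stabilizer lam t. \<exists>\<rho>. \<rho> permutes {1..n} \<and> (\<forall>x\<in>{1..n}. row (\<rho> x) = row x) \<and> w' = act \<sigma> (act \<rho> w)"
    proof (rule ccontr)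
      assume "\<not> ?thesis"
      then have "orbit_hom w base_polytabloid w' = 0"
        unfolding orbit_hom_base_polytabloid by (intro sum.neutral) auto
      then show False using nz by simp
    qed
    then show ?thesis using that by blast
  qed
  have "moment col w' = moment col (act \<rho> w)"
    unfolding eq using moment_col_act[OF \<sigma> act_in[OF \<rho>(1) w(1)]] .
  moreover note mom = moment_row_permutation[OF w(2,1) \<rho>]
  moreover have "w' = w" if "act \<rho> w = w"
    using semistandard_column_unique[OF w(2,1) \<sigma>] eq that w' by simp
  ultimately show ?thesis by force
qed

text \<open>Returning to \<open>w\<close> forces the row permutation to fix \<open>w\<close>, by the
  moment, and then the column permutation to be \<open>id\<close>; a single term of sign
  \<open>1\<close> remains.\<close>

lemma orbit_hom_diagonal:
  assumes w: "w \<in> \<Omega>" "semistandard (lab w)"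
  shows "orbit_hom w base_polytabloid w = 1"
proof -
  let ?C = "column_stabilizer lam t"
  have "(\<exists>\<rho>. \<rho> permutes {1..n} \<and> (\<forall>x\<in>{1..n}. row (\<rho> x) = row x) \<and> w = act \<sigma> (act \<rho> w)) \<longleftrightarrow> \<sigma> = id"
    if \<sigma>: "\<sigma> \<in> ?C" for \<sigma>
  proof
    assume "\<exists>\<rho>. \<rho> permutes {1..n} \<and> (\<forall>x\<in>{1..n}. row (\<rho> x) = row x) \<and> w = act \<sigma> (act \<rho> w)"
    then obtain \<rho> where \<rho>: "\<rho> permutes {1..n}" "\<And>x. x \<in> {1..n} \<Longrightarrow> row (\<rho> x) = row x" and eq: "w = act \<sigma> (act \<rho> w)"
      by blast
    have "moment col w = moment col (act \<rho> w)"
      using moment_col_act[OF \<sigma> act_in[OF \<rho>(1) w(1)]] eq by simp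
    then have "act \<rho> w = w" using moment_row_permutation(2)[OF w(2,1) \<rho>] by simp
    then show "\<sigma> = id" using semistandard_column_fix[OF w(2,1) \<sigma>] eq by simp
  next
    assume "\<sigma> = id"
    then show "\<exists>\<rho>. \<rho> permutes {1..n} \<and> (\<forall>x\<in>{1..n}. row (\<rho> x) = row x) \<and> w = act \<sigma> (act \<rho> w)"
      by (intro exI[of _ id]) (simp add: act_id)
  qed
  then have "orbit_hom w base_polytabloid w = (\<Sum>\<sigma>\<in>?C. if \<sigma> = id then 1 else 0)"
    unfolding orbit_hom_base_polytabloid by (intro sum.cong) auto
  also have "\<dots> = 1" using finite_column_stabilizer by (simp add: column_stabilizer_iff)
  finally show ?thesis .
qed

lemma dim_hom_values:
  assumes R: "rspace R = coord_space \<Omega>"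
  shows "cfun.dim hom_values = card {w\<in>\<Omega>. semistandard (lab w)}"
proof (rule antisym[OF dim_hom_values_le])
  let ?SS = "{w\<in>\<Omega>. semistandard (lab w)}"
  define b where "b w = orbit_hom w base_polytabloid" for w
  have fin: "finite ?SS" using finite_points by simp
  have "c w = 0" if sum: "(\<Sum>w\<in>?SS. cscale (c w) (b w)) = 0" and w: "w \<in> ?SS" for c w
  proof (rule ccontr)
    assume "c w \<noteq> 0"
    define Z where "Z = {w \<in> ?SS. c w \<noteq> 0}"
    have "finite Z" by (rule finite_subset[OF _ fin]) (auto simp: Z_def)
    moreover have "w \<in> Z" using w \<open>c w \<noteq> 0\<close> by (simp add: Z_def)
    ultimately have Z: "finite Z" "Z \<noteq> {}" by auto
    then have "Max (moment col ` Z) \<in> moment col ` Z" by simp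
    \<comment> \<open>Among the points with nonzero coefficient, one of largest column moment: by
      triangularity no other term of the relation is nonzero at \<open>m\<close>.\<close>
    then obtain m where m: "m \<in> Z" "moment col m = Max (moment col ` Z)" by auto
    have "0 = (\<Sum>w\<in>?SS. cscale (c w) (b w)) m" using sum by simp
    also have "\<dots> = (\<Sum>w\<in>?SS. c w * b w m)" by (simp add: sum_apply)
    also have "\<dots> = (\<Sum>w\<in>{m}. c w * b w m)"
    proof (rule sum.mono_neutral_right[OF fin])
      show "{m} \<subseteq> ?SS" using m by (simp add: Z_def)
      show "\<forall>i\<in>?SS - {m}. c i * b i m = 0"
      proof
        fix i assume i: "i \<in> ?SS - {m}"
        show "c i * b i m = 0"
        proof (rule ccontr)
          assume nz: "c i * b i m \<noteq> 0"
          then have "i \<in> Z" using i by (auto simp: Z_def)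
          then have "moment col i \<le> moment col m" using m(2) Z(1) by simp
          moreover have "m = i \<or> moment col m < moment col i"
            using orbit_hom_triangular[of i m] nz i m(1) by (auto simp: Z_def b_def)
          ultimately show False using i by auto
        qed
      qed
    qed
    also have "\<dots> = c m" using orbit_hom_diagonal[of m] m(1) by (simp add: Z_def b_def)
    finally show False using m(1) by (simp add: Z_def)
  qed
  then have ind: "inj_on b ?SS" "cfun.independent (b ` ?SS)"
    using independent_image[OF fin, of b] by blast+
  moreover have "b ` ?SS \<subseteq> hom_values"
    using rep_hom_orbit_hom[OF _ R] by (auto simp: hom_values_def b_def)
  ultimately have "card (b ` ?SS) \<le> cfun.dim hom_values"
    using independent_card_le_dim(1)[OF finite_points hom_values_supported] by blast
  then show "card ?SS \<le> cfun.dim hom_values" using card_image[OF ind(1)] by simp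
qed

end


section \<open>Irreducibility of Specht modules\<close>

text \<open>For a tabloid this is the index of the row containing \<open>x\<close>, so a tabloid
  becomes a filling of content \<lambda>.\<close>

definition tabloid_label :: "nat set list \<Rightarrow> nat \<Rightarrow> nat"
  where "tabloid_label T x = length (takeWhile (\<lambda>R. x \<notin> R) T)"

lemma tabloid_label_act:
  assumes "inj \<sigma>"
  shows "tabloid_label (tabloid_act \<sigma> T) (\<sigma> x) = tabloid_label T x"
  using assms by (simp add: tabloid_label_def takeWhile_map comp_def inj_image_mem_iff)

context young_tableau
begin

lemma tabloid_label_base:
  assumes x: "x \<in> {1..n}"
  shows "tabloid_label base_tabloid x = row x"
proof -
  have len: "row x < length lam" using row_col_in[OF x] by (simp add: cells_def)
  have "takeWhile (\<lambda>R. x \<notin> R) base_tabloid = take (row x) base_tabloid"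
    using len x by (intro takeWhile_eq_take_P_nth) (auto simp: nth_tabloid)
  then show ?thesis using len by (simp add: tabloid_label_def)
qed

lemma tabloid_label_act_base:
  assumes g: "g permutes {1..n}" and x: "x \<in> {1..n}"
  shows "tabloid_label (tabloid_act g base_tabloid) x = row (inv' g x)"
proof -
  have "inv' g x \<in> {1..n}" using x permutes_in_image[OF permutes_inv[OF g]] by blast
  then have "tabloid_label (tabloid_act g base_tabloid) (g (inv' g x)) = row (inv' g x)"
    using tabloid_label_act[OF permutes_inj[OF g]] tabloid_label_base by simp
  then show ?thesis using permutes_inverses(1)[OF g] by simp
qed

lemma labelled_rep_specht: "labelled_rep lam n t tabloid_act tabloids tabloid_label (specht lam)"
proof unfold_locales
  show "tabloid_label (tabloid_act \<sigma> T) (\<sigma> x) = tabloid_label T x" if "\<sigma> permutes {1..n}" for \<sigma> T x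
    using tabloid_label_act permutes_inj[OF that] by blast
  fix \<sigma> T
  assume \<sigma>: "\<sigma> permutes {1..n}" and T: "T \<in> tabloids"
    and fx: "\<And>x. x \<in> {1..n} \<Longrightarrow> tabloid_label T (\<sigma> x) = tabloid_label T x"
  obtain g where g: "g permutes {1..n}" "T = tabloid_act g base_tabloid" using T by (auto simp: tabloids_def)
  \<comment> \<open>Transports \<sigma> back to the base tabloid, where preserving labels means
    preserving rows.\<close>
  define \<rho> where "\<rho> = inv' g \<circ> (\<sigma> \<circ> g)"
  have \<rho>: "\<rho> permutes {1..n}"
    unfolding \<rho>_def by (intro permutes_compose g \<sigma> permutes_inv)
  have "row (\<rho> x) = row x" if x: "x \<in> {1..n}" for x
  proof -
    have gx: "g x \<in> {1..n}" and sgx: "\<sigma> (g x) \<in> {1..n}"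
      using x permutes_in_image[OF g(1)] permutes_in_image[OF \<sigma>] by blast+
    have "row (inv' g (\<sigma> (g x))) = row (inv' g (g x))"
      using fx[OF gx] tabloid_label_act_base[OF g(1)] gx sgx g(2) by simp
    then show ?thesis using permutes_inverses(2)[OF g(1)] by (simp add: \<rho>_def)
  qed
  then have "tabloid_act \<rho> base_tabloid = base_tabloid" using tabloid_act_fix_iff[OF \<rho>] by blast
  then have "tabloid_act g (tabloid_act \<rho> base_tabloid) = T" using g(2) by simp
  then show "tabloid_act \<sigma> T = T"
    unfolding \<rho>_def tabloid_act_comp tabloid_act_inverse[OF g(1)] g(2) .
qed (use finite_tabloids tabloid_act_comp tabloid_act_in subspace_specht specht_supported ract_specht_closed ract_specht in auto)

end

locale specht_module = young_tableau lam n t + tab: labelled_rep lam n t tabloid_act tabloids tabloid_label "specht lam"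
  for lam :: "nat list" and n :: nat and t :: "nat \<times> nat \<Rightarrow> nat"
begin

text \<open>The Kostka number of shape and content \<lambda> is \<open>1\<close>: strict columns
  force the label in row \<open>i\<close> to be at least \<open>i\<close>, and the labels have the
  same sum as the row indices.\<close>

lemma semistandard_tabloid:
  assumes T: "T \<in> tabloids" and ss: "semistandard (tabloid_label T)"
  shows "T = base_tabloid"
proof -
  obtain g where g: "g permutes {1..n}" "T = tabloid_act g base_tabloid" using T by (auto simp: tabloids_def)
  let ?l = "tabloid_label T"
  have l: "?l x = row (inv' g x)" if "x \<in> {1..n}" for x using tabloid_label_act_base g that by simp
  have le: "row x \<le> ?l x" if "x \<in> {1..n}" for x
    using that
  proof (induction "row x" arbitrary: x)
    case (Suc i)
    have "(i, col x) \<in> cells lam" using cells_down_closed[OF partition row_col_in[OF Suc.prems]] Suc.hyps(2) by simp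
    note y = t_in[OF this] row_t[OF this] col_t[OF this]
    have "i \<le> ?l (t (i, col x))" using Suc.hyps(1)[OF _ y(1)] y(2) by simp
    also have "\<dots> < ?l x" using ss y Suc.hyps(2) Suc.prems unfolding semistandard_def by (metis lessI)
    finally show ?case using Suc.hyps(2) by simp
  qed simp
  \<comment> \<open>The labels are the row indices permuted by \<open>g\<close>, so equal sums turn
    the pointwise inequality into equality.\<close>
  have "(\<Sum>x\<in>{1..n}. row x) = (\<Sum>x\<in>{1..n}. ?l x)"
    using sum.permute[OF permutes_inv[OF g(1)], of row] l by simp
  then have "row x = row (inv' g x)" if "x \<in> {1..n}" for x
    using sum_mono_inv[of row "{1..n}" ?l x] le l that by simp
  then have "tabloid_act (inv' g) base_tabloid = base_tabloid"
    using tabloid_act_fix_iff[OF permutes_inv[OF g(1)]] by simp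
  then show ?thesis using g tabloid_act_inverse by metis
qed

lemma rep_specht: "is_rep (sym_group n) (specht lam)"
  using tab.unitary by (simp add: unitary_rep_def)

text \<open>With \<open>c\<close> the coefficient of the base tabloid in the image of
  \<open>base_polytabloid\<close>, the homomorphism \<open>f\<close> minus \<open>c\<close> times
  the identity vanishes at the only semistandard tabloid, hence at the generator, hence
  everywhere.\<close>

lemma specht_hom_scalar:
  assumes f: "rep_hom (sym_group n) (specht lam) (specht lam) f"
  shows "\<exists>c. \<forall>v\<in>rspace (specht lam). f v = cscale c v"
proof (intro exI ballI)
  define c where "c = f base_polytabloid base_tabloid"
  note act = is_rep_act[OF rep_specht] and fD = rep_homD[OF f]
  note sub = cfun.subspace_diff[OF subspace_specht] cfun.subspace_scale[OF subspace_specht]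
  have "rep_hom (sym_group n) (specht lam) (specht lam) (\<lambda>v. f v - cscale c v)"
    unfolding rep_hom_def linear_map_on_def
    using fD sub act
    by (auto simp: fun_eq_iff algebra_simps ract_specht sym_group_carrier simp del: map_map)
  moreover have "f base_polytabloid T - cscale c base_polytabloid T = 0"
    if "T \<in> tabloids" "semistandard (tabloid_label T)" for T
    using semistandard_tabloid[OF that] base_polytabloid_base_tabloid by (simp add: c_def)
  ultimately have "f base_polytabloid - cscale c base_polytabloid = 0"
    using tab.hom_zero_if_zero_on_semistandard[of "\<lambda>v. f v - cscale c v"] by simp
  then have e: "f base_polytabloid = cscale c base_polytabloid" by simp
  let ?S = "rspace (specht lam)"
  let ?X = "{v\<in>?S. f v = cscale c v}"
  have "?S \<subseteq> ?X"
  proof -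
    have X: "cfun.subspace ?X"
      unfolding cfun.subspace_def
    proof (intro conjI ballI allI)
      have "f 0 = 0" using linear_map_on_zero subspace_specht f unfolding rep_hom_def by blast
      then show "0 \<in> ?X" using cfun.subspace_0[OF subspace_specht] by (simp add: fun_eq_iff)
      fix u assume u: "u \<in> ?X"
      then show "cscale k u \<in> ?X" for k
        using fD(3)[of u k] sub(2)[of u k] by (simp add: fun_eq_iff)
      fix v assume "v \<in> ?X"
      then show "u + v \<in> ?X"
        using u fD(2)[of u v] cfun.subspace_add[OF subspace_specht, of u v] by (simp add: fun_eq_iff algebra_simps)
    qed
    have "ract (specht lam) g base_polytabloid \<in> ?X" if g: "g permutes {1..n}" for g
      using fD(4)[OF _ base_polytabloid_in, of g] g e ract_specht_closed[OF g base_polytabloid_in] ract_specht_linear(2)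
      by (simp add: sym_group_carrier)
    then have "{ract (specht lam) g base_polytabloid | g. g permutes {1..n}} \<subseteq> ?X" by blast
    from cfun.span_minimal[OF this X] show ?thesis by (simp only: rspace_specht)
  qed
  then show "f v = cscale c v" if "v \<in> ?S" for v using that by blast
qed

text \<open>The orthogonal projection to an invariant subspace is a homomorphism, hence a scalar.\<close>

lemma irreducible_specht: "irreducible_rep (sym_group n) (specht lam)"
proof -
  let ?S = "rspace (specht lam)"
  have "U = {0} \<or> U = ?S" if U: "invariant_subspace (sym_group n) (specht lam) U" for U
  proof (cases "U = {0}")
    case False
    note Ud = invariant_subspaceD[OF U]
    have supp: "U \<subseteq> coord_space tabloids" "?S \<subseteq> coord_space tabloids" using Ud(2) specht_supported by auto
    have "\<exists>w\<in>U. \<forall>u\<in>U. inner_on tabloids (v - w) u = 0" for v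
      using orthogonal_projection_exists[OF finite_tabloids Ud(1) supp(1), of v] by metis
    then obtain p where p: "\<And>v. p v \<in> U" "\<And>v u. u \<in> U \<Longrightarrow> inner_on tabloids (v - p v) u = 0" by metis
    \<comment> \<open>Linearity and equivariance of the projection reduce to this: the expected
      value lies in \<open>U\<close> and leaves an orthogonal remainder.\<close>
    have unique: "p v = w" if "w \<in> U" "\<And>u. u \<in> U \<Longrightarrow> inner_on tabloids (v - w) u = 0" for v w
    proof -
      have d: "p v - w \<in> U" using p that cfun.subspace_diff[OF Ud(1)] by blast
      have "inner_on tabloids (p v - w) (p v - w) = inner_on tabloids (v - w) (p v - w) - inner_on tabloids (v - p v) (p v - w)"
        by (simp add: inner_on_diff_left)
      also have "\<dots> = 0" using that d p by simp
      finally show ?thesis using inner_on_self_eq_0[OF finite_tabloids, of "p v - w"] d supp by auto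
    qed
    have "rep_hom (sym_group n) (specht lam) (specht lam) p"
      unfolding rep_hom_def linear_map_on_def
    proof (intro conjI ballI allI)
      show "p \<in> ?S \<rightarrow> ?S" using p(1) Ud(2) by blast
      fix u v c g
      show "p (u + v) = p u + p v"
      proof (rule unique)
        fix w assume w: "w \<in> U"
        have eq: "(u + v) - (p u + p v) = (u - p u) + (v - p v)" by (simp add: algebra_simps)
        show "inner_on tabloids ((u + v) - (p u + p v)) w = 0"
          by (simp only: eq inner_on_add_left p(2)[OF w] add_0_left)
      qed (use p cfun.subspace_add[OF Ud(1)] in blast)
      show "p (cscale c v) = cscale c (p v)"
      proof (rule unique)
        fix w assume w: "w \<in> U"
        have eq: "cscale c v - cscale c (p v) = cscale c (v - p v)" by (simp add: fun_eq_iff algebra_simps)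
        show "inner_on tabloids (cscale c v - cscale c (p v)) w = 0"
          by (simp only: eq inner_on_scale_left p(2)[OF w] mult_zero_right)
      qed (use p cfun.subspace_scale[OF Ud(1)] in blast)
      assume g: "g \<in> carrier (sym_group n)" and v: "v \<in> ?S"
      show "p (ract (specht lam) g v) = ract (specht lam) g (p v)"
      proof (rule unique)
        show "ract (specht lam) g (p v) \<in> U" using Ud(3)[OF g p(1)] .
        have "v - p v \<in> {v \<in> ?S. \<forall>u\<in>U. inner_on tabloids v u = 0}"
          using p v Ud(2) cfun.subspace_diff[OF subspace_specht] by blast
        then have "ract (specht lam) g (v - p v) \<in> {v \<in> ?S. \<forall>u\<in>U. inner_on tabloids v u = 0}"
          by (rule invariant_subspaceD(3)[OF orthogonal_complement_invariant[OF tab.unitary U] g])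
        moreover have "ract (specht lam) g (v - p v) = ract (specht lam) g v - ract (specht lam) g (p v)"
          by (simp add: fun_eq_iff ract_specht del: map_map)
        ultimately show "inner_on tabloids (ract (specht lam) g v - ract (specht lam) g (p v)) u = 0" if "u \<in> U" for u
          using that by simp
      qed
    qed
    then obtain c where c: "\<And>v. v \<in> ?S \<Longrightarrow> p v = cscale c v" using specht_hom_scalar by blast
    \<comment> \<open>The projection fixes a nonzero \<open>u\<close> of \<open>U\<close>, so the
      scalar is \<open>1\<close> and \<open>U\<close> is everything.\<close>
    obtain u where u: "u \<in> U" "u \<noteq> 0" using False cfun.subspace_0[OF Ud(1)] by blast
    have "p u = u" by (rule unique[OF u(1)]) (simp add: inner_on_def)
    then have "cscale c u = cscale 1 u" using c u Ud(2) by auto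
    then have "c = 1" using u(2) by (simp only: cfun.scale_cancel_right) auto
    then have "v \<in> U" if "v \<in> ?S" for v using c[OF that] p(1)[of v] by (simp add: cscale_def)
    then show ?thesis using Ud(2) by blast
  qed simp
  then show ?thesis
    using rep_specht base_polytabloid_in base_polytabloid_nonzero unfolding irreducible_rep_def by blast
qed

end


section \<open>Tensor powers of the defining representation\<close>

text \<open>\<open>remdups\<close> keeps last occurrences, so prepending a new letter to a word
  prepends it to the list of distinct letters. Counting from the end leaves the labels of the other
  letters that occur unchanged, and an absent letter gets \<open>0\<close> because nothing remains
  after \<open>dropWhile\<close>.\<close>

definition word_label :: "'x list \<Rightarrow> 'x \<Rightarrow> nat"
  where "word_label w x = length (dropWhile (\<lambda>y. y \<noteq> x) (remdups w))"

lemma word_label_pos_iff: "0 < word_label w x \<longleftrightarrow> x \<in> set w"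
  by (auto simp: word_label_def)

lemma dropWhile_distinct_eq:
  assumes "x \<in> set d" "length (dropWhile (\<lambda>z. z \<noteq> x) d) = length (dropWhile (\<lambda>z. z \<noteq> y) d)"
  shows "x = y"
  using assms
proof (induction d)
  case (Cons z d)
  have le: "length (dropWhile (\<lambda>z. z \<noteq> x) d) \<le> length d" for x by (rule length_dropWhile_le)
  show ?case using Cons le[of x] le[of y] by (auto split: if_splits)
qed simp

lemma word_label_inj: "x \<in> set w \<Longrightarrow> word_label w x = word_label w y \<Longrightarrow> x = y"
  unfolding word_label_def by (rule dropWhile_distinct_eq) auto

lemma remdups_map_inj: "inj f \<Longrightarrow> remdups (map f w) = map f (remdups w)"
  by (induction w) (auto dest: injD)

lemma word_label_map:
  assumes "inj \<sigma>"
  shows "word_label (map \<sigma> w) (\<sigma> x) = word_label w x"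
  using assms by (simp add: word_label_def remdups_map_inj dropWhile_map comp_def inj_eq)

lemma finite_words: "finite X \<Longrightarrow> finite (words X r)"
  unfolding words_def by (rule finite_lists_length_eq)

lemma words_map: "\<sigma> permutes X \<Longrightarrow> map \<sigma> w \<in> words X r \<longleftrightarrow> w \<in> words X r"
  using permutes_in_image[of \<sigma> X] by (auto simp: words_def subset_iff)

text \<open>A Kronecker power of a permutation matrix is a permutation matrix: in row
  \<open>I\<close> only the column \<open>map (inv' g) I\<close> survives.\<close>

lemma ract_defining_rep_power:
  assumes g: "g permutes {1..n}" and v: "v \<in> rspace (defining_rep_power n r)"
  shows "ract (defining_rep_power n r) g v I = v (map (inv' g) I)"
proof (cases "I \<in> words {1..n} r")
  case True
  let ?I = "map (inv' g) I"
  have I: "?I \<in> words {1..n} r" using words_map[OF permutes_inv[OF g]] True by blast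
  have "(\<Prod>k<r. perm_matrix g (I ! k) (J ! k)) = of_bool (J = ?I)" if "J \<in> words {1..n} r" for J
  proof -
    have len: "length I = r" "length J = r" using True that by (auto simp: words_def)
    have "(\<Prod>k<r. perm_matrix g (I ! k) (J ! k)) = (\<Prod>k<r. of_bool (g (J ! k) = I ! k))"
      by (simp add: perm_matrix_def of_bool_def)
    also have "\<dots> = of_bool (\<forall>k<r. g (J ! k) = I ! k)"
      by (cases "\<forall>k<r. g (J ! k) = I ! k") auto
    also have "g (J ! k) = I ! k \<longleftrightarrow> J ! k = inv' g (I ! k)" for k
      using permutes_inv_eq[OF g] by metis
    then have "(\<forall>k<r. g (J ! k) = I ! k) \<longleftrightarrow> J = ?I"
      using len by (simp add: list_eq_iff_nth_eq)
    finally show ?thesis .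
  qed
  then have "ract (defining_rep_power n r) g v I = (\<Sum>J\<in>words {1..n} r. of_bool (J = ?I) * v J)"
    using True by (simp add: defining_rep_power_def tensor_power_def matrix_rep_def mat_vec_def)
  also have "\<dots> = (\<Sum>J\<in>{?I}. of_bool (J = ?I) * v J)"
    by (rule sum.mono_neutral_right) (use I finite_words in auto)
  finally show ?thesis by simp
next
  case False
  then have "?thesis \<longleftrightarrow> 0 = v (map (inv' g) I)"
    by (simp add: defining_rep_power_def tensor_power_def matrix_rep_def mat_vec_def)
  moreover have "map (inv' g) I \<notin> words {1..n} r" using words_map[OF permutes_inv[OF g]] False by blast
  ultimately show ?thesis
    using v by (simp add: defining_rep_power_def tensor_power_def matrix_rep_def coord_space_def)
qed

context specht_module
begin

lemma rspace_power: "rspace (defining_rep_power n r) = coord_space (words {1..n} r)"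
  by (simp add: defining_rep_power_def tensor_power_def matrix_rep_def)

lemma labelled_rep_power:
  "labelled_rep lam n t map (words {1..n} r) word_label (defining_rep_power n r)"
proof unfold_locales
  show "word_label (map \<sigma> w) (\<sigma> x) = word_label w x" if "\<sigma> permutes {1..n}" for \<sigma> x and w :: "nat list"
    by (rule word_label_map[OF permutes_inj[OF that]])
  \<comment> \<open>The letters of \<open>w\<close> are determined by their labels, so a
    label-preserving permutation fixes each of them.\<close>
  show "map \<sigma> w = w" if "\<sigma> permutes {1..n}" and w: "w \<in> words {1..n} r"
    and "\<And>x. x \<in> {1..n} \<Longrightarrow> word_label w (\<sigma> x) = word_label w x" for \<sigma> w
  proof (rule map_idI)
    fix x assume x: "x \<in> set w"
    then have "x \<in> {1..n}" using w by (auto simp: words_def)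
    then have "word_label w x = word_label w (\<sigma> x)" using that(3) by simp
    from word_label_inj[OF x this] show "\<sigma> x = x" ..
  qed
  show "ract (defining_rep_power n r) g v \<in> rspace (defining_rep_power n r)"
    if g: "g permutes {1..n}" and v: "v \<in> rspace (defining_rep_power n r)" for g v
    using v words_map[OF permutes_inv[OF g]] unfolding rspace_power coord_space_def
    by (auto simp: ract_defining_rep_power[OF g v])
  show "map \<sigma> w \<in> words {1..n} r" if "\<sigma> permutes {1..n}" "w \<in> words {1..n} r" for \<sigma> w
    using words_map that by blast
  show "ract (defining_rep_power n r) g v w = v (map (inv' g) w)"
    if "g permutes {1..n}" "v \<in> rspace (defining_rep_power n r)" for g v w
    using ract_defining_rep_power that .
qed (simp_all add: rspace_power subspace_coord_space finite_words)

theorem multiplicity_eq_card_semistandard: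
  "rep_multiplicity (sym_group n) (specht lam) (defining_rep_power n r) =
    card {w \<in> words {1..n} r. semistandard (word_label w)}"
proof -
  interpret P: labelled_rep lam n t map "words {1..n} r" word_label "defining_rep_power n r"
    by (rule labelled_rep_power)
  have "rep_multiplicity (sym_group n) (specht lam) (defining_rep_power n r) = cfun.dim P.hom_values"
    unfolding P.hom_values_def
    using rep_multiplicity_eq_dim[OF P.unitary irreducible_specht base_polytabloid_in base_polytabloid_nonzero]
      specht_hom_scalar by blast
  then show ?thesis using P.dim_hom_values[OF rspace_power] by simp
qed

end


section \<open>Counting semistandard words\<close>

lemma finite_lists_remdups: "finite {w. length w = r \<and> remdups w = d}"
  by (rule finite_subset[OF _ finite_lists_length_eq[of "set d" r]]) auto

text \<open>The Stirling recursion, by the first letter: either it occurs again later, with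
  \<open>length d\<close> choices, or it is the head of \<open>d\<close> and the remaining word has
  the list \<open>tl d\<close>.\<close>

lemma card_lists_remdups:
  assumes "distinct d"
  shows "card {w. length w = r \<and> remdups w = d} = Stirling r (length d)"
  using assms
proof (induction r arbitrary: d)
  case 0
  have "{w. length w = 0 \<and> remdups w = d} = (if d = [] then {[]} else {})" by auto
  then show ?case by (cases d) auto
next
  case (Suc r)
  have sr: "set w = set e" if "remdups w = e" for w e :: "'a list" using that by auto
  have hd_notin: "hd d \<notin> set w" if "remdups w = tl d" "d \<noteq> []" for w
    using sr[OF that(1)] Suc.prems that(2) by (cases d) auto
  let ?L = "\<lambda>d. {w. length w = r \<and> remdups w = d}"
  let ?f = "\<lambda>(x, w). x # w"
  have eq: "{w. length w = Suc r \<and> remdups w = d} =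
      ?f ` (set d \<times> ?L d) \<union> (if d = [] then {} else ?f ` ({hd d} \<times> ?L (tl d)))" (is "_ = ?A \<union> ?B")
  proof (intro equalityI subsetI)
    fix v assume "v \<in> {w. length w = Suc r \<and> remdups w = d}"
    then obtain x w where v: "v = x # w" "length w = r" "remdups (x # w) = d"
      by (cases v) auto
    show "v \<in> ?A \<union> ?B"
    proof (cases "x \<in> set w")
      case True
      then have "remdups w = d" "x \<in> set d" using v(3) by auto
      then show ?thesis using v by (auto intro!: image_eqI[of _ _ "(x, w)"])
    next
      case False
      then have "d = x # remdups w" using v(3) by simp
      then show ?thesis using v by (auto intro!: image_eqI[of _ _ "(x, w)"])
    qed
  next
    fix v assume "v \<in> ?A \<union> ?B"
    then show "v \<in> {w. length w = Suc r \<and> remdups w = d}"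
    proof
      assume "v \<in> ?B"
      then obtain w where w: "d \<noteq> []" "v = hd d # w" "length w = r" "remdups w = tl d"
        by (auto split: if_splits)
      then show ?thesis using hd_notin[OF w(4,1)] by simp
    next
      assume "v \<in> ?A"
      then obtain x w where w: "x \<in> set d" "v = x # w" "length w = r" "remdups w = d" by auto
      then show ?thesis using sr[OF w(4)] by simp
    qed
  qed
  have disj: "?A \<inter> ?B = {}"
  proof -
    have "x = hd d \<Longrightarrow> False" if "d \<noteq> []" "w \<in> ?L d" "w \<in> ?L (tl d)" for x w
      using that by (cases d) auto
    then show ?thesis by (auto split: if_splits)
  qed
  have inj: "inj_on ?f S" for S by (auto simp: inj_on_def)
  have A: "card ?A = length d * Stirling r (length d)"
    using Suc.IH[OF Suc.prems] by (simp add: card_image[OF inj] card_cartesian_product distinct_card[OF Suc.prems])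
  have B: "card ?B = (if d = [] then 0 else Stirling r (length d - 1))"
    using Suc.IH[of "tl d"] Suc.prems by (simp add: card_image[OF inj] card_cartesian_product distinct_tl)
  have "card (?A \<union> ?B) = card ?A + card ?B"
    using disj by (intro card_Un_disjoint) (auto simp: finite_lists_remdups)
  then show ?case unfolding eq A B by (cases d) auto
qed

lemma card_words_by_remdups:
  assumes "finite X"
  shows "card {w \<in> words X r. P (remdups w)} =
    (\<Sum>i\<le>r. Stirling r i * card {d. distinct d \<and> set d \<subseteq> X \<and> length d = i \<and> P d})"
proof -
  define D where "D i = {d. distinct d \<and> set d \<subseteq> X \<and> length d = i \<and> P d}" for i
  have finD: "finite (D i)" for i
    by (rule finite_subset[OF _ finite_lists_length_eq[OF assms, of i]]) (auto simp: D_def)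
  let ?L = "\<lambda>d. {w. length w = r \<and> remdups w = d}"
  have "{w \<in> words X r. P (remdups w)} = (\<Union>d\<in>(\<Union>i\<in>{..r}. D i). ?L d)"
  proof (intro equalityI subsetI)
    fix w assume w: "w \<in> {w \<in> words X r. P (remdups w)}"
    then have "remdups w \<in> D (length (remdups w))" "w \<in> ?L (remdups w)"
      by (auto simp: words_def D_def)
    moreover have "length (remdups w) \<le> r" using w length_remdups_leq[of w] by (simp add: words_def)
    ultimately show "w \<in> (\<Union>d\<in>(\<Union>i\<in>{..r}. D i). ?L d)" by blast
  next
    fix w assume "w \<in> (\<Union>d\<in>(\<Union>i\<in>{..r}. D i). ?L d)"
    then obtain i where "remdups w \<in> D i" "length w = r" by blast
    then show "w \<in> {w \<in> words X r. P (remdups w)}" by (auto simp: words_def D_def)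
  qed
  also have "card \<dots> = (\<Sum>d\<in>(\<Union>i\<in>{..r}. D i). card (?L d))"
    using finD finite_lists_remdups by (intro card_UN_disjoint) auto
  also have "\<dots> = (\<Sum>i\<le>r. \<Sum>d\<in>D i. card (?L d))"
    using finD by (intro sum.UNION_disjoint) (auto simp: D_def)
  also have "\<dots> = (\<Sum>i\<le>r. \<Sum>d\<in>D i. Stirling r i)"
    by (intro sum.cong refl) (auto simp: D_def card_lists_remdups)
  finally show ?thesis by (simp add: D_def mult.commute)
qed

lemma word_label_remdups: "word_label (remdups w) = word_label w"
  by (simp add: word_label_def fun_eq_iff distinct_remdups_id)

lemma word_label_nth:
  assumes "distinct d" "j < length d"
  shows "word_label d (d ! j) = length d - j"
proof -
  have "takeWhile (\<lambda>y. y \<noteq> d ! j) d = take j d"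
    using assms by (intro takeWhile_eq_take_P_nth) (auto simp: nth_eq_iff_index_eq)
  then show ?thesis
    using assms by (simp add: word_label_def distinct_remdups_id dropWhile_eq_drop)
qed

lemma word_label_eq_0: "x \<notin> set w \<Longrightarrow> word_label w x = 0"
  using word_label_pos_iff[of w x] by simp

lemma map_word_label:
  assumes "distinct d"
  shows "map (word_label d) d = rev [1..<Suc (length d)]"
  using assms by (intro nth_equalityI) (auto simp: word_label_nth rev_nth simp del: upt_Suc)


subsection \<open>Standard fillings\<close>

text \<open>Standard tableaux with entry set \<open>A\<close>: below the first row the labels used
  are only some subset of \<open>{1..i}\<close>.\<close>

definition standard_fillings :: "nat list \<Rightarrow> nat set \<Rightarrow> (nat \<times> nat \<Rightarrow> nat) set"
  where "standard_fillings mu A = {u \<in> extensional (cells mu). bij_betw u (cells mu) A \<and>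
    (\<forall>i j k. (i, j) \<in> cells mu \<and> (i, k) \<in> cells mu \<and> j < k \<longrightarrow> u (i, j) < u (i, k)) \<and>
    (\<forall>i j k. (i, k) \<in> cells mu \<and> (j, k) \<in> cells mu \<and> i < j \<longrightarrow> u (i, k) < u (j, k))}"

lemma standard_tableaux_eq: "standard_tableaux mu = standard_fillings mu {1..sum_list mu}"
  by (simp add: standard_tableaux_def standard_fillings_def tableau_def)

lemma finite_standard_fillings: "finite A \<Longrightarrow> finite (standard_fillings mu A)"
  by (rule finite_subset[OF _ finite_PiE[OF finite_cells, of mu "\<lambda>_. A"]])
     (auto simp: standard_fillings_def bij_betw_def extensional_def)

text \<open>Composition with the order isomorphism from \<open>A\<close> to \<open>B\<close>
  preserves standardness; equality of the counts follows by symmetry.\<close>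

lemma card_standard_fillings_le:
  assumes "finite A" "finite B" "card A = card B"
  shows "card (standard_fillings mu A) \<le> card (standard_fillings mu B)"
proof -
  obtain a where a: "bij_betw a {..<card A} A" "strict_mono_on {..<card A} a"
    using ex_bij_betw_strict_mono_card[OF assms(1)] .
  obtain b where b: "bij_betw b {..<card A} B" "strict_mono_on {..<card A} b"
    using ex_bij_betw_strict_mono_card[OF assms(2)] assms(3) by metis
  define g where "g = b \<circ> inv_into {..<card A} a"
  have ia: "bij_betw (inv_into {..<card A} a) A {..<card A}" using bij_betw_inv_into[OF a(1)] .
  have g: "bij_betw g A B" unfolding g_def by (rule bij_betw_trans[OF ia b(1)])
  have mono: "g x < g y" if "x \<in> A" "y \<in> A" "x < y" for x y
  proof -
    let ?i = "inv_into {..<card A} a"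
    have i: "?i x \<in> {..<card A}" "?i y \<in> {..<card A}" "a (?i x) = x" "a (?i y) = y"
      using that a(1) bij_betwE[OF ia] bij_betw_inv_into_right[OF a(1)] by auto
    have "?i x < ?i y"
    proof (rule ccontr)
      assume "\<not> ?i x < ?i y"
      then have "a (?i y) \<le> a (?i x)"
        using a(2) i(1,2) by (metis leI order_le_less strict_mono_onD)
      then show False using i(3,4) that(3) by simp
    qed
    then show ?thesis using b(2) i(1,2) by (simp add: g_def strict_mono_onD)
  qed
  show ?thesis
  proof (rule card_inj_on_le)
    show "inj_on (\<lambda>u. restrict (g \<circ> u) (cells mu)) (standard_fillings mu A)"
    proof (rule inj_onI)
      fix u v assume u: "u \<in> standard_fillings mu A" and v: "v \<in> standard_fillings mu A"
        and eq: "restrict (g \<circ> u) (cells mu) = restrict (g \<circ> v) (cells mu)"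
      show "u = v"
      proof (rule extensionalityI)
        fix c assume c: "c \<in> cells mu"
        have "g (u c) = g (v c)" using fun_cong[OF eq, of c] c by simp
        moreover have "u c \<in> A" "v c \<in> A" using u v c by (auto simp: standard_fillings_def bij_betw_def)
        ultimately show "u c = v c" using g by (auto simp: bij_betw_def inj_on_def)
      qed (use u v in \<open>auto simp: standard_fillings_def\<close>)
    qed
    show "(\<lambda>u. restrict (g \<circ> u) (cells mu)) ` standard_fillings mu A \<subseteq> standard_fillings mu B"
    proof (rule image_subsetI)
      fix u assume u: "u \<in> standard_fillings mu A"
      have "bij_betw (g \<circ> u) (cells mu) B"
        using u bij_betw_trans[OF _ g] by (auto simp: standard_fillings_def)
      then have "bij_betw (restrict (g \<circ> u) (cells mu)) (cells mu) B"
        by (simp cong: bij_betw_cong)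
      moreover have "u c \<in> A" if "c \<in> cells mu" for c
        using u that by (auto simp: standard_fillings_def bij_betw_def)
      ultimately show "restrict (g \<circ> u) (cells mu) \<in> standard_fillings mu B"
        using u mono unfolding standard_fillings_def by simp
    qed
  qed (rule finite_standard_fillings[OF assms(2)])
qed

lemma card_standard_fillings:
  assumes "finite A" "card A = sum_list mu"
  shows "card (standard_fillings mu A) = num_standard_tableaux mu"
  unfolding num_standard_tableaux_def standard_tableaux_eq
  using assms by (intro antisym card_standard_fillings_le) auto

text \<open>The entry set is the image of the filling, so different subsets give disjoint families
  of the same size.\<close>

lemma card_standard_fillings_subsets:
  "card (\<Union>A\<in>{A. A \<subseteq> {1..i} \<and> card A = sum_list mu}. standard_fillings mu A) =
    (i choose sum_list mu) * num_standard_tableaux mu"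
proof -
  let ?I = "{A. A \<subseteq> {1..i} \<and> card A = sum_list mu}"
  have finA: "finite A" if "A \<in> ?I" for A using that finite_subset by auto
  have "card (\<Union>A\<in>?I. standard_fillings mu A) = (\<Sum>A\<in>?I. card (standard_fillings mu A))"
  proof (rule card_UN_disjoint)
    show "\<forall>A\<in>?I. finite (standard_fillings mu A)" using finA finite_standard_fillings by blast
    show "\<forall>A\<in>?I. \<forall>B\<in>?I. A \<noteq> B \<longrightarrow> standard_fillings mu A \<inter> standard_fillings mu B = {}"
      by (auto simp: standard_fillings_def bij_betw_def)
  qed simp
  also have "\<dots> = (\<Sum>A\<in>?I. num_standard_tableaux mu)"
    using finA card_standard_fillings by (intro sum.cong) auto
  also have "\<dots> = (i choose sum_list mu) * num_standard_tableaux mu"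
    using n_subsets[of "{1..i}" "sum_list mu"] by simp
  finally show ?thesis .
qed


context young_tableau
begin

text \<open>The content of the filling depends only on \<open>length d\<close>; this is what allows
  the first row to be recovered from the lower ones.\<close>

lemma image_mset_word_label:
  assumes d: "distinct d" "set d \<subseteq> {1..n}"
  shows "image_mset (word_label d) (mset_set {1..n}) =
    replicate_mset (n - length d) 0 + mset_set {1..length d}"
proof -
  let ?R = "{1..n} - set d"
  have "{1..n} = ?R \<union> set d" using d(2) by auto
  then have "mset_set {1..n} = mset_set ?R + mset d"
    using mset_set_Union[of ?R "set d"] mset_set_set[OF d(1)] by auto
  moreover have "image_mset (word_label d) (mset_set ?R) = replicate_mset (n - length d) 0"
  proof -
    have "image_mset (word_label d) (mset_set ?R) = image_mset (\<lambda>_. 0) (mset_set ?R)"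
      by (rule image_mset_cong) (auto intro: word_label_eq_0)
    also have "\<dots> = replicate_mset (card ?R) 0" by (simp add: image_mset_const_eq)
    also have "card ?R = n - length d" using d by (simp add: card_Diff_subset distinct_card)
    finally show ?thesis .
  qed
  moreover have "image_mset (word_label d) (mset d) = mset_set {1..length d}"
  proof -
    have "image_mset (word_label d) (mset d) = mset (map (word_label d) d)" by simp
    also have "\<dots> = mset [1..<Suc (length d)]" by (simp only: map_word_label[OF d(1)] mset_rev)
    also have "\<dots> = mset_set {1..length d}" by (simp only: mset_upt atLeastLessThanSuc_atLeastAtMost)
    finally show ?thesis .
  qed
  ultimately show ?thesis by simp
qed

end

section \<open>Semistandard fillings determined by their lower rows\<close>

locale young_tableau_Cons = young_tableau "l # mu" n t for l mu n t
begin

definition upper :: "nat \<Rightarrow> nat" where "upper q = t (0, q)"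
definition lower :: "nat \<times> nat \<Rightarrow> nat" where "lower c = t (Suc (fst c), snd c)"
definition Low :: "nat set" where "Low = {x \<in> {1..n}. 0 < row x}"

lemma cells_Cons:
  "(0, q) \<in> cells (l # mu) \<longleftrightarrow> q < l" "(Suc p, q) \<in> cells (l # mu) \<longleftrightarrow> (p, q) \<in> cells mu"
  by (auto simp: cells_def)

lemma n_eq: "n = l + sum_list mu"
  using sum_lam by simp

lemma upper_simps:
  assumes "q < l"
  shows "row (upper q) = 0" "col (upper q) = q" "upper q \<in> {1..n}"
  using assms cells_Cons(1)[of q] row_t col_t t_in unfolding upper_def by blast+

lemma lower_simps:
  assumes "c \<in> cells mu"
  shows "row (lower c) = Suc (fst c)" "col (lower c) = snd c" "lower c \<in> {1..n}"
proof -
  have "(Suc (fst c), snd c) \<in> cells (l # mu)" using assms cells_Cons(2)[of "fst c" "snd c"] by simp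
  then show "row (lower c) = Suc (fst c)" "col (lower c) = snd c" "lower c \<in> {1..n}"
    unfolding lower_def using row_t col_t t_in by blast+
qed

lemma upper_col:
  assumes "x \<in> {1..n}" "row x = 0"
  shows "col x < l" "upper (col x) = x"
  using row_col_in[OF assms(1)] t_row_col[OF assms(1)] assms(2) cells_Cons(1) by (auto simp: upper_def)

lemma lower_row_col:
  assumes "x \<in> Low"
  shows "(row x - 1, col x) \<in> cells mu" "lower (row x - 1, col x) = x"
proof -
  have x: "x \<in> {1..n}" and p: "row x = Suc (row x - 1)" using assms by (auto simp: Low_def)
  show "(row x - 1, col x) \<in> cells mu" using row_col_in[OF x] cells_Cons(2)[of "row x - 1" "col x"] p by simp
  show "lower (row x - 1, col x) = x" using t_row_col[OF x] p by (simp add: lower_def)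
qed

lemma bij_lower: "bij_betw lower (cells mu) Low"
proof (rule bij_betw_imageI)
  show "inj_on lower (cells mu)"
  proof (rule inj_onI)
    fix c c' assume "c \<in> cells mu" "c' \<in> cells mu" "lower c = lower c'"
    then have "Suc (fst c) = Suc (fst c')" "snd c = snd c'" using lower_simps(1,2) by metis+
    then show "c = c'" by (simp add: prod_eq_iff)
  qed
  show "lower ` cells mu = Low"
  proof (intro equalityI subsetI)
    fix x assume "x \<in> lower ` cells mu"
    then show "x \<in> Low" using lower_simps unfolding Low_def by force
  next
    fix x assume "x \<in> Low"
    then show "x \<in> lower ` cells mu" using lower_row_col by (metis imageI)
  qed
qed

lemma bij_upper: "bij_betw upper {..<l} ({1..n} - Low)"
proof (rule bij_betwI[where g = col])
  show "upper \<in> {..<l} \<rightarrow> {1..n} - Low"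
    using upper_simps unfolding Low_def by force
  show "col \<in> {1..n} - Low \<rightarrow> {..<l}"
    using upper_col(1) unfolding Low_def by blast
  show "col (upper q) = q" if "q \<in> {..<l}" for q using upper_simps(2) that by simp
  show "upper (col x) = x" if "x \<in> {1..n} - Low" for x using upper_col(2) that unfolding Low_def by blast
qed

lemma Low_subset: "Low \<subseteq> {1..n}" and finite_Low: "finite Low"
  by (auto simp: Low_def)

text \<open>The label strictly exceeds that of the first-row entry in the same column.\<close>

lemma semistandard_pos:
  assumes "semistandard L" "x \<in> Low"
  shows "0 < L x"
proof -
  have x: "x \<in> {1..n}" "0 < row x" using assms(2) by (auto simp: Low_def)
  have "(0, col x) \<in> cells (l # mu)" using cells_down_closed[OF partition row_col_in[OF x(1)]] by simp
  note y = row_t[OF this] col_t[OF this] t_in[OF this]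
  have "L (t (0, col x)) < L x" using assms(1) x y unfolding semistandard_def by simp
  then show ?thesis by simp
qed

definition lower_labels :: "(nat \<Rightarrow> nat) \<Rightarrow> nat \<times> nat \<Rightarrow> nat"
  where "lower_labels L = restrict (L \<circ> lower) (cells mu)"

abbreviation "label_lists i \<equiv> {d. distinct d \<and> set d \<subseteq> {1..n} \<and> length d = i \<and> semistandard (word_label d)}"

abbreviation "lower_fillings i \<equiv> (\<Union>A\<in>{A. A \<subseteq> {1..i} \<and> card A = sum_list mu}. standard_fillings mu A)"

text \<open>Labels below the first row are positive, and positive labels are pairwise distinct; so
  rows that increase weakly increase strictly.\<close>

lemma lower_labels_in:
  assumes d: "d \<in> label_lists i"
  shows "lower_labels (word_label d) \<in> lower_fillings i"
proof -
  let ?L = "word_label d" and ?A = "word_label d ` Low"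
  have ss: "semistandard ?L" and dist: "distinct d" and len: "length d = i" using d by auto
  have Low: "Low \<subseteq> set d"
  proof
    fix x assume "x \<in> Low"
    from semistandard_pos[OF ss this] show "x \<in> set d" by (simp only: word_label_pos_iff)
  qed
  have "?L ` set d = set (map ?L d)" by simp
  also have "\<dots> = {1..i}" unfolding map_word_label[OF dist] using len by auto
  finally have A: "?A \<subseteq> {1..i}" using Low by auto
  have inj: "inj_on ?L Low"
  proof (rule inj_onI)
    fix x y assume "x \<in> Low" and eq: "?L x = ?L y"
    then have "x \<in> set d" using Low by blast
    from word_label_inj[OF this eq] show "x = y" .
  qed
  have bij: "bij_betw (?L \<circ> lower) (cells mu) ?A"
    using bij_betw_trans[OF bij_lower inj_on_imp_bij_betw[OF inj]] .
  have card: "card ?A = sum_list mu"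
    using bij_betw_same_card[OF bij] card_cells by simp
  have row_less: "?L (lower c) < ?L (lower c')"
    if c: "c \<in> cells mu" "c' \<in> cells mu" "fst c = fst c'" "snd c < snd c'" for c c'
  proof -
    have "?L (lower c) \<le> ?L (lower c')"
      using ss lower_simps[OF c(1)] lower_simps[OF c(2)] c(3,4) unfolding semistandard_def by simp
    moreover have "?L (lower c) \<noteq> ?L (lower c')"
      using bij c unfolding bij_betw_def inj_on_def by fastforce
    ultimately show ?thesis by simp
  qed
  have col_less: "?L (lower c) < ?L (lower c')"
    if c: "c \<in> cells mu" "c' \<in> cells mu" "snd c = snd c'" "fst c < fst c'" for c c'
    using ss lower_simps[OF c(1)] lower_simps[OF c(2)] c(3,4) unfolding semistandard_def by simp
  have "bij_betw (lower_labels ?L) (cells mu) ?A"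
    using bij by (simp add: lower_labels_def cong: bij_betw_cong)
  then have "lower_labels ?L \<in> standard_fillings mu ?A"
    using row_less col_less unfolding standard_fillings_def by (simp add: lower_labels_def)
  then show ?thesis using A card by blast
qed

text \<open>All lists of length \<open>i\<close> have the same multiset of labels. The lower rows
  therefore determine the multiset of labels in the first row, which is sorted and so determined
  itself; the labels in turn determine the list.\<close>

lemma inj_lower_labels: "inj_on (\<lambda>d. lower_labels (word_label d)) (label_lists i)"
proof (rule inj_onI)
  fix d e assume d: "d \<in> label_lists i" and e: "e \<in> label_lists i"
    and eq: "lower_labels (word_label d) = lower_labels (word_label e)"
  have low: "word_label d x = word_label e x" if "x \<in> Low" for x
    using fun_cong[OF eq, of "(row x - 1, col x)"] lower_row_col[OF that] by (simp add: lower_labels_def)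
  have decomp: "mset (map (word_label f \<circ> upper) [0..<l]) + image_mset (word_label f) (mset_set Low) =
      replicate_mset (n - i) 0 + mset_set {1..i}" if f: "f \<in> label_lists i" for f
  proof -
    have "mset (map (word_label f \<circ> upper) [0..<l]) =
        image_mset (word_label f) (image_mset upper (mset_set {..<l}))"
      by (simp add: multiset.map_comp atLeast0LessThan)
    also have "image_mset upper (mset_set {..<l}) = mset_set ({1..n} - Low)"
      using bij_upper by (simp add: image_mset_mset_set bij_betw_def)
    finally have "mset (map (word_label f \<circ> upper) [0..<l]) + image_mset (word_label f) (mset_set Low) =
        image_mset (word_label f) (mset_set ({1..n} - Low) + mset_set Low)"
      by (simp only: image_mset_union)
    also have "mset_set ({1..n} - Low) + mset_set Low = mset_set {1..n}"
      using mset_set_Union[of "{1..n} - Low" Low] finite_Low Low_subset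
      by (simp add: Un_absorb2 Diff_disjoint Int_commute)
    also have "image_mset (word_label f) (mset_set {1..n}) = replicate_mset (n - i) 0 + mset_set {1..i}"
      using image_mset_word_label[of f] f by blast
    finally show ?thesis .
  qed
  have "image_mset (word_label d) (mset_set Low) = image_mset (word_label e) (mset_set Low)"
    using low finite_Low by (intro image_mset_cong) auto
  then have "mset (map (word_label d \<circ> upper) [0..<l]) = mset (map (word_label e \<circ> upper) [0..<l])"
    using decomp[OF d] decomp[OF e] by (metis add_right_cancel)
  moreover have sorted: "sorted (map (word_label f \<circ> upper) [0..<l])" if "f \<in> label_lists i" for f
  proof -
    have ss: "semistandard (word_label f)" using that by simp
    have "word_label f (upper p) \<le> word_label f (upper q)" if "p < q" "q < l" for p q
      using ss that upper_simps[of p] upper_simps[of q] unfolding semistandard_def by simp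
    then show ?thesis by (simp add: sorted_iff_nth_mono_less)
  qed
  ultimately have "map (word_label d \<circ> upper) [0..<l] = map (word_label e \<circ> upper) [0..<l]"
    using properties_for_sort sorted[OF d] sorted[OF e] by metis
  then have up: "word_label d (upper q) = word_label e (upper q)" if "q < l" for q
    using that by simp
  have labels: "word_label d x = word_label e x" if x: "x \<in> {1..n}" for x
  proof (cases "x \<in> Low")
    case False
    then have "row x = 0" using x by (simp add: Low_def)
    then show ?thesis using up[OF upper_col(1)[OF x]] upper_col(2)[OF x] by simp
  qed (rule low)
  show "d = e"
  proof (rule nth_equalityI)
    show "length d = length e" using d e by simp
    fix j assume j: "j < length d"
    have je: "j < length e" and dj: "d ! j \<in> {1..n}" using d e j nth_mem[OF j] by (simp, blast)
    have "word_label e (e ! j) = word_label d (d ! j)"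
      using word_label_nth[of d j] word_label_nth[of e j] j je d e by simp
    also have "\<dots> = word_label e (d ! j)" by (rule labels[OF dj])
    finally have "word_label e (e ! j) = word_label e (d ! j)" .
    from word_label_inj[OF nth_mem[OF je] this] show "d ! j = e ! j" ..
  qed
qed

lemma word_label_list_exists:
  assumes L: "bij_betw L P {1..i}" and out: "\<And>x. x \<notin> P \<Longrightarrow> L x = 0"
  obtains d where "distinct d" "set d = P" "length d = i" "word_label d = L"
proof -
  let ?g = "inv_into P L"
  \<comment> \<open>Descending, because labels count from the end of the list.\<close>
  define d where "d = map ?g (rev [1..<Suc i])"
  have g: "bij_betw ?g {1..i} P" using bij_betw_inv_into[OF L] .
  have set: "set (rev [1..<Suc i]) = {1..i}" by auto
  have dist: "distinct d"
    unfolding d_def distinct_map set using g by (simp add: bij_betw_def)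
  have setd: "set d = P" unfolding d_def set_map set using g by (simp add: bij_betw_def)
  have len: "length d = i" by (simp add: d_def)
  have "word_label d x = L x" for x
  proof (cases "x \<in> P")
    case True
    then obtain j where j: "j < length d" "x = d ! j" using setd by (metis in_set_conv_nth)
    have "rev [1..<Suc i] ! j = i - j" using j(1) len by (simp add: rev_nth del: upt_Suc)
    then have "x = ?g (i - j)" using j len by (simp add: d_def del: upt_Suc)
    moreover have "i - j \<in> {1..i}" using j(1) len by auto
    ultimately have "L x = i - j" using bij_betw_inv_into_right[OF L] by simp
    then show ?thesis using word_label_nth[OF dist j(1)] j(2) len by simp
  next
    case False
    then show ?thesis using out setd word_label_eq_0 by metis
  qed
  then show ?thesis using that dist setd len by blast
qed

text \<open>
  Given the labels \<open>u\<close> of the lower rows, the first row consists of the \<open>n - i\<close> labels \<open>0\<close> followed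
  by the unused labels in increasing order. Since \<open>n - i \<ge> \<lambda>\<^sub>2\<close>, only the labels \<open>0\<close> lie above
  labels of \<open>u\<close>.
\<close>

lemma lower_labels_surj:
  assumes i: "i \<le> n - part (l # mu) 2" and u: "u \<in> lower_fillings i"
  shows "u \<in> (\<lambda>d. lower_labels (word_label d)) ` label_lists i"
proof -
  obtain A where A: "A \<subseteq> {1..i}" "card A = sum_list mu" and uA: "u \<in> standard_fillings mu A" using u by blast
  have finA: "finite A" using A(1) finite_subset by blast
  \<comment> \<open>The positive labels left over for the first row; after \<open>m\<close> zeros
    they fill it exactly, because \<open>n - i\<close> and \<open>i - sum_list mu\<close> add up to
    \<open>l\<close>.\<close>
  define zs where "zs = sorted_list_of_set ({1..i} - A)"
  define m where "m = n - i"
  have "sum_list mu \<le> i" using card_mono[OF _ A(1)] A(2) by simp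
  moreover have "i \<le> n" using i by simp
  moreover have "length zs = i - sum_list mu"
    using A finA by (simp add: zs_def card_Diff_subset)
  ultimately have lenz: "m + length zs = l" using n_eq by (simp add: m_def)
  have setz: "set zs = {1..i} - A" and zs: "distinct zs" "sorted zs" by (simp_all add: zs_def)
  define ys where "ys = replicate m 0 @ zs"
  have sorted: "sorted ys" using zs(2) by (auto simp: ys_def sorted_append)
  have leny: "length ys = l" using lenz by (simp add: ys_def)
  define L where "L x = (if x \<notin> {1..n} then 0 else if row x = 0 then ys ! col x else u (row x - 1, col x))" for x
  have Lup: "L (upper q) = ys ! q" if "q < l" for q
    using upper_simps[OF that] by (simp add: L_def del: atLeastAtMost_iff One_nat_def)
  have Llow: "L (lower c) = u c" if "c \<in> cells mu" for c
    using lower_simps[OF that] by (simp add: L_def del: atLeastAtMost_iff One_nat_def)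
  have uin: "u c \<in> A" if "c \<in> cells mu" for c using uA that by (auto simp: standard_fillings_def bij_betw_def)
  \<comment> \<open>The entries with positive label, that is, the letters of the list to be
    constructed.\<close>
  define P where "P = Low \<union> upper ` {m..<l}"
  have "bij_betw L Low A"
  proof -
    have "bij_betw (L \<circ> lower) (cells mu) A"
      using uA Llow by (simp add: standard_fillings_def cong: bij_betw_cong)
    then have "bij_betw L (lower ` cells mu) A"
      using bij_betw_comp_iff2[of lower "cells mu"] bij_lower
      by (metis bij_betw_comp_iff bij_betw_imp_surj_on)
    then show ?thesis using bij_lower by (simp add: bij_betw_def)
  qed
  moreover have "bij_betw L (upper ` {m..<l}) ({1..i} - A)"
  proof -
    have inj_up: "inj_on upper {m..<l}" using bij_upper by (auto simp: bij_betw_def intro: inj_on_subset[of _ "{..<l}"])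
    have nth: "L (upper q) = zs ! (q - m)" if "q \<in> {m..<l}" for q
      using that Lup[of q] by (simp add: ys_def nth_append)
    have "bij_betw (\<lambda>q. zs ! (q - m)) {m..<l} ({1..i} - A)"
    proof -
      have "bij_betw (\<lambda>q. q - m) {m..<l} {..<length zs}"
        by (rule bij_betwI[where g = "\<lambda>q. q + m"]) (use lenz in auto)
      then have "bij_betw ((!) zs \<circ> (\<lambda>q. q - m)) {m..<l} ({1..i} - A)"
        using bij_betw_nth[OF zs(1) refl] setz by (intro bij_betw_trans) auto
      then show ?thesis by (simp add: comp_def)
    qed
    then have "bij_betw (L \<circ> upper) {m..<l} ({1..i} - A)"
      using nth bij_betw_cong[of "{m..<l}" "L \<circ> upper" "\<lambda>q. zs ! (q - m)" "{1..i} - A"]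
      unfolding comp_apply by blast
    then show ?thesis
      using bij_betw_comp_iff[OF inj_on_imp_bij_betw[OF inj_up]] by blast
  qed
  moreover have "A \<inter> ({1..i} - A) = {}" "A \<union> ({1..i} - A) = {1..i}" using A(1) by auto
  ultimately have LP: "bij_betw L P {1..i}" unfolding P_def using bij_betw_combine by metis
  have "L x = 0" if "x \<notin> P" for x
  proof (cases "x \<in> {1..n}")
    case True
    then have r: "row x = 0" using that by (simp add: P_def Low_def)
    note x = upper_col[OF True r]
    have "col x \<notin> {m..<l}" using that x(2) unfolding P_def by (metis UnI2 imageI)
    then have "col x < m" using x(1) by simp
    then have "ys ! col x = 0" by (simp add: ys_def nth_append)
    then show ?thesis using Lup[OF x(1)] x(2) by simp
  qed (simp add: L_def del: atLeastAtMost_iff One_nat_def)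
  then obtain d where d: "distinct d" "set d = P" "length d = i" "word_label d = L"
    using word_label_list_exists[OF LP] by metis
  have "upper ` {m..<l} \<subseteq> {1..n}" using upper_simps(3) by (auto simp del: atLeastAtMost_iff)
  then have P: "P \<subseteq> {1..n}" unfolding P_def using Low_subset by blast
  have "semistandard L"
    unfolding semistandard_def
  proof (intro conjI ballI impI)
    fix x y assume xy: "x \<in> {1..n}" "y \<in> {1..n}"
    show "L x \<le> L y" if c: "row x = row y \<and> col x < col y"
    proof (cases "row x = 0")
      case True
      then have ry: "row y = 0" using c by simp
      note cx = upper_col[OF xy(1) True] and cy = upper_col[OF xy(2) ry]
      have "ys ! col x \<le> ys ! col y" using sorted c cy(1) leny by (simp add: sorted_iff_nth_mono_less)
      then show ?thesis using Lup[OF cx(1)] Lup[OF cy(1)] cx(2) cy(2) by simp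
    next
      case False
      then have "x \<in> Low" "y \<in> Low" using xy c by (auto simp: Low_def)
      note lx = lower_row_col[OF this(1)] and ly = lower_row_col[OF this(2)]
      have "u (row x - 1, col x) < u (row y - 1, col y)"
        using uA lx(1) ly(1) c unfolding standard_fillings_def by simp
      then show ?thesis using Llow[OF lx(1)] Llow[OF ly(1)] lx(2) ly(2) by simp
    qed
    show "L x < L y" if c: "col x = col y \<and> row x < row y"
    proof -
      have "y \<in> Low" using xy c by (auto simp: Low_def)
      note ly = lower_row_col[OF this]
      have Ly: "L y = u (row y - 1, col y)" using Llow[OF ly(1)] ly(2) by simp
      show ?thesis
      proof (cases "row x = 0")
        case True
        have "(1, col y) \<in> cells (l # mu)"
          using cells_down_closed[OF partition row_col_in[OF xy(2)]] c by simp
        then have "col x < part (l # mu) 2" using c by (cases mu) (auto simp: cells_def part_def)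
        \<comment> \<open>With this the truncated subtraction in the bound on \<open>i\<close> is a
          true one, and \<open>m\<close> is at least the second part.\<close>
        moreover have "part (l # mu) 2 \<le> n"
        proof (cases mu)
          case (Cons a b)
          then show ?thesis using n_eq by (simp add: part_def)
        qed (simp add: part_def)
        ultimately have "col x < m" using i by (simp add: m_def)
        then have "L x = 0" using Lup[OF upper_col(1)[OF xy(1) True]] upper_col(2)[OF xy(1) True] by (simp add: ys_def nth_append)
        moreover have "L y > 0" using uin[OF ly(1)] A(1) Ly by auto
        ultimately show ?thesis by simp
      next
        case False
        then have "x \<in> Low" using xy by (auto simp: Low_def)
        note lx = lower_row_col[OF this]
        have "row x - 1 < row y - 1" using False c by linarith
        then have "u (row x - 1, col x) < u (row y - 1, col y)"
          using uA lx(1) ly(1) c unfolding standard_fillings_def by simp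
        then show ?thesis using Llow[OF lx(1)] lx(2) Ly by simp
      qed
    qed
  qed
  then have "d \<in> label_lists i" using d P by simp
  moreover have "lower_labels (word_label d) = u"
  proof (rule extensionalityI[where A = "cells mu"])
    show "lower_labels (word_label d) c = u c" if "c \<in> cells mu" for c
      using Llow[OF that] that d(4) by (simp add: lower_labels_def)
  qed (use uA in \<open>auto simp: lower_labels_def standard_fillings_def\<close>)
  ultimately show ?thesis by blast
qed

lemma card_label_lists:
  assumes "i \<le> n - part (l # mu) 2"
  shows "card (label_lists i) = (i choose sum_list mu) * num_standard_tableaux mu"
proof -
  have "(\<lambda>d. lower_labels (word_label d)) ` label_lists i = lower_fillings i"
  proof (intro equalityI subsetI)
    fix u assume "u \<in> (\<lambda>d. lower_labels (word_label d)) ` label_lists i"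
    then obtain d where "d \<in> label_lists i" "u = lower_labels (word_label d)" by (rule imageE)
    then show "u \<in> lower_fillings i" by (simp only: lower_labels_in)
  next
    fix u assume "u \<in> lower_fillings i"
    then show "u \<in> (\<lambda>d. lower_labels (word_label d)) ` label_lists i" by (rule lower_labels_surj[OF assms])
  qed
  then have "card (label_lists i) = card (lower_fillings i)"
    using card_image[OF inj_lower_labels[of i]] by (simp only:)
  also have "\<dots> = (i choose sum_list mu) * num_standard_tableaux mu"
    by (rule card_standard_fillings_subsets)
  finally show ?thesis .
qed

end

theorem proposition1:
  fixes n r :: nat and lam :: "nat list"
  assumes "n \<ge> 1"
    and "partition_of lam n"
    and "1 \<le> r" and "r \<le> n - part lam 2"
  shows "rep_multiplicity (sym_group n) (specht lam) (defining_rep_power n r) =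
    num_standard_tableaux (tl lam) *
      (\<Sum>i = sum_list (tl lam)..r. (i choose sum_list (tl lam)) * Stirling r i)"
proof -
  obtain l mu where lam: "lam = l # mu"
    using assms(1,2) by (cases lam) (auto simp: partition_of_def)
  obtain t where t: "tableau (l # mu) t" using tableau_exists .
  interpret young_tableau_Cons l mu n t
    using assms(2) t unfolding lam by unfold_locales
  interpret specht_module "l # mu" n t
    by (intro specht_module.intro labelled_rep_specht young_tableau_axioms)
  let ?k = "sum_list mu"
  have "rep_multiplicity (sym_group n) (specht (l # mu)) (defining_rep_power n r) =
      card {w \<in> words {1..n} r. semistandard (word_label (remdups w))}"
    using multiplicity_eq_card_semistandard by (simp add: word_label_remdups)
  also have "\<dots> = (\<Sum>i\<le>r. Stirling r i *
      card {d. distinct d \<and> set d \<subseteq> {1..n} \<and> length d = i \<and> semistandard (word_label d)})"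
    by (rule card_words_by_remdups) simp
  \<comment> \<open>Every \<open>i \<le> r\<close> satisfies the bound of
    \<open>card_label_lists\<close>, by the hypothesis on \<open>r\<close>.\<close>
  also have "\<dots> = (\<Sum>i\<le>r. Stirling r i * ((i choose ?k) * num_standard_tableaux mu))"
    using card_label_lists assms(4) by (intro sum.cong) (simp_all add: lam)
  \<comment> \<open>For \<open>i < ?k\<close> the binomial coefficient is \<open>0\<close>; if
    \<open>?k > r\<close>, both sums are \<open>0\<close>.\<close>
  also have "\<dots> = (\<Sum>i = ?k..r. Stirling r i * ((i choose ?k) * num_standard_tableaux mu))"
    by (rule sum.mono_neutral_right) auto
  also have "\<dots> = num_standard_tableaux mu * (\<Sum>i = ?k..r. (i choose ?k) * Stirling r i)"
    by (simp add: sum_distrib_left ac_simps)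
  finally show ?thesis by (simp add: lam)
qed

end
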